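(* Let $1\leq p<\infty$, and let $U$, $V$, $T_M$, $I_{U,V}$, the Boolean algebra $\mathfrak{B}$ and the lattice $\mathfrak{H}(U,V)$ be as defined in the context. The (well-defined) map $\varphi\colon\mathfrak{B}\to\mathfrak{H}(U,V)$ given by $$\varphi([M])=\begin{cases}\mathcal{J}^{T_M}(U,V)&\text{if $M$ is infinite},\\ \mathcal{J}^{I_{U,V}}(U,V)&\text{if $M$ is finite},\end{cases}$$ is injective, monotone and preserves the join operation. In particular, $\mathcal{L}(U,V)$ has continuum many closed ideals between $\mathcal{J}^{I_{U,V}}(U,V)$ and $\mathcal{FS}(U,V)$.
   Context: Scalars are real; operators are bounded linear maps; $\mathcal{L}(X,Y)$ is the space of operators from $X$ to $Y$, and $\mathcal{L}(X)=\mathcal{L}(X,X)$. An ideal of $\mathcal{L}(X,Y)$ is a linear subspace $\mathcal{J}$ with $ATB\in\mathcal{J}$ for all $A\in\mathcal{L}(Y)$, $T\in\mathcal{J}$, $B\in\mathcal{L}(X)$; a closed ideal is an ideal closed in the operator norm. $\mathfrak{H}(X,Y)$ is the set of closed ideals of $\mathcal{L}(X,Y)$, a lattice under inclusion with meet $\mathcal{I}\wedge\mathcal{J}=\mathcal{I}\cap\mathcal{J}$ and join $\mathcal{I}\vee\mathcal{J}=\overline{\mathcal{I}+\mathcal{J}}$. For an operator $T\colon W\to Z$, $\mathcal{J}^T(X,Y)$ is the closed linear span in $\mathcal{L}(X,Y)$ of $\{ATB : A\in\mathcal{L}(Z,Y),\ B\in\mathcal{L}(X,W)\}$. $\mathcal{FS}(X,Y)$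 is the closed ideal of finitely strictly singular operators: $T\in\mathcal{L}(X,Y)$ is finitely strictly singular if for all $\varepsilon>0$ there is $n\in\mathbb{N}$ such that every subspace $E\subset X$ of dimension at least $n$ contains a vector $x$ with $\|Tx\|<\varepsilon\|x\|$. "Continuum many closed ideals between $\mathcal{I}$ and $\mathcal{I}'$" means a family of $2^{\aleph_0}$ pairwise distinct closed ideals $\mathcal{J}$ with $\mathcal{I}\subset\mathcal{J}\subset\mathcal{I}'$. Setting. Fix $1\leq p<\infty$. Fix positive integers $u_1<v_1<u_2<v_2<\dots$ and, for each $n\in\mathbb{N}$, unit vectors $g^{(n)}_1,\dots,g^{(n)}_{v_n}$ in $\ell_2^{u_n}$ (such choices exist) so that, with $s_n=(2u_n)^{p/2}n^p$ if $2\leq p<\infty$ and $s_n=2u_n n^2$ if $1\leq p\leq 2$ (and $s_0=0$), the following hold for all $n\in\mathbb{N}$: (1) $u_n\geq 19n^3(6n+1)^{u_1+\dots+u_{n-1}}$; (2) $v_n\geq 9n^3 s_n$; (3) for every $J\subset\{1,\dots,v_n\}$ with $|J|\leq\max\{s_{n-1}+1,\,19n^2\}$ one has $\frac12\sum_{i\in J}|a_i|^2\leq\big\|\sum_{i\in J}a_ig^{(n)}_i\big\|^2\leq 2\sum_{i\in J}|a_i|^2$ for all $(a_i)_{i\in J}\subset\mathbb{R}$, and $\sum_{i\in J}|\langle x,g^{(n)}_i\rangle|^2\leq 2\|x\|^2$ for all $x\in\ell_2^{u_n}$. Define $T_n\colon\ell_2^{u_n}\to\ell_\infty^{v_n}$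 by $T_nx=(\langle x,g^{(n)}_i\rangle)_{i=1}^{v_n}$ (so $\|T_n\|=1$). Set $U=\big(\bigoplus_{n=1}^\infty\ell_2^{u_n}\big)_{\ell_p}$ and $V=\big(\bigoplus_{n=1}^\infty\ell_\infty^{v_n}\big)_{c_0}$. For infinite $M\subset\mathbb{N}$ define $T_M\colon U\to V$ by $(x_n)\mapsto(y_n)$, where $y_n=T_n(x_n)$ if $n\in M$ and $y_n=0$ otherwise. The formal inclusion $I_{U,V}\colon U\to V$: by concatenating coordinates of the blocks, regard elements of $U$ as scalar sequences $(x_i)_{i=1}^\infty$ with $\sum_n\big(\sum_{i=t_{n-1}+1}^{t_n}|x_i|^2\big)^{p/2}<\infty$, where $t_n=u_1+\dots+u_n$ ($t_0=0$), and, again by concatenating coordinates, identify $V$ with $c_0$; then $I_{U,V}$ maps the sequence $(x_i)$ to itself. (Equivalently, reblocking $c_0$ as $\big(\bigoplus_n\ell_\infty^{u_n}\big)_{c_0}$, it is the diagonal operator whose $n$th entry is the formal identity $\ell_2^{u_n}\to\ell_\infty^{u_n}$.) $\mathfrak{B}$ is the Boolean algebra obtained as the quotient of the power set of $\mathbb{N}$ by the relation $M\sim N$ iff the symmetric difference of $M$ and $N$ is finite; $[M]$ is the class of $M$; the order is $[M]\leq[N]$ iff $M\setminus N$ is finite, and the join is $[M]\vee[N]=[M\cup N]$. *)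

theory Defs
  imports "HOL-Analysis.Analysis" "HOL-Library.Function_Algebras" "HOL-Library.Equipollence"
begin

section \<open>Pointwise vector space structure on functions\<close>

text \<open>Addition, zero and negation on functions come from \<^theory>\<open>HOL-Library.Function_Algebras\<close>.
  Both vectors (families of coordinates) and operators live in such function types.\<close>

instantiation "fun" :: (type, real_vector) real_vector
begin

definition scaleR_fun :: "real \<Rightarrow> ('a \<Rightarrow> 'b) \<Rightarrow> 'a \<Rightarrow> 'b" where
  "scaleR_fun c f = (\<lambda>x. c *\<^sub>R f x)"

instance
  by standard (simp_all add: scaleR_fun_def plus_fun_def fun_eq_iff scaleR_add_left scaleR_add_right)

end


section \<open>Normed spaces with an explicit carrier, and bounded operators\<close>

text \<open>The spaces below depend on numerical parameters (block sizes and an exponent), so they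
  are given as a carrier inside an ambient real vector space together with a norm that is
  only meaningful on the carrier.\<close>

record 'a nspace =
  carr :: "'a set"
  nrm :: "'a \<Rightarrow> real"

text \<open>Operators are extended by \<open>0\<close> outside the carrier of their domain, so that distinct
  functions are distinct operators, and so that sums, scalar multiples and composites of
  operators are the pointwise ones.\<close>

definition ops :: "('a::real_vector, 'c) nspace_scheme \<Rightarrow> ('b::real_vector, 'd) nspace_scheme \<Rightarrow> ('a \<Rightarrow> 'b) set" where
  "ops X Y = {T.
     (\<forall>x\<in>carr X. T x \<in> carr Y) \<and>
     (\<forall>x\<in>carr X. \<forall>y\<in>carr X. T (x + y) = T x + T y) \<and>
     (\<forall>c. \<forall>x\<in>carr X. T (c *\<^sub>R x) = c *\<^sub>R T x) \<and>
     (\<exists>K. \<forall>x\<in>carr X. nrm Y (T x) \<le> K * nrm X x) \<and>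
     (\<forall>x. x \<notin> carr X \<longrightarrow> T x = 0)}"

definition opnorm :: "('a::real_vector, 'c) nspace_scheme \<Rightarrow> ('b::real_vector, 'd) nspace_scheme \<Rightarrow> ('a \<Rightarrow> 'b) \<Rightarrow> real" where
  "opnorm X Y T = (SUP x\<in>{x \<in> carr X. nrm X x \<le> 1}. nrm Y (T x))"

definition op_closure :: "('a::real_vector, 'c) nspace_scheme \<Rightarrow> ('b::real_vector, 'd) nspace_scheme
    \<Rightarrow> ('a \<Rightarrow> 'b) set \<Rightarrow> ('a \<Rightarrow> 'b) set" where
  "op_closure X Y \<A> = {T \<in> ops X Y. \<forall>\<epsilon>>0. \<exists>S\<in>\<A>. opnorm X Y (T - S) < \<epsilon>}"


section \<open>Closed operator ideals\<close>

definition op_ideal :: "('a::real_vector, 'c) nspace_scheme \<Rightarrow> ('b::real_vector, 'd) nspace_scheme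
    \<Rightarrow> ('a \<Rightarrow> 'b) set \<Rightarrow> bool" where
  "op_ideal X Y \<J> \<longleftrightarrow> \<J> \<subseteq> ops X Y \<and> subspace \<J> \<and>
     (\<forall>A\<in>ops Y Y. \<forall>T\<in>\<J>. \<forall>B\<in>ops X X. A \<circ> T \<circ> B \<in> \<J>)"

definition closed_ideals :: "('a::real_vector, 'c) nspace_scheme \<Rightarrow> ('b::real_vector, 'd) nspace_scheme
    \<Rightarrow> ('a \<Rightarrow> 'b) set set" where
  "closed_ideals X Y = {\<J>. op_ideal X Y \<J> \<and> op_closure X Y \<J> = \<J>}"

definition ideal_join :: "('a::real_vector, 'c) nspace_scheme \<Rightarrow> ('b::real_vector, 'd) nspace_scheme
    \<Rightarrow> ('a \<Rightarrow> 'b) set \<Rightarrow> ('a \<Rightarrow> 'b) set \<Rightarrow> ('a \<Rightarrow> 'b) set" where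
  "ideal_join X Y \<I> \<J> = op_closure X Y {S + T | S T. S \<in> \<I> \<and> T \<in> \<J>}"

text \<open>\<open>ideal_gen W Z T X Y\<close> is \<open>\<J>\<^sup>T(X,Y)\<close> for an operator \<open>T\<close> from \<open>W\<close> to \<open>Z\<close>.\<close>

definition ideal_gen :: "('e::real_vector, 'c) nspace_scheme \<Rightarrow> ('f::real_vector, 'd) nspace_scheme
    \<Rightarrow> ('e \<Rightarrow> 'f) \<Rightarrow> ('a::real_vector, 'g) nspace_scheme \<Rightarrow> ('b::real_vector, 'h) nspace_scheme
    \<Rightarrow> ('a \<Rightarrow> 'b) set" where
  "ideal_gen W Z T X Y =
     op_closure X Y (span {A \<circ> T \<circ> B | A B. A \<in> ops Z Y \<and> B \<in> ops X W})"

text \<open>``Dimension at least \<open>n\<close>'' is expressed by \<open>n\<close> linearly independent vectors, because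
  \<^const>\<open>dim\<close> is \<open>0\<close> on infinite-dimensional subspaces.\<close>

definition fin_strictly_singular :: "('a::real_vector, 'c) nspace_scheme \<Rightarrow> ('b::real_vector, 'd) nspace_scheme
    \<Rightarrow> ('a \<Rightarrow> 'b) set" where
  "fin_strictly_singular X Y = {T \<in> ops X Y. \<forall>\<epsilon>>0. \<exists>n::nat. \<forall>E.
     subspace E \<and> E \<subseteq> carr X \<and> (\<exists>B\<subseteq>E. finite B \<and> independent B \<and> card B = n)
     \<longrightarrow> (\<exists>x\<in>E. nrm Y (T x) < \<epsilon> * nrm X x)}"


section \<open>The spaces \<open>U\<close> and \<open>V\<close>\<close>

text \<open>\<open>k\<close>-dimensional vectors are sequences vanishing from coordinate \<open>k\<close> on.\<close>

definition l2_fin :: "nat \<Rightarrow> (nat \<Rightarrow> real) nspace" where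
  "l2_fin k = \<lparr>carr = {x. \<forall>i\<ge>k. x i = 0}, nrm = (\<lambda>x. L2_set x {..<k})\<rparr>"

definition linf_fin :: "nat \<Rightarrow> (nat \<Rightarrow> real) nspace" where
  "linf_fin k = \<lparr>carr = {x. \<forall>i\<ge>k. x i = 0},
                 nrm = (\<lambda>x. Max (insert 0 ((\<lambda>i. \<bar>x i\<bar>) ` {..<k})))\<rparr>"

definition inner_fin :: "nat \<Rightarrow> (nat \<Rightarrow> real) \<Rightarrow> (nat \<Rightarrow> real) \<Rightarrow> real" where
  "inner_fin k x y = (\<Sum>i<k. x i * y i)"

definition lp_sum :: "real \<Rightarrow> (nat \<Rightarrow> 'a nspace) \<Rightarrow> (nat \<Rightarrow> 'a) nspace" where
  "lp_sum p X = \<lparr>carr = {x. (\<forall>n. x n \<in> carr (X n)) \<and> summable (\<lambda>n. nrm (X n) (x n) powr p)},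
                 nrm = (\<lambda>x. (\<Sum>n. nrm (X n) (x n) powr p) powr (1 / p))\<rparr>"

definition c0_sum :: "(nat \<Rightarrow> 'a nspace) \<Rightarrow> (nat \<Rightarrow> 'a) nspace" where
  "c0_sum X = \<lparr>carr = {x. (\<forall>n. x n \<in> carr (X n)) \<and> (\<lambda>n. nrm (X n) (x n)) \<longlonglongrightarrow> 0},
               nrm = (\<lambda>x. SUP n. nrm (X n) (x n))\<rparr>"

text \<open>Blocks and coordinates are numbered from \<open>0\<close>: the values \<open>u n\<close>, \<open>v n\<close> and \<open>g n i\<close> stand for
  \<open>u\<^bsub>n+1\<^esub>\<close>, \<open>v\<^bsub>n+1\<^esub>\<close> and the vector \<open>g\<^bsub>i+1\<^esub>\<close> of block \<open>n+1\<close> in numbering from \<open>1\<close>.\<close>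

definition U_space :: "real \<Rightarrow> (nat \<Rightarrow> nat) \<Rightarrow> (nat \<Rightarrow> nat \<Rightarrow> real) nspace" where
  "U_space p u = lp_sum p (\<lambda>n. l2_fin (u n))"

definition V_space :: "(nat \<Rightarrow> nat) \<Rightarrow> (nat \<Rightarrow> nat \<Rightarrow> real) nspace" where
  "V_space v = c0_sum (\<lambda>n. linf_fin (v n))"

text \<open>Here the argument keeps its numbering from \<open>1\<close>: \<open>s_seq p u n\<close> is \<open>s\<^sub>n\<close>, with \<open>s\<^sub>0 = 0\<close>, which
  is why \<open>u\<close> is shifted. The two formulas agree for \<open>p = 2\<close>.\<close>

fun s_seq :: "real \<Rightarrow> (nat \<Rightarrow> nat) \<Rightarrow> nat \<Rightarrow> real" where
  "s_seq p u 0 = 0"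
| "s_seq p u (Suc n) =
     (if 2 \<le> p then (2 * real (u n)) powr (p / 2) * real (Suc n) powr p
      else 2 * real (u n) * real (Suc n) ^ 2)"


section \<open>The operators \<open>T\<^sub>M\<close> and the formal inclusion\<close>

definition T_block :: "(nat \<Rightarrow> nat) \<Rightarrow> (nat \<Rightarrow> nat) \<Rightarrow> (nat \<Rightarrow> nat \<Rightarrow> nat \<Rightarrow> real)
    \<Rightarrow> nat \<Rightarrow> (nat \<Rightarrow> real) \<Rightarrow> nat \<Rightarrow> real" where
  "T_block u v g n x = (\<lambda>i. if i < v n then inner_fin (u n) x (g n i) else 0)"

definition T_op :: "real \<Rightarrow> (nat \<Rightarrow> nat) \<Rightarrow> (nat \<Rightarrow> nat) \<Rightarrow> (nat \<Rightarrow> nat \<Rightarrow> nat \<Rightarrow> real)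
    \<Rightarrow> nat set \<Rightarrow> (nat \<Rightarrow> nat \<Rightarrow> real) \<Rightarrow> nat \<Rightarrow> nat \<Rightarrow> real" where
  "T_op p u v g M x =
     (if x \<in> carr (U_space p u) then (\<lambda>n. if n \<in> M then T_block u v g n (x n) else 0) else 0)"

text \<open>For positive block sizes \<open>d\<close>, \<open>concat_blocks d\<close> concatenates the blocks of a family into one
  sequence, and \<open>split_blocks d\<close> cuts a sequence into blocks. In \<open>concat_blocks\<close>, \<open>n\<close> is the
  block containing position \<open>k\<close>.\<close>

definition concat_blocks :: "(nat \<Rightarrow> nat) \<Rightarrow> (nat \<Rightarrow> nat \<Rightarrow> real) \<Rightarrow> nat \<Rightarrow> real" where
  "concat_blocks d x k = (let n = (LEAST n. k < (\<Sum>m\<le>n. d m)) in x n (k - (\<Sum>m<n. d m)))"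

definition split_blocks :: "(nat \<Rightarrow> nat) \<Rightarrow> (nat \<Rightarrow> real) \<Rightarrow> nat \<Rightarrow> nat \<Rightarrow> real" where
  "split_blocks d y n i = (if i < d n then y ((\<Sum>m<n. d m) + i) else 0)"

definition formal_incl :: "real \<Rightarrow> (nat \<Rightarrow> nat) \<Rightarrow> (nat \<Rightarrow> nat)
    \<Rightarrow> (nat \<Rightarrow> nat \<Rightarrow> real) \<Rightarrow> nat \<Rightarrow> nat \<Rightarrow> real" where
  "formal_incl p u v x =
     (if x \<in> carr (U_space p u) then split_blocks v (concat_blocks u x) else 0)"


section \<open>The Boolean algebra of sets of naturals modulo finite sets\<close>

lemma finite_subset_Un: "finite A \<Longrightarrow> finite B \<Longrightarrow> C \<subseteq> A \<union> B \<Longrightarrow> finite C"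
  by (metis finite_Un finite_subset)

quotient_type natset_mod_fin = "nat set" / "\<lambda>M N. finite ((M - N) \<union> (N - M))"
proof (rule equivpI)
  show "reflp (\<lambda>M N::nat set. finite ((M - N) \<union> (N - M)))"
    by (simp add: reflp_def)
  show "symp (\<lambda>M N::nat set. finite ((M - N) \<union> (N - M)))"
    by (simp add: symp_def)
  show "transp (\<lambda>M N::nat set. finite ((M - N) \<union> (N - M)))"
  proof (rule transpI)
    fix M N K :: "nat set"
    assume "finite ((M - N) \<union> (N - M))" "finite ((N - K) \<union> (K - N))"
    then have "finite (((M - N) \<union> (N - M)) \<union> ((N - K) \<union> (K - N)))" by blast
    then show "finite ((M - K) \<union> (K - M))" by (rule rev_finite_subset) blast
  qed
qed

lift_definition mod_fin :: "nat set \<Rightarrow> natset_mod_fin" is "\<lambda>M. M" .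

instantiation natset_mod_fin :: boolean_algebra
begin

lift_definition less_eq_natset_mod_fin :: "natset_mod_fin \<Rightarrow> natset_mod_fin \<Rightarrow> bool"
  is "\<lambda>M N. finite (M - N)"
proof -
  have *: "finite (M' - N')"
    if "finite ((M - M') \<union> (M' - M))" "finite ((N - N') \<union> (N' - N))" "finite (M - N)"
    for M M' N N' :: "nat set"
  proof -
    have "finite (((M - M') \<union> (M' - M)) \<union> ((N - N') \<union> (N' - N)) \<union> (M - N))"
      using that by blast
    then show ?thesis by (rule rev_finite_subset) blast
  qed
  show "finite (M - N) = finite (M' - N')"
    if "finite ((M - M') \<union> (M' - M))" "finite ((N - N') \<union> (N' - N))" for M M' N N' :: "nat set"
    using *[of M M' N N'] *[of M' M N' N] that by (metis Un_commute)
qed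

definition less_natset_mod_fin :: "natset_mod_fin \<Rightarrow> natset_mod_fin \<Rightarrow> bool" where
  "less_natset_mod_fin a b \<longleftrightarrow> a \<le> b \<and> \<not> b \<le> a"

lift_definition sup_natset_mod_fin :: "natset_mod_fin \<Rightarrow> natset_mod_fin \<Rightarrow> natset_mod_fin"
  is "(\<union>)"
  by (erule (1) finite_subset_Un) auto

lift_definition inf_natset_mod_fin :: "natset_mod_fin \<Rightarrow> natset_mod_fin \<Rightarrow> natset_mod_fin"
  is "(\<inter>)"
  by (erule (1) finite_subset_Un) auto

lift_definition minus_natset_mod_fin :: "natset_mod_fin \<Rightarrow> natset_mod_fin \<Rightarrow> natset_mod_fin"
  is "(-)"
  by (erule (1) finite_subset_Un) auto

lift_definition uminus_natset_mod_fin :: "natset_mod_fin \<Rightarrow> natset_mod_fin"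
  is "uminus"
  by (erule finite_subset[rotated]) blast

lift_definition bot_natset_mod_fin :: natset_mod_fin is "{}" .

lift_definition top_natset_mod_fin :: natset_mod_fin is "UNIV" .

instance
proof
  fix a b c :: natset_mod_fin
  show "a < b \<longleftrightarrow> a \<le> b \<and> \<not> b \<le> a" by (rule less_natset_mod_fin_def)
  show "a \<le> a" by transfer simp
  show "a \<le> c" if "a \<le> b" "b \<le> c"
    using that by transfer (erule (1) finite_subset_Un, auto)
  show "a = b" if "a \<le> b" "b \<le> a" using that by transfer simp
  show "inf a b \<le> a" by transfer (rule finite_subset[OF _ finite.emptyI], auto)
  show "inf a b \<le> b" by transfer (rule finite_subset[OF _ finite.emptyI], auto)
  show "a \<le> inf b c" if "a \<le> b" "a \<le> c"
    using that by transfer (erule (1) finite_subset_Un, auto)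
  show "a \<le> sup a b" by transfer (rule finite_subset[OF _ finite.emptyI], auto)
  show "b \<le> sup a b" by transfer (rule finite_subset[OF _ finite.emptyI], auto)
  show "sup b c \<le> a" if "b \<le> a" "c \<le> a"
    using that by transfer (erule (1) finite_subset_Un, auto)
  show "bot \<le> a" by transfer simp
  show "a \<le> top" by transfer simp
  show "sup a (inf b c) = inf (sup a b) (sup a c)"
    by transfer (rule finite_subset[OF _ finite.emptyI], auto)
  show "inf a (- a) = bot" by transfer (rule finite_subset[OF _ finite.emptyI], auto)
  show "sup a (- a) = top" by transfer (rule finite_subset[OF _ finite.emptyI], auto)
  show "a - b = inf a (- b)" by transfer (rule finite_subset[OF _ finite.emptyI], auto)
qed

end

end

theory Submission
  imports Defs
begin

text \<open>
  If \<open>m > n\<close>, the vectors \<open>g m i\<close> with \<open>i < u n\<close> form a Riesz basis of their span, so a biorthogonal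
  system lets the formal identity of block \<open>n\<close> factor through block \<open>m\<close>; hence the formal inclusion
  factors through \<open>T\<^sub>M\<close> for every infinite \<open>M\<close>. Conversely, each single block of \<open>T\<^sub>M\<close> has finite rank
  and factors through the formal inclusion. This yields well-definedness, monotonicity and joins.

  Injectivity: let \<open>T\<^sub>M\<close> be close to \<open>S = \<Sum>i<k. A\<^sub>i T\<^sub>N B\<^sub>i\<close> with contractions \<open>B\<^sub>i\<close>, and take a large
  \<open>n \<in> M - N\<close>. Every coordinate of \<open>T\<^sub>N B\<^sub>i\<close>, restricted to block \<open>n\<close>, is the inner product with a vector
  \<open>h\<close> of norm at most \<open>1\<close>, and by the Bessel condition \<open>|\<langle>h, g n j\<rangle>| \<ge> 1/(n+1)\<close> for at most \<open>2(n+1)\<^sup>2\<close>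
  indices \<open>j\<close>. There are few relevant \<open>h\<close>: at most \<open>n u\<^sub>n\<close> from earlier blocks, and at most \<open>s_seq p u (n + 1)\<close>
  of norm at least \<open>1/(n+1)\<close> from later ones, again by the Bessel condition. As \<open>v\<^sub>n\<close> is
  much larger, some \<open>j\<close> makes all coordinates of \<open>T\<^sub>N B\<^sub>i (g n j)\<close> small, while coordinate \<open>j\<close> of
  \<open>T\<^sub>M (g n j)\<close> is \<open>1\<close>.

  Finite strict singularity: by Milman's lemma a subspace of large dimension contains a vector at
  which many coordinates of the \<open>T\<^sub>M B\<^sub>i\<close> equal \<open>\<plusminus>1\<close> and none is larger; the Bessel condition then
  forces the vector to have large norm.
\<close>

section \<open>Operators and closed ideals\<close>

text \<open>The Bessel and Riesz conditions hold only for index sets of bounded size, and this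
  shapes every count. In block \<open>m\<close> sets of size at most \<open>s m + 1\<close> are
  admissible, so coordinates in blocks later than \<open>n\<close> can be counted only while there
  are at most \<open>s (Suc n) + 1\<close> of them; the count then returns at most
  \<open>s (Suc n)\<close>, which excludes any larger collection. The value \<open>s (Suc n)\<close>
  is exactly what this count produces: with N = n + 1 it is 2 N^2 u_n for p < 2, and Jensen's
  inequality turns it into (2 u_n)^(p/2) N^p for p >= 2. The other bound, 19 N^2, admits the 2 N^2 +
  1 indices needed inside block \<open>n\<close> and the unit coordinates in the proof of finite
  strict singularity.

  Elements of an ideal are replaced by sums of \<open>k\<close> terms before \<open>n\<close> is
  chosen, with all size moved into the outer factors, so that \<open>n\<close> may dominate both
  \<open>k\<close> and their bound.

  The ideal of the finite class has its own generator. It is separated from \<open>JT M\<close> by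
  splitting \<open>M\<close> into two infinite halves: the ideal of one half contains
  \<open>JI\<close> and misses \<open>T M\<close>.\<close>

locale normed_carrier =
  fixes X :: "'a::real_vector nspace"
  assumes carr_subspace: "subspace (carr X)"
    and nrm_nonneg: "x \<in> carr X \<Longrightarrow> 0 \<le> nrm X x"
    and nrm_triangle: "x \<in> carr X \<Longrightarrow> y \<in> carr X \<Longrightarrow> nrm X (x + y) \<le> nrm X x + nrm X y"
    and nrm_scale: "x \<in> carr X \<Longrightarrow> nrm X (c *\<^sub>R x) = \<bar>c\<bar> * nrm X x"
begin

lemma carr_zero: "0 \<in> carr X"
  and carr_add: "x \<in> carr X \<Longrightarrow> y \<in> carr X \<Longrightarrow> x + y \<in> carr X"
  and carr_scale: "x \<in> carr X \<Longrightarrow> c *\<^sub>R x \<in> carr X"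
  using carr_subspace by (auto simp: subspace_def)

lemma nrm_zero: "nrm X 0 = 0"
  using nrm_scale[OF carr_zero, of 0] by simp

end

lemma opsI:
  assumes "\<And>x. x \<in> carr X \<Longrightarrow> T x \<in> carr Y"
    and "\<And>x y. x \<in> carr X \<Longrightarrow> y \<in> carr X \<Longrightarrow> T (x + y) = T x + T y"
    and "\<And>c x. x \<in> carr X \<Longrightarrow> T (c *\<^sub>R x) = c *\<^sub>R T x"
    and "\<And>x. x \<in> carr X \<Longrightarrow> nrm Y (T x) \<le> K * nrm X x"
    and "\<And>x. x \<notin> carr X \<Longrightarrow> T x = 0"
  shows "T \<in> ops X Y"
  using assms unfolding ops_def by blast

lemma ops_carr: "T \<in> ops X Y \<Longrightarrow> x \<in> carr X \<Longrightarrow> T x \<in> carr Y"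
  and ops_add: "T \<in> ops X Y \<Longrightarrow> x \<in> carr X \<Longrightarrow> y \<in> carr X \<Longrightarrow> T (x + y) = T x + T y"
  and ops_scale: "T \<in> ops X Y \<Longrightarrow> x \<in> carr X \<Longrightarrow> T (c *\<^sub>R x) = c *\<^sub>R T x"
  and ops_outside: "T \<in> ops X Y \<Longrightarrow> x \<notin> carr X \<Longrightarrow> T x = 0"
  unfolding ops_def by blast+

lemma ops_bounded:
  assumes "normed_carrier X" "T \<in> ops X Y"
  obtains K where "0 < K" "\<And>x. x \<in> carr X \<Longrightarrow> nrm Y (T x) \<le> K * nrm X x"
proof -
  obtain K where K: "\<And>x. x \<in> carr X \<Longrightarrow> nrm Y (T x) \<le> K * nrm X x"
    using assms(2) unfolding ops_def by blast
  have "nrm Y (T x) \<le> (\<bar>K\<bar> + 1) * nrm X x" if "x \<in> carr X" for x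
    using K[OF that] normed_carrier.nrm_nonneg[OF assms(1) that]
    by (smt (verit) mult_right_mono)
  then show ?thesis by (intro that[of "\<bar>K\<bar> + 1"]) auto
qed

lemma ops_zero:
  assumes "normed_carrier X" "T \<in> ops X Y"
  shows "T 0 = 0"
  using ops_scale[OF assms(2) normed_carrier.carr_zero[OF assms(1)], of 0] by simp

lemma ops_in_carr:
  assumes "normed_carrier Y" "T \<in> ops X Y"
  shows "T x \<in> carr Y"
  using assms ops_carr ops_outside normed_carrier.carr_zero by metis

lemma scaleR_fun_apply [simp]: "(c *\<^sub>R f) x = c *\<^sub>R f x"
  by (simp add: scaleR_fun_def)

lemma sum_fun_apply [simp]: "(\<Sum>i\<in>A. f i) x = (\<Sum>i\<in>A. f i x)"
  by (induction A rule: infinite_finite_induct) auto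

lemma subspace_ops:
  assumes X: "normed_carrier X" and Y: "normed_carrier Y"
  shows "subspace (ops X Y)"
proof -
  interpret X: normed_carrier X by fact
  interpret Y: normed_carrier Y by fact
  have zero: "0 \<in> ops X Y"
    by (rule opsI[where K=0]) (auto simp: Y.carr_zero Y.nrm_zero)
  have add: "S + T \<in> ops X Y" if S: "S \<in> ops X Y" and T: "T \<in> ops X Y" for S T
  proof -
    obtain K where K: "\<And>x. x \<in> carr X \<Longrightarrow> nrm Y (S x) \<le> K * nrm X x" using S X ops_bounded by metis
    obtain L where L: "\<And>x. x \<in> carr X \<Longrightarrow> nrm Y (T x) \<le> L * nrm X x" using T X ops_bounded by metis
    show ?thesis
    proof (rule opsI[where K="K + L"])
      fix x assume x: "x \<in> carr X"
      then show "nrm Y ((S + T) x) \<le> (K + L) * nrm X x"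
        using Y.nrm_triangle[OF ops_carr[OF S x] ops_carr[OF T x]] K[OF x] L[OF x]
        by (simp add: algebra_simps)
    qed (auto simp: ops_carr[OF S] ops_carr[OF T] ops_add[OF S] ops_add[OF T] ops_scale[OF S]
      ops_scale[OF T] ops_outside[OF S] ops_outside[OF T] Y.carr_add algebra_simps)
  qed
  have "c *\<^sub>R T \<in> ops X Y" if T: "T \<in> ops X Y" for c T
  proof -
    obtain L where L: "\<And>x. x \<in> carr X \<Longrightarrow> nrm Y (T x) \<le> L * nrm X x" using T X ops_bounded by metis
    show ?thesis
    proof (rule opsI[where K="\<bar>c\<bar> * L"])
      fix x assume x: "x \<in> carr X"
      show "nrm Y ((c *\<^sub>R T) x) \<le> \<bar>c\<bar> * L * nrm X x"
        using Y.nrm_scale[OF ops_carr[OF T x]] L[OF x]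
        by (simp add: mult.assoc mult_left_mono)
    qed (auto simp: ops_carr[OF T] ops_add[OF T] ops_scale[OF T]
       ops_outside[OF T] Y.carr_scale algebra_simps)
  qed
  with zero add show ?thesis by (simp add: subspace_def)
qed

lemma ops_comp:
  assumes X: "normed_carrier X" and Y: "normed_carrier Y" and Z: "normed_carrier Z"
    and A: "A \<in> ops Y Z" and T: "T \<in> ops X Y"
  shows "A \<circ> T \<in> ops X Z"
proof -
  obtain K where K: "K > 0" "\<And>x. x \<in> carr Y \<Longrightarrow> nrm Z (A x) \<le> K * nrm Y x" using A Y ops_bounded by metis
  obtain L where L: "\<And>x. x \<in> carr X \<Longrightarrow> nrm Y (T x) \<le> L * nrm X x" using T X ops_bounded by metis
  show ?thesis
  proof (rule opsI[where K="K * L"])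
    fix x assume x: "x \<in> carr X"
    have "nrm Z (A (T x)) \<le> K * nrm Y (T x)" using K(2) ops_carr[OF T x] by blast
    also have "\<dots> \<le> K * (L * nrm X x)" using K(1) L[OF x] by simp
    finally show "nrm Z ((A \<circ> T) x) \<le> K * L * nrm X x" by (simp add: mult.assoc)
  qed (auto simp: ops_carr[OF T] ops_carr[OF A] ops_add[OF T] ops_add[OF A] ops_scale[OF T] ops_scale[OF A]
       ops_outside[OF T] ops_zero[OF Y A])
qed

lemma comp3_ops:
  assumes "normed_carrier W" "normed_carrier X" "normed_carrier Y" "normed_carrier Z"
    and "A \<in> ops Z Y" "T \<in> ops W Z" "B \<in> ops X W"
  shows "A \<circ> T \<circ> B \<in> ops X Y"
  by (rule ops_comp[OF assms(2,1,3) ops_comp[OF assms(1,4,3,5,6)] assms(7)])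

text \<open>The identity must vanish off the carrier to belong to \<open>ops X X\<close>. It serves
  as the trivial outer or inner factor where a product of three operators is required.\<close>

definition carr_id :: "'a::real_vector nspace \<Rightarrow> 'a \<Rightarrow> 'a" where
  "carr_id X x = (if x \<in> carr X then x else 0)"

lemma carr_id_ops: "normed_carrier X \<Longrightarrow> carr_id X \<in> ops X X"
  by (rule opsI[where K=1])
    (auto simp: carr_id_def normed_carrier.carr_add normed_carrier.carr_scale)

text \<open>By homogeneity a bound on the unit ball is a bound with factor \<open>nrm X x\<close>
  everywhere, so the supremum in \<open>opnorm\<close> can be forgotten. The inclusion of
  \<open>\<A>\<close> in \<open>ops X Y\<close> makes the differences bounded operators, for which
  the supremum is well behaved.\<close>

lemma op_closure_iff:
  assumes X: "normed_carrier X" and Y: "normed_carrier Y" and \<A>: "\<A> \<subseteq> ops X Y"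
  shows "T \<in> op_closure X Y \<A> \<longleftrightarrow>
    T \<in> ops X Y \<and> (\<forall>\<epsilon>>0. \<exists>S\<in>\<A>. \<forall>x\<in>carr X. nrm Y (T x - S x) \<le> \<epsilon> * nrm X x)"
proof -
  interpret X: normed_carrier X by fact
  interpret Y: normed_carrier Y by fact
  have pointwise: "nrm Y (R x) \<le> \<epsilon> * nrm X x"
    if R: "R \<in> ops X Y" and less: "opnorm X Y R < \<epsilon>" and x: "x \<in> carr X" for R \<epsilon> x
  proof -
    obtain K where K: "0 < K" "\<And>x. x \<in> carr X \<Longrightarrow> nrm Y (R x) \<le> K * nrm X x"
      using R X ops_bounded by metis
    show ?thesis
    \<comment> \<open>A vector of norm 0 cannot be normalised, and the locale does not force it to
      be 0; boundedness makes the norm of its image vanish.\<close>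
    proof (cases "nrm X x = 0")
      case True
      then show ?thesis using K(2)[OF x] by simp
    next
      case False
      then have pos: "nrm X x > 0" using X.nrm_nonneg[OF x] by simp
      define z where "z = (1 / nrm X x) *\<^sub>R x"
      have z: "z \<in> carr X" "nrm X z = 1"
        using x pos by (auto simp: z_def X.carr_scale X.nrm_scale)
      have "bdd_above ((\<lambda>x. nrm Y (R x)) ` {x \<in> carr X. nrm X x \<le> 1})"
      proof (rule bdd_aboveI2)
        fix y assume "y \<in> {x \<in> carr X. nrm X x \<le> 1}"
        then show "nrm Y (R y) \<le> K" using K(2)[of y] K(1) by (smt (verit) mem_Collect_eq mult_left_le)
      qed
      then have "nrm Y (R z) \<le> opnorm X Y R"
        unfolding opnorm_def by (rule cSUP_upper[rotated]) (use z in auto)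
      then have "nrm Y (R x) / nrm X x \<le> \<epsilon>"
        using less pos by (simp add: z_def ops_scale[OF R x] Y.nrm_scale[OF ops_carr[OF R x]])
      then show ?thesis using pos by (simp add: field_simps)
    qed
  qed
  \<comment> \<open>Half of \<open>\<epsilon>\<close> is used because a pointwise bound passes to
    the supremum only as a weak inequality.\<close>
  have less: "opnorm X Y R < \<epsilon>"
    if R: "\<And>x. x \<in> carr X \<Longrightarrow> nrm Y (R x) \<le> \<epsilon> / 2 * nrm X x" and "\<epsilon> > 0" for R \<epsilon>
  proof -
    have "opnorm X Y R \<le> \<epsilon> / 2"
      unfolding opnorm_def
    proof (rule cSUP_least)
      show "{x \<in> carr X. nrm X x \<le> 1} \<noteq> {}" using X.carr_zero X.nrm_zero by force
    next
      fix x assume "x \<in> {x \<in> carr X. nrm X x \<le> 1}"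
      then show "nrm Y (R x) \<le> \<epsilon> / 2"
        using R[of x] \<open>\<epsilon> > 0\<close> by (smt (verit) half_gt_zero mem_Collect_eq mult_left_le)
    qed
    then show ?thesis using \<open>\<epsilon> > 0\<close> by simp
  qed
  have diff: "T - S \<in> ops X Y" if "T \<in> ops X Y" "S \<in> \<A>" for T S
    using that \<A> subspace_diff[OF subspace_ops[OF X Y]] by blast
  show ?thesis
  proof
    assume T: "T \<in> op_closure X Y \<A>"
    show "T \<in> ops X Y \<and> (\<forall>\<epsilon>>0. \<exists>S\<in>\<A>. \<forall>x\<in>carr X. nrm Y (T x - S x) \<le> \<epsilon> * nrm X x)"
    proof (intro conjI allI impI)
      show "T \<in> ops X Y" using T by (simp add: op_closure_def)
    next
      fix \<epsilon> :: real assume "\<epsilon> > 0"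
      then obtain S where S: "S \<in> \<A>" "opnorm X Y (T - S) < \<epsilon>"
        using T by (auto simp: op_closure_def)
      then show "\<exists>S\<in>\<A>. \<forall>x\<in>carr X. nrm Y (T x - S x) \<le> \<epsilon> * nrm X x"
        using pointwise[OF diff[OF _ S(1)] S(2)] T
        by (intro bexI[of _ S]) (auto simp: op_closure_def)
    qed
  next
    assume T: "T \<in> ops X Y \<and> (\<forall>\<epsilon>>0. \<exists>S\<in>\<A>. \<forall>x\<in>carr X. nrm Y (T x - S x) \<le> \<epsilon> * nrm X x)"
    have "\<exists>S\<in>\<A>. opnorm X Y (T - S) < \<epsilon>" if "\<epsilon> > 0" for \<epsilon>
    proof -
      obtain S where S: "S \<in> \<A>" "\<And>x. x \<in> carr X \<Longrightarrow> nrm Y (T x - S x) \<le> \<epsilon> / 2 * nrm X x"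
        using T \<open>\<epsilon> > 0\<close> half_gt_zero by blast
      have "opnorm X Y (T - S) < \<epsilon>" using S(2) that by (intro less) auto
      then show ?thesis using S(1) by blast
    qed
    then show "T \<in> op_closure X Y \<A>" using T by (simp add: op_closure_def)
  qed
qed

lemma op_closure_superset:
  assumes "normed_carrier X" "normed_carrier Y" "\<A> \<subseteq> ops X Y"
  shows "\<A> \<subseteq> op_closure X Y \<A>"
proof
  fix T assume T: "T \<in> \<A>"
  have "nrm Y 0 = 0" using assms(2) normed_carrier.nrm_zero by blast
  moreover have "0 \<le> nrm X x" if "x \<in> carr X" for x
    using assms(1) that normed_carrier.nrm_nonneg by blast
  ultimately show "T \<in> op_closure X Y \<A>"
    unfolding op_closure_iff[OF assms] using T assms(3) by (auto intro!: bexI[of _ T])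
qed

lemma op_closure_mono: "\<A> \<subseteq> \<B> \<Longrightarrow> op_closure X Y \<A> \<subseteq> op_closure X Y \<B>"
  unfolding op_closure_def by blast

lemma op_closure_ops: "op_closure X Y \<A> \<subseteq> ops X Y"
  unfolding op_closure_def by blast

lemma op_closure_idem:
  assumes X: "normed_carrier X" and Y: "normed_carrier Y" and \<A>: "\<A> \<subseteq> ops X Y"
  shows "op_closure X Y (op_closure X Y \<A>) = op_closure X Y \<A>"
proof (rule antisym)
  interpret Y: normed_carrier Y by fact
  show "op_closure X Y (op_closure X Y \<A>) \<subseteq> op_closure X Y \<A>"
  proof
    fix T assume T: "T \<in> op_closure X Y (op_closure X Y \<A>)"
    have "\<exists>S\<in>\<A>. \<forall>x\<in>carr X. nrm Y (T x - S x) \<le> \<epsilon> * nrm X x" if "\<epsilon> > 0" for \<epsilon>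
    proof -
      obtain R where R: "R \<in> op_closure X Y \<A>" "\<And>x. x\<in>carr X \<Longrightarrow> nrm Y (T x - R x) \<le> \<epsilon>/2 * nrm X x"
        using T \<open>\<epsilon> > 0\<close> half_gt_zero unfolding op_closure_iff[OF X Y op_closure_ops] by blast
      obtain S where S: "S \<in> \<A>" "\<And>x. x\<in>carr X \<Longrightarrow> nrm Y (R x - S x) \<le> \<epsilon>/2 * nrm X x"
        using R(1) \<open>\<epsilon> > 0\<close> half_gt_zero unfolding op_closure_iff[OF X Y \<A>] by blast
      have "nrm Y (T x - S x) \<le> \<epsilon> * nrm X x" if x: "x \<in> carr X" for x
      proof -
        have "T x \<in> carr Y" "R x \<in> carr Y" "S x \<in> carr Y"
          using x T R(1) S(1) \<A> op_closure_ops ops_carr by blast+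
        then have "T x - R x \<in> carr Y" "R x - S x \<in> carr Y"
          by (auto simp: subspace_diff Y.carr_subspace)
        from Y.nrm_triangle[OF this] R(2)[OF x] S(2)[OF x] show ?thesis
          by simp
      qed
      then show ?thesis using S(1) by blast
    qed
    then show "T \<in> op_closure X Y \<A>"
      using T op_closure_ops unfolding op_closure_iff[OF X Y \<A>] by blast
  qed
  show "op_closure X Y \<A> \<subseteq> op_closure X Y (op_closure X Y \<A>)"
    by (rule op_closure_superset[OF X Y op_closure_ops])
qed

lemma op_closure_closed_ideal:
  assumes X: "normed_carrier X" and Y: "normed_carrier Y" and J: "op_ideal X Y \<J>"
  shows "op_closure X Y \<J> \<in> closed_ideals X Y"
proof -
  interpret X: normed_carrier X by fact
  interpret Y: normed_carrier Y by fact
  have \<J>: "\<J> \<subseteq> ops X Y" and sub: "subspace \<J>"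
    and ideal: "\<And>A T B. A \<in> ops Y Y \<Longrightarrow> T \<in> \<J> \<Longrightarrow> B \<in> ops X X \<Longrightarrow> A \<circ> T \<circ> B \<in> \<J>"
    using J by (auto simp: op_ideal_def)
  note iff = op_closure_iff[OF X Y \<J>]
  have "subspace (op_closure X Y \<J>)"
  proof (rule subspaceI)
    show "0 \<in> op_closure X Y \<J>"
      using op_closure_superset[OF X Y \<J>] subspace_0[OF sub] by blast
  next
    fix S T assume S: "S \<in> op_closure X Y \<J>" and T: "T \<in> op_closure X Y \<J>"
    have "\<exists>R\<in>\<J>. \<forall>x\<in>carr X. nrm Y ((S + T) x - R x) \<le> \<epsilon> * nrm X x" if "\<epsilon> > 0" for \<epsilon>
    proof -
      obtain S' where S': "S' \<in> \<J>" "\<And>x. x\<in>carr X \<Longrightarrow> nrm Y (S x - S' x) \<le> \<epsilon>/2 * nrm X x"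
        using S \<open>\<epsilon> > 0\<close> half_gt_zero unfolding iff by blast
      obtain T' where T': "T' \<in> \<J>" "\<And>x. x\<in>carr X \<Longrightarrow> nrm Y (T x - T' x) \<le> \<epsilon>/2 * nrm X x"
        using T \<open>\<epsilon> > 0\<close> half_gt_zero unfolding iff by blast
      have "nrm Y ((S + T) x - (S' + T') x) \<le> \<epsilon> * nrm X x" if x: "x \<in> carr X" for x
      proof -
        have "T x \<in> carr Y" "T' x \<in> carr Y" "S x \<in> carr Y" "S' x \<in> carr Y"
          using x S T S'(1) T'(1) \<J> op_closure_ops ops_carr by blast+
        then have "S x - S' x \<in> carr Y" "T x - T' x \<in> carr Y"
          by (auto simp: subspace_diff Y.carr_subspace)
        from Y.nrm_triangle[OF this] S'(2)[OF x] T'(2)[OF x] show ?thesis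
          by (simp add: algebra_simps)
      qed
      then show ?thesis using S'(1) T'(1) subspace_add[OF sub] by blast
    qed
    moreover have "S + T \<in> ops X Y"
      using S T op_closure_ops subspace_add[OF subspace_ops[OF X Y]] by blast
    ultimately show "S + T \<in> op_closure X Y \<J>" unfolding iff by blast
  next
    fix c T assume T: "T \<in> op_closure X Y \<J>"
    have "\<exists>R\<in>\<J>. \<forall>x\<in>carr X. nrm Y ((c *\<^sub>R T) x - R x) \<le> \<epsilon> * nrm X x" if "\<epsilon> > 0" for \<epsilon>
    proof -
      have "\<epsilon> / (\<bar>c\<bar> + 1) > 0" using that by simp
      then obtain T' where T': "T' \<in> \<J>"
        "\<And>x. x\<in>carr X \<Longrightarrow> nrm Y (T x - T' x) \<le> \<epsilon> / (\<bar>c\<bar> + 1) * nrm X x"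
        using T unfolding iff by blast
      have "nrm Y ((c *\<^sub>R T) x - (c *\<^sub>R T') x) \<le> \<epsilon> * nrm X x" if x: "x \<in> carr X" for x
      proof -
        have "T x \<in> carr Y" "T' x \<in> carr Y"
          using x T T'(1) \<J> op_closure_ops ops_carr by blast+
        then have "T x - T' x \<in> carr Y"
          by (auto simp: subspace_diff Y.carr_subspace)
        then have "nrm Y (c *\<^sub>R (T x - T' x)) = \<bar>c\<bar> * nrm Y (T x - T' x)"
          by (rule Y.nrm_scale)
        also have "\<dots> \<le> (\<bar>c\<bar> + 1) * (\<epsilon> / (\<bar>c\<bar> + 1) * nrm X x)"
          using T'(2)[OF x] Y.nrm_nonneg[OF \<open>T x - T' x \<in> carr Y\<close>] by (intro mult_mono) auto
        also have "\<dots> = \<epsilon> * nrm X x" by simp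
        finally show ?thesis by (simp add: algebra_simps)
      qed
      then show ?thesis using T'(1) subspace_scale[OF sub] by blast
    qed
    moreover have "c *\<^sub>R T \<in> ops X Y"
      using T op_closure_ops subspace_scale[OF subspace_ops[OF X Y]] by blast
    ultimately show "c *\<^sub>R T \<in> op_closure X Y \<J>" unfolding iff by blast
  qed
  moreover have "A \<circ> T \<circ> B \<in> op_closure X Y \<J>"
    if A: "A \<in> ops Y Y" and T: "T \<in> op_closure X Y \<J>" and B: "B \<in> ops X X" for A T B
  proof -
    obtain K where K: "0 < K" "\<And>y. y \<in> carr Y \<Longrightarrow> nrm Y (A y) \<le> K * nrm Y y"
      using A Y ops_bounded by metis
    obtain L where L: "0 < L" "\<And>x. x \<in> carr X \<Longrightarrow> nrm X (B x) \<le> L * nrm X x"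
      using B X ops_bounded by metis
    have "\<exists>R\<in>\<J>. \<forall>x\<in>carr X. nrm Y ((A \<circ> T \<circ> B) x - R x) \<le> \<epsilon> * nrm X x" if "\<epsilon> > 0" for \<epsilon>
    proof -
      have "\<epsilon> / (K * L) > 0" using that K L by simp
      then obtain T' where T': "T' \<in> \<J>"
        "\<And>x. x\<in>carr X \<Longrightarrow> nrm Y (T x - T' x) \<le> \<epsilon> / (K * L) * nrm X x"
        using T unfolding iff by blast
      have "nrm Y ((A \<circ> T \<circ> B) x - (A \<circ> T' \<circ> B) x) \<le> \<epsilon> * nrm X x" if x: "x \<in> carr X" for x
      proof -
        have Bx: "B x \<in> carr X" using B x ops_carr by blast
        then have *: "T (B x) \<in> carr Y" "T' (B x) \<in> carr Y"
          using x T T'(1) \<J> op_closure_ops ops_carr by blast+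
        then have d: "T (B x) - T' (B x) \<in> carr Y"
          by (auto simp: subspace_diff Y.carr_subspace)
        have "A (T (B x) - T' (B x)) + A (T' (B x)) = A (T (B x))"
          using ops_add[OF A d *(2)] by simp
        then have "nrm Y (A (T (B x)) - A (T' (B x))) = nrm Y (A (T (B x) - T' (B x)))"
          by (metis add_diff_cancel)
        also have "\<dots> \<le> K * (\<epsilon> / (K * L) * nrm X (B x))"
          using K(2)[OF d] K(1) T'(2)[OF Bx] by (smt (verit) mult_left_mono)
        also have "\<dots> \<le> K * (\<epsilon> / (K * L) * (L * nrm X x))"
          using L(2)[OF x] K L \<open>\<epsilon> > 0\<close> by (intro mult_left_mono) auto
        also have "\<dots> = \<epsilon> * nrm X x" using K L by simp
        finally show ?thesis by simp
      qed
      then show ?thesis using ideal[OF A T'(1) B] by blast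
    qed
    moreover have "A \<circ> T \<circ> B \<in> ops X Y"
      using comp3_ops[OF X X Y Y A _ B] T op_closure_ops by blast
    ultimately show ?thesis unfolding iff by blast
  qed
  ultimately show ?thesis
    using op_closure_idem[OF X Y \<J>] op_closure_ops[of X Y \<J>]
    by (auto simp: closed_ideals_def op_ideal_def)
qed

lemma span_ideal:
  assumes W: "normed_carrier W" and X: "normed_carrier X" and Y: "normed_carrier Y"
    and Z: "normed_carrier Z" and T: "T \<in> ops W Z"
  shows "op_ideal X Y (span {A \<circ> T \<circ> B | A B. A \<in> ops Z Y \<and> B \<in> ops X W})" (is "op_ideal X Y (span ?G)")
proof -
  interpret Y: normed_carrier Y by fact
  have G: "?G \<subseteq> ops X Y" using comp3_ops[OF W X Y Z _ T] by blast
  then have sub: "span ?G \<subseteq> ops X Y" by (rule span_minimal[OF _ subspace_ops[OF X Y]])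
  have "A \<circ> S \<circ> B \<in> span ?G" if A: "A \<in> ops Y Y" and S: "S \<in> span ?G" and B: "B \<in> ops X X" for A S B
  proof -
    \<comment> \<open>Membership in \<open>ops X Y\<close> is carried through the induction because
      \<open>A\<close> is linear only on \<open>carr Y\<close>, so the values of \<open>S\<close>
      must lie there.\<close>
    have "S \<in> ops X Y \<and> A \<circ> S \<circ> B \<in> span ?G"
    proof (rule span_induct[OF S])
      show "subspace {S \<in> ops X Y. A \<circ> S \<circ> B \<in> span ?G}"
      proof (rule subspaceI)
        have "A \<circ> 0 \<circ> B = 0" using ops_zero[OF Y A] by (auto simp: fun_eq_iff)
        then show "0 \<in> {S \<in> ops X Y. A \<circ> S \<circ> B \<in> span ?G}"
          using subspace_0[OF subspace_ops[OF X Y]] span_zero by auto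
      next
        fix S R assume "S \<in> {S \<in> ops X Y. A \<circ> S \<circ> B \<in> span ?G}" "R \<in> {S \<in> ops X Y. A \<circ> S \<circ> B \<in> span ?G}"
        then have *: "S \<in> ops X Y" "R \<in> ops X Y" "(A \<circ> S \<circ> B) + (A \<circ> R \<circ> B) \<in> span ?G"
          by (auto intro: span_add)
        moreover have "A \<circ> (S + R) \<circ> B = (A \<circ> S \<circ> B) + (A \<circ> R \<circ> B)"
          using ops_in_carr[OF Y *(1)] ops_in_carr[OF Y *(2)] ops_add[OF A] by (simp add: fun_eq_iff)
        ultimately show "S + R \<in> {S \<in> ops X Y. A \<circ> S \<circ> B \<in> span ?G}"
          using subspace_add[OF subspace_ops[OF X Y]] by auto
      next
        fix c S assume "S \<in> {S \<in> ops X Y. A \<circ> S \<circ> B \<in> span ?G}"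
        then have *: "S \<in> ops X Y" "c *\<^sub>R (A \<circ> S \<circ> B) \<in> span ?G"
          by (auto intro: span_scale)
        moreover have "A \<circ> (c *\<^sub>R S) \<circ> B = c *\<^sub>R (A \<circ> S \<circ> B)"
          using ops_in_carr[OF Y *(1)] ops_scale[OF A] by (simp add: fun_eq_iff)
        ultimately show "c *\<^sub>R S \<in> {S \<in> ops X Y. A \<circ> S \<circ> B \<in> span ?G}"
          using subspace_scale[OF subspace_ops[OF X Y]] by auto
      qed
    next
      fix R assume "R \<in> ?G"
      then obtain A' B' where R: "R = A' \<circ> T \<circ> B'" "A' \<in> ops Z Y" "B' \<in> ops X W" by blast
      then have "A \<circ> R \<circ> B = (A \<circ> A') \<circ> T \<circ> (B' \<circ> B)" by (simp add: comp_assoc)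
      moreover have "A \<circ> A' \<in> ops Z Y" "B' \<circ> B \<in> ops X W"
        using ops_comp A B R W X Y Z by blast+
      ultimately have "A \<circ> R \<circ> B \<in> ?G" by blast
      then show "R \<in> ops X Y \<and> A \<circ> R \<circ> B \<in> span ?G"
        using \<open>R \<in> ?G\<close> G by (auto intro: span_base)
    qed
    then show ?thesis by blast
  qed
  with sub show ?thesis by (auto simp: op_ideal_def)
qed

lemma ideal_gen_closed_ideal:
  assumes "normed_carrier W" "normed_carrier X" "normed_carrier Y" "normed_carrier Z" "T \<in> ops W Z"
  shows "ideal_gen W Z T X Y \<in> closed_ideals X Y"
  unfolding ideal_gen_def using assms by (intro op_closure_closed_ideal span_ideal)

lemma ideal_gen_least:
  assumes "\<J> \<in> closed_ideals X Y" "T \<in> \<J>"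
  shows "ideal_gen X Y T X Y \<subseteq> \<J>"
proof -
  have "{A \<circ> T \<circ> B | A B. A \<in> ops Y Y \<and> B \<in> ops X X} \<subseteq> \<J>" and "subspace \<J>"
    and closed: "op_closure X Y \<J> = \<J>"
    using assms by (auto simp: closed_ideals_def op_ideal_def)
  from span_minimal[OF this(1,2)] show ?thesis
    unfolding ideal_gen_def using op_closure_mono[of _ \<J> X Y] by (subst closed[symmetric]) blast
qed

lemma comp_in_ideal_gen:
  assumes X: "normed_carrier X" and Y: "normed_carrier Y" and T: "T \<in> ops X Y"
    and "A \<in> ops Y Y" "B \<in> ops X X"
  shows "A \<circ> T \<circ> B \<in> ideal_gen X Y T X Y"
proof -
  have "A \<circ> T \<circ> B \<in> span {A \<circ> T \<circ> B | A B. A \<in> ops Y Y \<and> B \<in> ops X X}"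
    using assms by (intro span_base) blast
  then show ?thesis
    using op_closure_superset[OF X Y] span_ideal[OF X X Y Y T]
    unfolding ideal_gen_def op_ideal_def by blast
qed

lemma closed_ideal_comp:
  assumes "\<J> \<in> closed_ideals X Y" "A \<in> ops Y Y" "T \<in> \<J>" "B \<in> ops X X"
  shows "A \<circ> T \<circ> B \<in> \<J>"
  using assms by (auto simp: closed_ideals_def op_ideal_def)

lemma closed_ideal_ops: "\<J> \<in> closed_ideals X Y \<Longrightarrow> \<J> \<subseteq> ops X Y"
  and closed_ideal_subspace: "\<J> \<in> closed_ideals X Y \<Longrightarrow> subspace \<J>"
  by (auto simp: closed_ideals_def op_ideal_def)

lemma carr_id_comp:
  assumes "normed_carrier Y" "T \<in> ops X Y"
  shows "carr_id Y \<circ> T = T"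
  using ops_in_carr[OF assms] by (auto simp: carr_id_def fun_eq_iff)

lemma comp_carr_id:
  assumes "normed_carrier X" "T \<in> ops X Y"
  shows "T \<circ> carr_id X = T"
  using ops_outside[OF assms(2)] ops_zero[OF assms] by (auto simp: carr_id_def fun_eq_iff)

lemma sum_ideal:
  assumes X: "normed_carrier X" and Y: "normed_carrier Y"
    and I: "\<I> \<in> closed_ideals X Y" and J: "\<J> \<in> closed_ideals X Y"
  shows "op_ideal X Y {S + T | S T. S \<in> \<I> \<and> T \<in> \<J>}"
proof -
  have "A \<circ> (S + T) \<circ> B \<in> {S + T | S T. S \<in> \<I> \<and> T \<in> \<J>}"
    if "A \<in> ops Y Y" "B \<in> ops X X" "S \<in> \<I>" "T \<in> \<J>" for A B S T
  proof -
    have *: "S \<in> ops X Y" "T \<in> ops X Y" using that I J closed_ideal_ops by blast+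
    then have "A \<circ> (S + T) \<circ> B = (A \<circ> S \<circ> B) + (A \<circ> T \<circ> B)"
      using ops_in_carr[OF Y *(1)] ops_in_carr[OF Y *(2)] ops_add[OF that(1)] by (simp add: fun_eq_iff)
    moreover have "A \<circ> S \<circ> B \<in> \<I>" "A \<circ> T \<circ> B \<in> \<J>"
      using that I J closed_ideal_comp by blast+
    ultimately show ?thesis by blast
  qed
  moreover have "{S + T | S T. S \<in> \<I> \<and> T \<in> \<J>} \<subseteq> ops X Y"
    using subspace_add[OF subspace_ops[OF X Y]] closed_ideal_ops[OF I] closed_ideal_ops[OF J] by blast
  moreover have "subspace {S + T | S T. S \<in> \<I> \<and> T \<in> \<J>}"
    using subspace_sums[OF closed_ideal_subspace[OF I] closed_ideal_subspace[OF J]] by auto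
  ultimately show ?thesis unfolding op_ideal_def by blast
qed

lemma ideal_join_closed_ideal:
  assumes "normed_carrier X" "normed_carrier Y" "\<I> \<in> closed_ideals X Y" "\<J> \<in> closed_ideals X Y"
  shows "ideal_join X Y \<I> \<J> \<in> closed_ideals X Y"
  unfolding ideal_join_def using assms by (intro op_closure_closed_ideal sum_ideal)

lemma add_in_ideal_join:
  assumes "normed_carrier X" "normed_carrier Y" "\<I> \<in> closed_ideals X Y" "\<J> \<in> closed_ideals X Y"
    "S \<in> \<I>" "T \<in> \<J>"
  shows "S + T \<in> ideal_join X Y \<I> \<J>"
proof -
  have "S + T \<in> {S + T | S T. S \<in> \<I> \<and> T \<in> \<J>}" using assms by blast
  then show ?thesis
    unfolding ideal_join_def using op_closure_superset[OF assms(1,2)] sum_ideal[OF assms(1-4)]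
    unfolding op_ideal_def by blast
qed

lemma ideal_join_least:
  assumes "\<K> \<in> closed_ideals X Y" "\<I> \<subseteq> \<K>" "\<J> \<subseteq> \<K>"
  shows "ideal_join X Y \<I> \<J> \<subseteq> \<K>"
proof -
  have "{S + T | S T. S \<in> \<I> \<and> T \<in> \<J>} \<subseteq> \<K>"
    using assms subspace_add[OF closed_ideal_subspace[OF assms(1)]] by blast
  then have "ideal_join X Y \<I> \<J> \<subseteq> op_closure X Y \<K>"
    unfolding ideal_join_def by (rule op_closure_mono)
  then show ?thesis using assms(1) by (simp add: closed_ideals_def)
qed

lemma ideal_join_upper:
  assumes X: "normed_carrier X" and Y: "normed_carrier Y"
    and I: "\<I> \<in> closed_ideals X Y" and J: "\<J> \<in> closed_ideals X Y"
  shows "\<I> \<subseteq> ideal_join X Y \<I> \<J>" "\<J> \<subseteq> ideal_join X Y \<I> \<J>"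
proof -
  have 0: "0 \<in> \<I>" "0 \<in> \<J>"
    using subspace_0[OF closed_ideal_subspace[OF I]] subspace_0[OF closed_ideal_subspace[OF J]] by auto
  show "\<I> \<subseteq> ideal_join X Y \<I> \<J>"
    using add_in_ideal_join[OF assms _ 0(2)] by (intro subsetI) simp
  show "\<J> \<subseteq> ideal_join X Y \<I> \<J>"
    using add_in_ideal_join[OF assms 0(1)] by (intro subsetI) simp
qed

text \<open>Generators are absorbed one at a time: \<open>B'\<close> is divided by a bound
  \<open>K\<close> of its own and \<open>A'\<close> is multiplied by \<open>c * K\<close>. All inner
  factors become contractions and the outer ones share one bound \<open>C\<close>, the form in which
  coordinates can be counted uniformly in \<open>i\<close>.\<close>

lemma span_representation:
  assumes W: "normed_carrier W" and X: "normed_carrier X" and Y: "normed_carrier Y"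
    and Z: "normed_carrier Z" and T: "T \<in> ops W Z"
    and S: "S \<in> span {A \<circ> T \<circ> B | A B. A \<in> ops Z Y \<and> B \<in> ops X W}"
  shows "\<exists>k A B C. 0 \<le> C \<and> S = (\<Sum>i<k::nat. A i \<circ> T \<circ> B i) \<and>
    (\<forall>i<k. A i \<in> ops Z Y \<and> B i \<in> ops X W \<and> (\<forall>x\<in>carr X. nrm W (B i x) \<le> nrm X x) \<and>
       (\<forall>z\<in>carr Z. nrm Y (A i z) \<le> C * nrm Z z))"
  using S
proof (induction rule: span_induct_alt)
  case base
  then show ?case by (intro exI[of _ 0]) auto
next
  case (step c R S)
  interpret Z: normed_carrier Z by fact
  interpret W: normed_carrier W by fact
  obtain A' B' where R: "R = A' \<circ> T \<circ> B'" "A' \<in> ops Z Y" "B' \<in> ops X W" using step.hyps by blast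
  obtain k A B C where S: "0 \<le> C" "S = (\<Sum>i<k::nat. A i \<circ> T \<circ> B i)"
    "\<And>i. i < k \<Longrightarrow> A i \<in> ops Z Y \<and> B i \<in> ops X W \<and> (\<forall>x\<in>carr X. nrm W (B i x) \<le> nrm X x) \<and>
       (\<forall>z\<in>carr Z. nrm Y (A i z) \<le> C * nrm Z z)"
    using step.IH by blast
  obtain K where K: "0 < K" "\<And>x. x \<in> carr X \<Longrightarrow> nrm W (B' x) \<le> K * nrm X x"
    using R(3) X ops_bounded by metis
  define A1 where "A1 = A(k := (c * K) *\<^sub>R A')"
  define B1 where "B1 = B(k := (1 / K) *\<^sub>R B')"
  have A1: "A1 k \<in> ops Z Y" and B1: "B1 k \<in> ops X W"
    using R subspace_scale[OF subspace_ops] W X Y Z by (auto simp: A1_def B1_def)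
  obtain L where L: "0 < L" "\<And>z. z \<in> carr Z \<Longrightarrow> nrm Y (A1 k z) \<le> L * nrm Z z"
    using A1 Z ops_bounded by metis
  have "c *\<^sub>R R x = A1 k (T (B1 k x))" for x
  proof -
    have B'x: "B' x \<in> carr W" using R(3) ops_in_carr[OF W] by blast
    moreover have "T (B' x) \<in> carr Z" using T ops_in_carr[OF Z] by blast
    ultimately show ?thesis
      using K(1) by (simp add: A1_def B1_def R(1) ops_scale[OF T] ops_scale[OF R(2)])
  qed
  then have "c *\<^sub>R R + S = (\<Sum>i<Suc k. A1 i \<circ> T \<circ> B1 i)"
    by (simp add: S(2) A1_def B1_def fun_eq_iff add.commute)
  moreover have "A1 i \<in> ops Z Y \<and> B1 i \<in> ops X W \<and> (\<forall>x\<in>carr X. nrm W (B1 i x) \<le> nrm X x) \<and>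
       (\<forall>z\<in>carr Z. nrm Y (A1 i z) \<le> max C L * nrm Z z)" if "i < Suc k" for i
  proof (cases "i = k")
    case True
    have "nrm W (B1 k x) \<le> nrm X x" if "x \<in> carr X" for x
    proof -
      have "nrm W (B1 k x) = \<bar>1 / K\<bar> * nrm W (B' x)"
        using W.nrm_scale[OF ops_in_carr[OF W R(3)]] by (simp add: B1_def)
      then have "K * nrm W (B1 k x) \<le> K * nrm X x" using K(1) K(2)[OF that] by simp
      then show ?thesis using K(1) by simp
    qed
    moreover have "nrm Y (A1 k z) \<le> max C L * nrm Z z" if "z \<in> carr Z" for z
      using L(2)[OF that] Z.nrm_nonneg[OF that]
      by (meson max.cobounded2 mult_right_mono order_trans)
    ultimately show ?thesis using True A1 B1 by blast
  next
    case False
    then have "i < k" "A1 i = A i" "B1 i = B i" using that by (auto simp: A1_def B1_def)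
    moreover have "nrm Y (A i z) \<le> max C L * nrm Z z" if "z \<in> carr Z" for z
      using S(3)[OF \<open>i < k\<close>] that Z.nrm_nonneg[OF that]
      by (meson max.cobounded1 mult_right_mono order_trans)
    ultimately show ?thesis using S(3)[of i] by simp
  qed
  ultimately show ?case
    using S(1) by (intro exI[of _ "Suc k"] exI[of _ A1] exI[of _ B1] exI[of _ "max C L"]) auto
qed

section \<open>The spaces \<open>U\<close> and \<open>V\<close>\<close>

lemma convex_on_powr_nonneg:
  assumes "1 \<le> p"
  shows "convex_on {0..} (\<lambda>x::real. x powr p)"
proof (rule convex_onI)
  fix t x y :: real
  assume t: "0 < t" "t < 1" and xy: "x \<in> {0..}" "y \<in> {0..}"
  have le: "s powr p \<le> s" if "0 < s" "s < 1" for s :: real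
    using powr_mono'[of 1 p s] that assms by simp
  show "((1 - t) *\<^sub>R x + t *\<^sub>R y) powr p \<le> (1 - t) * x powr p + t * y powr p"
  \<comment> \<open>With an endpoint 0 the inequality reduces to \<open>s powr p \<le> s\<close> for
    weights strictly between 0 and 1.\<close>
  proof (cases "x = 0 \<or> y = 0")
    case True
    then show ?thesis
      using le[of t] le[of "1 - t"] t xy by (auto simp: powr_mult mult_right_mono)
  next
    case False
    then show ?thesis
      using convex_onD[OF powr_convex[OF assms], of t x y] t xy by simp
  qed
qed simp

text \<open>After normalising by \<open>A\<close> and \<open>B\<close>, convexity of the p-th power
  with weights A/(A+B) and B/(A+B) bounds \<open>(f n + g n) powr p\<close> by a series
  \<open>h\<close> whose sum is exactly \<open>(A + B) powr p\<close>. If \<open>A\<close> or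
  \<open>B\<close> is 0, the corresponding sequence vanishes.\<close>

lemma minkowski_sequences:
  fixes f g :: "nat \<Rightarrow> real"
  assumes p: "1 \<le> p" and f: "\<And>n. 0 \<le> f n" and g: "\<And>n. 0 \<le> g n"
    and sf: "summable (\<lambda>n. f n powr p)" and sg: "summable (\<lambda>n. g n powr p)"
  shows "summable (\<lambda>n. (f n + g n) powr p)"
    and "(\<Sum>n. (f n + g n) powr p) powr (1/p) \<le> (\<Sum>n. f n powr p) powr (1/p) + (\<Sum>n. g n powr p) powr (1/p)"
proof -
  define A where "A = (\<Sum>n. f n powr p) powr (1/p)"
  define B where "B = (\<Sum>n. g n powr p) powr (1/p)"
  have Ap: "A powr p = (\<Sum>n. f n powr p)" and Bp: "B powr p = (\<Sum>n. g n powr p)"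
    using p suminf_nonneg[OF sf] suminf_nonneg[OF sg] by (auto simp: A_def B_def powr_powr)
  have AB: "0 \<le> A" "0 \<le> B" by (auto simp: A_def B_def)
  have f0: "f n = 0" if "A = 0" for n
    using Ap that suminf_eq_zero_iff[OF sf] p by simp
  have g0: "g n = 0" if "B = 0" for n
    using Bp that suminf_eq_zero_iff[OF sg] p by simp
  have "summable (\<lambda>n. (f n + g n) powr p) \<and> (\<Sum>n. (f n + g n) powr p) powr (1/p) \<le> A + B"
  proof (cases "A = 0 \<or> B = 0")
    case True
    then consider "\<And>n. f n = 0" | "\<And>n. g n = 0" using f0 g0 by blast
    then show ?thesis
    proof cases
      case 1
      then show ?thesis using sg AB(1) by (simp add: B_def)
    next
      case 2
      then show ?thesis using sf AB(2) by (simp add: A_def)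
    qed
  next
    case False
    then have pos: "A > 0" "B > 0" using AB by auto
    define h where "h n = (A + B) powr p * (A / (A + B) * (f n powr p / A powr p) + B / (A + B) * (g n powr p / B powr p))" for n
    have le: "(f n + g n) powr p \<le> h n" for n
    proof -
      have t: "1 - B / (A + B) = A / (A + B)" using pos by (simp add: field_simps)
      have "f n + g n = (A + B) * (A / (A + B) * (f n / A) + B / (A + B) * (g n / B))"
        using pos by (simp add: distrib_left)
      then have "(f n + g n) powr p = (A + B) powr p * (A / (A + B) * (f n / A) + B / (A + B) * (g n / B)) powr p"
        using powr_mult[of "A + B" "A / (A + B) * (f n / A) + B / (A + B) * (g n / B)" p] pos f[of n] g[of n]
        by (simp only: add_nonneg_nonneg less_imp_le divide_nonneg_nonneg mult_nonneg_nonneg)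
      also have "\<dots> \<le> (A + B) powr p * (A / (A + B) * (f n / A) powr p + B / (A + B) * (g n / B) powr p)"
        using convex_onD[OF convex_on_powr_nonneg[OF p], of "B / (A + B)" "f n / A" "g n / B"] pos f[of n] g[of n] t
        by (intro mult_left_mono) auto
      also have "\<dots> = h n" using pos f[of n] g[of n] by (simp add: h_def powr_divide)
      finally show ?thesis .
    qed
    have "(\<lambda>n. A / (A + B) * (f n powr p / A powr p) + B / (A + B) * (g n powr p / B powr p))
        sums (A / (A + B) * ((\<Sum>n. f n powr p) / A powr p) + B / (A + B) * ((\<Sum>n. g n powr p) / B powr p))"
      using sf sg by (intro sums_add sums_mult sums_divide summable_sums)
    also have "(A / (A + B) * ((\<Sum>n. f n powr p) / A powr p) + B / (A + B) * ((\<Sum>n. g n powr p) / B powr p)) = 1"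
      using pos by (simp flip: Ap Bp add: add_divide_distrib[symmetric])
    finally have h: "h sums ((A + B) powr p)"
      unfolding h_def by (drule_tac sums_mult[where c="(A + B) powr p"]) simp
    have sum: "summable (\<lambda>n. (f n + g n) powr p)"
      by (rule summable_comparison_test'[OF sums_summable[OF h], of 0]) (use le in auto)
    have "(\<Sum>n. (f n + g n) powr p) \<le> (A + B) powr p"
      using suminf_le[OF le sum sums_summable[OF h]] sums_unique[OF h] by simp
    then have "(\<Sum>n. (f n + g n) powr p) powr (1/p) \<le> ((A + B) powr p) powr (1/p)"
      using p suminf_nonneg[OF sum] by (intro powr_mono2) auto
    also have "\<dots> = A + B" using p pos by (simp add: powr_powr)
    finally show ?thesis using sum by blast
  qed
  then show "summable (\<lambda>n. (f n + g n) powr p)"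
    "(\<Sum>n. (f n + g n) powr p) powr (1/p) \<le> (\<Sum>n. f n powr p) powr (1/p) + (\<Sum>n. g n powr p) powr (1/p)"
    by (auto simp: A_def B_def)
qed

lemma lp_sum_dominated:
  assumes p: "1 \<le> p" and X: "\<And>n. normed_carrier (X n)" and x: "x \<in> carr (lp_sum p X)"
    and y: "\<And>n. y n \<in> carr (X n)" and K: "0 \<le> K" "\<And>n. nrm (X n) (y n) \<le> K * nrm (X n) (x n)"
  shows "y \<in> carr (lp_sum p X)" "nrm (lp_sum p X) y \<le> K * nrm (lp_sum p X) x"
proof -
  have x': "x n \<in> carr (X n)" and sx: "summable (\<lambda>n. nrm (X n) (x n) powr p)" for n
    using x by (auto simp: lp_sum_def)
  have nn: "0 \<le> nrm (X n) (x n)" "0 \<le> nrm (X n) (y n)" for n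
    using normed_carrier.nrm_nonneg[OF X] x' y by blast+
  have le: "nrm (X n) (y n) powr p \<le> K powr p * nrm (X n) (x n) powr p" for n
    using powr_mono2[OF _ nn(2) K(2), of p n] p K(1) nn by (simp add: powr_mult)
  have s: "summable (\<lambda>n. nrm (X n) (y n) powr p)"
    by (rule summable_comparison_test'[OF summable_mult[OF sx, of "K powr p"], of 0]) (use le in auto)
  then show "y \<in> carr (lp_sum p X)" using y by (simp add: lp_sum_def)
  have "(\<Sum>n. nrm (X n) (y n) powr p) \<le> (\<Sum>n. K powr p * nrm (X n) (x n) powr p)"
    using suminf_le[OF le s summable_mult[OF sx]] .
  also have "\<dots> = K powr p * (\<Sum>n. nrm (X n) (x n) powr p)" by (rule suminf_mult[OF sx])
  finally have "(\<Sum>n. nrm (X n) (y n) powr p) powr (1/p) \<le> (K powr p * (\<Sum>n. nrm (X n) (x n) powr p)) powr (1/p)"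
    using p suminf_nonneg[OF s] by (intro powr_mono2) auto
  then show "nrm (lp_sum p X) y \<le> K * nrm (lp_sum p X) x"
    using p K(1) suminf_nonneg[OF sx] by (simp add: lp_sum_def powr_mult powr_powr)
qed

lemma normed_carrier_lp_sum:
  assumes p: "1 \<le> p" and X: "\<And>n. normed_carrier (X n)"
  shows "normed_carrier (lp_sum p X)"
proof -
  have add: "x + y \<in> carr (lp_sum p X) \<and> nrm (lp_sum p X) (x + y) \<le> nrm (lp_sum p X) x + nrm (lp_sum p X) y"
    if x: "x \<in> carr (lp_sum p X)" and y: "y \<in> carr (lp_sum p X)" for x y
  proof -
    have x': "x n \<in> carr (X n)" and y': "y n \<in> carr (X n)" for n using x y by (auto simp: lp_sum_def)
    have sx: "summable (\<lambda>n. nrm (X n) (x n) powr p)" and sy: "summable (\<lambda>n. nrm (X n) (y n) powr p)"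
      using x y by (auto simp: lp_sum_def)
    have nn: "0 \<le> nrm (X n) (x n)" "0 \<le> nrm (X n) (y n)" "0 \<le> nrm (X n) (x n + y n)" for n
      using normed_carrier.nrm_nonneg[OF X] normed_carrier.carr_add[OF X] x' y' by blast+
    note M = minkowski_sequences[OF p nn(1,2) sx sy]
    have le: "nrm (X n) (x n + y n) powr p \<le> (nrm (X n) (x n) + nrm (X n) (y n)) powr p" for n
      using normed_carrier.nrm_triangle[OF X x' y'] p nn by (intro powr_mono2) auto
    have s: "summable (\<lambda>n. nrm (X n) (x n + y n) powr p)"
      by (rule summable_comparison_test'[OF M(1), of 0]) (use le in auto)
    have "(\<Sum>n. nrm (X n) (x n + y n) powr p) powr (1/p) \<le> (\<Sum>n. (nrm (X n) (x n) + nrm (X n) (y n)) powr p) powr (1/p)"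
      using suminf_le[OF le s M(1)] p suminf_nonneg[OF s] by (intro powr_mono2) auto
    with M(2) s x' y' show ?thesis
      by (auto simp: lp_sum_def normed_carrier.carr_add[OF X])
  qed
  have scale: "c *\<^sub>R x \<in> carr (lp_sum p X) \<and> nrm (lp_sum p X) (c *\<^sub>R x) = \<bar>c\<bar> * nrm (lp_sum p X) x"
    if x: "x \<in> carr (lp_sum p X)" for x c
  proof -
    have x': "x n \<in> carr (X n)" for n using x by (auto simp: lp_sum_def)
    have sx: "summable (\<lambda>n. nrm (X n) (x n) powr p)" using x by (auto simp: lp_sum_def)
    have eq: "nrm (X n) (c *\<^sub>R x n) powr p = \<bar>c\<bar> powr p * nrm (X n) (x n) powr p" for n
      using normed_carrier.nrm_scale[OF X x'] normed_carrier.nrm_nonneg[OF X x'] by (simp add: powr_mult)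
    show ?thesis
      using x' sx p suminf_nonneg[OF sx] suminf_mult[OF sx, of "\<bar>c\<bar> powr p"]
      by (auto simp: lp_sum_def normed_carrier.carr_scale[OF X] eq powr_mult powr_powr intro!: summable_mult)
  qed
  have zero: "0 \<in> carr (lp_sum p X)"
    using normed_carrier.carr_zero[OF X] normed_carrier.nrm_zero[OF X] by (simp add: lp_sum_def)
  show ?thesis
    using add scale zero by (unfold_locales) (auto simp: subspace_def lp_sum_def)
qed

lemma lp_sum_finite_sum:
  assumes p: "1 \<le> p" and x: "x \<in> carr (lp_sum p X)" and D: "finite D"
  shows "(\<Sum>n\<in>D. nrm (X n) (x n) powr p) \<le> nrm (lp_sum p X) x powr p"
proof -
  have sx: "summable (\<lambda>n. nrm (X n) (x n) powr p)" using x by (auto simp: lp_sum_def)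
  have "(\<Sum>n\<in>D. nrm (X n) (x n) powr p) \<le> (\<Sum>n. nrm (X n) (x n) powr p)"
    by (rule sum_le_suminf[OF sx D]) auto
  also have "\<dots> = nrm (lp_sum p X) x powr p"
    using p suminf_nonneg[OF sx] by (simp add: lp_sum_def powr_powr)
  finally show ?thesis .
qed

lemma lp_sum_block:
  assumes p: "1 \<le> p" and X: "\<And>n. normed_carrier (X n)" and x: "x \<in> carr (lp_sum p X)"
  shows "x n \<in> carr (X n)" "nrm (X n) (x n) \<le> nrm (lp_sum p X) x"
proof -
  show xn: "x n \<in> carr (X n)" using x by (simp add: lp_sum_def)
  have "nrm (X n) (x n) powr p \<le> nrm (lp_sum p X) x powr p"
    using lp_sum_finite_sum[OF p x, of "{n}"] by simp
  then show "nrm (X n) (x n) \<le> nrm (lp_sum p X) x"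
    using powr_less_mono2[of p "nrm (lp_sum p X) x" "nrm (X n) (x n)"] p
      normed_carrier.nrm_nonneg[OF normed_carrier_lp_sum[OF p X] x] by linarith
qed

lemma lp_sum_block_tendsto:
  assumes p: "1 \<le> p" and X: "\<And>n. normed_carrier (X n)" and x: "x \<in> carr (lp_sum p X)"
  shows "(\<lambda>n. nrm (X n) (x n)) \<longlonglongrightarrow> 0"
proof -
  have "(\<lambda>n. nrm (X n) (x n) powr p) \<longlonglongrightarrow> 0"
    using x by (auto simp: lp_sum_def intro: summable_LIMSEQ_zero)
  then have "(\<lambda>n. (nrm (X n) (x n) powr p) powr (1/p)) \<longlonglongrightarrow> 0 powr (1/p)"
    using p by (intro tendsto_powr2[OF _ tendsto_const]) auto
  moreover have "(nrm (X n) (x n) powr p) powr (1/p) = nrm (X n) (x n)" for n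
    using p normed_carrier.nrm_nonneg[OF X lp_sum_block(1)[OF p X x]] by (simp add: powr_powr)
  ultimately show ?thesis using p by simp
qed

lemma lp_sum_single:
  assumes p: "1 \<le> p" and X: "\<And>n. normed_carrier (X n)" and x: "x \<in> carr (X n)"
  shows "(\<lambda>m. if m = n then x else 0) \<in> carr (lp_sum p X)"
    and "nrm (lp_sum p X) (\<lambda>m. if m = n then x else 0) = nrm (X n) x"
proof -
  have eq: "nrm (X m) (if m = n then x else 0) powr p = (if m = n then nrm (X n) x powr p else 0)" for m
    using normed_carrier.nrm_zero[OF X] by simp
  have s: "(\<lambda>m. nrm (X m) (if m = n then x else 0) powr p) sums (nrm (X n) x powr p)"
    unfolding eq by (rule sums_single)
  then show "(\<lambda>m. if m = n then x else 0) \<in> carr (lp_sum p X)"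
    using x normed_carrier.carr_zero[OF X] by (auto simp: lp_sum_def sums_iff)
  show "nrm (lp_sum p X) (\<lambda>m. if m = n then x else 0) = nrm (X n) x"
    using p s normed_carrier.nrm_nonneg[OF X x] by (simp add: lp_sum_def sums_iff powr_powr)
qed

section \<open>Sums of normed spaces in the sense of c_0\<close>

lemma c0_sum_le:
  assumes X: "\<And>n. normed_carrier (X n)" and x: "x \<in> carr (c0_sum X)"
  shows "nrm (X n) (x n) \<le> nrm (c0_sum X) x"
proof -
  have "Bseq (\<lambda>n. nrm (X n) (x n))"
    using x by (auto simp: c0_sum_def intro: convergent_imp_Bseq convergentI)
  then have "bdd_above (range (\<lambda>n. nrm (X n) (x n)))"
    by (auto simp: Bseq_def bdd_above_def) (meson abs_le_D1)
  then show ?thesis using cSUP_upper[of n UNIV "\<lambda>n. nrm (X n) (x n)"] by (simp add: c0_sum_def)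
qed

lemma normed_carrier_c0_sum:
  assumes X: "\<And>n. normed_carrier (X n)"
  shows "normed_carrier (c0_sum X)"
proof -
  have blk: "x n \<in> carr (X n)" "0 \<le> nrm (X n) (x n)" if "x \<in> carr (c0_sum X)" for x n
    using that normed_carrier.nrm_nonneg[OF X] by (auto simp: c0_sum_def)
  have add: "x + y \<in> carr (c0_sum X)" if x: "x \<in> carr (c0_sum X)" and y: "y \<in> carr (c0_sum X)" for x y
  proof -
    have "(\<lambda>n. nrm (X n) (x n) + nrm (X n) (y n)) \<longlonglongrightarrow> 0"
      using x y tendsto_add[of _ 0 _ _ 0] by (fastforce simp: c0_sum_def)
    then have "(\<lambda>n. nrm (X n) (x n + y n)) \<longlonglongrightarrow> 0"
      by (rule Lim_null_comparison[rotated])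
        (use normed_carrier.nrm_triangle[OF X] normed_carrier.nrm_nonneg[OF X] normed_carrier.carr_add[OF X] blk x y in auto)
    then show ?thesis using blk[OF x] blk[OF y] normed_carrier.carr_add[OF X] by (simp add: c0_sum_def)
  qed
  have scale: "c *\<^sub>R x \<in> carr (c0_sum X)" if x: "x \<in> carr (c0_sum X)" for x c
    using x blk[OF x] normed_carrier.carr_scale[OF X] normed_carrier.nrm_scale[OF X]
    by (auto simp: c0_sum_def intro: tendsto_mult_right_zero)
  have zero: "0 \<in> carr (c0_sum X)"
    using normed_carrier.carr_zero[OF X] normed_carrier.nrm_zero[OF X] by (simp add: c0_sum_def)
  have nrm_le: "nrm (c0_sum X) x \<le> K" if "\<And>n. nrm (X n) (x n) \<le> K" for x K
    using that by (auto simp: c0_sum_def intro: cSUP_least)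
  have scale_le: "nrm (c0_sum X) (c *\<^sub>R x) \<le> \<bar>c\<bar> * nrm (c0_sum X) x" if x: "x \<in> carr (c0_sum X)" for x c
    using c0_sum_le[OF X x] normed_carrier.nrm_scale[OF X blk(1)[OF x]]
    by (intro nrm_le) (auto intro: mult_left_mono)
  show ?thesis
  proof
    show "subspace (carr (c0_sum X))" using add scale zero by (simp add: subspace_def)
    show "0 \<le> nrm (c0_sum X) x" if "x \<in> carr (c0_sum X)" for x
      using c0_sum_le[OF X that, of 0] blk(2)[OF that, of 0] by linarith
    show "nrm (c0_sum X) (x + y) \<le> nrm (c0_sum X) x + nrm (c0_sum X) y"
      if x: "x \<in> carr (c0_sum X)" and y: "y \<in> carr (c0_sum X)" for x y
    proof (rule nrm_le)
      fix n
      show "nrm (X n) ((x + y) n) \<le> nrm (c0_sum X) x + nrm (c0_sum X) y"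
        using normed_carrier.nrm_triangle[OF X blk(1)[OF x] blk(1)[OF y], of n] c0_sum_le[OF X x, of n]
          c0_sum_le[OF X y, of n] by simp
    qed
    show "nrm (c0_sum X) (c *\<^sub>R x) = \<bar>c\<bar> * nrm (c0_sum X) x" if x: "x \<in> carr (c0_sum X)" for x c
    proof (cases "c = 0")
      case True
      have "nrm (c0_sum X) 0 = 0"
        using normed_carrier.nrm_zero[OF X] by (simp add: c0_sum_def)
      then show ?thesis using True by simp
    next
      case False
      \<comment> \<open>The reverse inequality is the bound just proved, applied to the scalar 1/c
        and the vector c x.\<close>
      have "nrm (c0_sum X) ((1/c) *\<^sub>R (c *\<^sub>R x)) \<le> \<bar>1/c\<bar> * nrm (c0_sum X) (c *\<^sub>R x)"
        by (rule scale_le[OF scale[OF x]])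
      then have "\<bar>c\<bar> * nrm (c0_sum X) x \<le> nrm (c0_sum X) (c *\<^sub>R x)"
        using False by (simp add: field_simps)
      with scale_le[OF x] show ?thesis by (simp add: antisym)
    qed
  qed
qed

section \<open>The finite-dimensional blocks\<close>

lemma normed_carrier_l2_fin: "normed_carrier (l2_fin k)"
proof
  fix x :: "nat \<Rightarrow> real" and c
  show "nrm (l2_fin k) (c *\<^sub>R x) = \<bar>c\<bar> * nrm (l2_fin k) x"
    by (simp add: l2_fin_def L2_set_def power_mult_distrib real_sqrt_mult flip: sum_distrib_left)
next
  fix x y :: "nat \<Rightarrow> real"
  show "nrm (l2_fin k) (x + y) \<le> nrm (l2_fin k) x + nrm (l2_fin k) y"
    using L2_set_triangle_ineq[of x y "{..<k}"] by (simp add: l2_fin_def plus_fun_def)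
qed (auto simp: l2_fin_def subspace_def)

lemma l2_fin_sq: "(nrm (l2_fin k) x)\<^sup>2 = (\<Sum>i<k. (x i)\<^sup>2)"
  by (simp add: l2_fin_def L2_set_def sum_nonneg)

lemma l2_fin_nonneg: "0 \<le> nrm (l2_fin k) x"
  by (simp add: l2_fin_def)

lemma l2_fin_eq_0: "x \<in> carr (l2_fin k) \<Longrightarrow> nrm (l2_fin k) x = 0 \<Longrightarrow> x = 0"
  by (auto simp: l2_fin_def L2_set_eq_0_iff fun_eq_iff) (metis lessThan_iff not_le)

lemma inner_fin_cauchy_schwarz: "\<bar>inner_fin k x y\<bar> \<le> nrm (l2_fin k) x * nrm (l2_fin k) y"
proof -
  have "\<bar>inner_fin k x y\<bar> \<le> (\<Sum>i<k. \<bar>x i\<bar> * \<bar>y i\<bar>)"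
    by (simp add: inner_fin_def sum_abs[THEN order_trans] abs_mult)
  also have "\<dots> \<le> nrm (l2_fin k) x * nrm (l2_fin k) y"
    by (simp add: l2_fin_def L2_set_mult_ineq)
  finally show ?thesis .
qed

lemma inner_fin_self: "inner_fin k x x = (nrm (l2_fin k) x)\<^sup>2"
  by (simp add: l2_fin_sq inner_fin_def flip: power2_eq_square)

lemma inner_fin_commute: "inner_fin k x y = inner_fin k y x"
  by (simp add: inner_fin_def mult.commute)

lemma inner_fin_add: "inner_fin k (x + y) z = inner_fin k x z + inner_fin k y z"
  and inner_fin_scale: "inner_fin k (c *\<^sub>R x) z = c * inner_fin k x z"
  and inner_fin_zero: "inner_fin k 0 z = 0"
  by (auto simp: inner_fin_def sum.distrib sum_distrib_left algebra_simps)

lemma inner_fin_sum: "inner_fin k (\<Sum>i\<in>A. c i *\<^sub>R x i) z = (\<Sum>i\<in>A. c i * inner_fin k (x i) z)"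
  by (simp add: inner_fin_def sum_distrib_left sum_distrib_right mult.assoc) (rule sum.swap)

lemma linf_fin_abs_le: "i < k \<Longrightarrow> \<bar>x i\<bar> \<le> nrm (linf_fin k) x"
  by (auto simp: linf_fin_def intro: Max_ge)

lemma linf_fin_nonneg: "0 \<le> nrm (linf_fin k) x"
  by (auto simp: linf_fin_def intro: Max_ge)

lemma linf_fin_le: "0 \<le> K \<Longrightarrow> (\<And>i. i < k \<Longrightarrow> \<bar>x i\<bar> \<le> K) \<Longrightarrow> nrm (linf_fin k) x \<le> K"
  by (auto simp: linf_fin_def)

lemma normed_carrier_linf_fin: "normed_carrier (linf_fin k)"
proof
  show "subspace (carr (linf_fin k))" by (auto simp: linf_fin_def subspace_def)
  show "0 \<le> nrm (linf_fin k) x" for x by (rule linf_fin_nonneg)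
  show "nrm (linf_fin k) (x + y) \<le> nrm (linf_fin k) x + nrm (linf_fin k) y" for x y
  proof (rule linf_fin_le)
    fix i assume "i < k"
    then show "\<bar>(x + y) i\<bar> \<le> nrm (linf_fin k) x + nrm (linf_fin k) y"
      using linf_fin_abs_le[of i k x] linf_fin_abs_le[of i k y] by simp
  qed (simp add: linf_fin_nonneg)
  have le: "nrm (linf_fin k) (c *\<^sub>R x) \<le> \<bar>c\<bar> * nrm (linf_fin k) x" for c x
    by (rule linf_fin_le) (auto simp: linf_fin_nonneg abs_mult intro: mult_left_mono linf_fin_abs_le)
  show "nrm (linf_fin k) (c *\<^sub>R x) = \<bar>c\<bar> * nrm (linf_fin k) x" for x c
  proof (cases "c = 0")
    case True
    then show ?thesis using le[of c x] linf_fin_nonneg[of k "c *\<^sub>R x"] by simp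
  next
    case False
    have "nrm (linf_fin k) ((1/c) *\<^sub>R (c *\<^sub>R x)) \<le> \<bar>1/c\<bar> * nrm (linf_fin k) (c *\<^sub>R x)"
      by (rule le)
    then have "\<bar>c\<bar> * nrm (linf_fin k) x \<le> nrm (linf_fin k) (c *\<^sub>R x)"
      using False by (simp add: field_simps)
    with le[of c x] show ?thesis by (simp add: antisym)
  qed
qed

section \<open>Block and coordinate estimates in U and V\<close>

lemma normed_carrier_U: "1 \<le> p \<Longrightarrow> normed_carrier (U_space p u)"
  unfolding U_space_def by (rule normed_carrier_lp_sum[OF _ normed_carrier_l2_fin])

lemma normed_carrier_V: "normed_carrier (V_space v)"
  unfolding V_space_def by (rule normed_carrier_c0_sum[OF normed_carrier_linf_fin])

lemmas U_dominated = lp_sum_dominated[where X="\<lambda>n. l2_fin (u n)" for u, folded U_space_def, OF _ normed_carrier_l2_fin]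
  and U_finite_sum = lp_sum_finite_sum[where X="\<lambda>n. l2_fin (u n)" for u, folded U_space_def]
  and U_block = lp_sum_block[where X="\<lambda>n. l2_fin (u n)" for u, folded U_space_def, OF _ normed_carrier_l2_fin]
  and U_block_tendsto = lp_sum_block_tendsto[where X="\<lambda>n. l2_fin (u n)" for u, folded U_space_def, OF _ normed_carrier_l2_fin]
  and U_single = lp_sum_single[where X="\<lambda>n. l2_fin (u n)" for u, folded U_space_def, OF _ normed_carrier_l2_fin]

lemma U_nrm_pos:
  assumes p: "1 \<le> p" and x: "x \<in> carr (U_space p u)" and "x \<noteq> 0"
  shows "0 < nrm (U_space p u) x"
proof -
  obtain n where "x n \<noteq> 0" using \<open>x \<noteq> 0\<close> by (auto simp: fun_eq_iff)
  then have "nrm (l2_fin (u n)) (x n) \<noteq> 0" using l2_fin_eq_0 U_block(1)[OF p x] by blast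
  then show ?thesis using U_block(2)[OF p x, of n] l2_fin_nonneg[of "u n" "x n"] by linarith
qed

lemma V_carrI:
  assumes "\<And>n i. v n \<le> i \<Longrightarrow> z n i = 0" and b: "\<And>n i. i < v n \<Longrightarrow> \<bar>z n i\<bar> \<le> b n" "b \<longlonglongrightarrow> 0"
  shows "z \<in> carr (V_space v)"
proof -
  \<comment> \<open>For an empty block nothing prevents \<open>b n\<close> from being negative,
    while a norm bound has to be nonnegative; hence the absolute values.\<close>
  have "(\<lambda>n. \<bar>b n\<bar>) \<longlonglongrightarrow> 0" using b(2) tendsto_rabs_zero by blast
  then have "(\<lambda>n. nrm (linf_fin (v n)) (z n)) \<longlonglongrightarrow> 0"
  proof (rule Lim_null_comparison[rotated])
    show "\<forall>\<^sub>F n in sequentially. norm (nrm (linf_fin (v n)) (z n)) \<le> \<bar>b n\<bar>"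
    proof (intro always_eventually allI)
      fix n
      have "nrm (linf_fin (v n)) (z n) \<le> \<bar>b n\<bar>"
        by (rule linf_fin_le) (use b(1) in force)+
      then show "norm (nrm (linf_fin (v n)) (z n)) \<le> \<bar>b n\<bar>"
        using linf_fin_nonneg by simp
    qed
  qed
  then show ?thesis using assms(1) by (simp add: V_space_def c0_sum_def linf_fin_def)
qed

lemma V_outside: "z \<in> carr (V_space v) \<Longrightarrow> v n \<le> i \<Longrightarrow> z n i = 0"
  by (auto simp: V_space_def c0_sum_def linf_fin_def)

lemma V_nrm_le:
  assumes "0 \<le> K" "\<And>n i. i < v n \<Longrightarrow> \<bar>z n i\<bar> \<le> K"
  shows "nrm (V_space v) z \<le> K"
  using linf_fin_le assms by (auto simp: V_space_def c0_sum_def intro!: cSUP_least)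

lemma V_block_bound:
  assumes z: "z \<in> carr (V_space v)"
  obtains b where "b \<longlonglongrightarrow> 0" "\<And>n i. \<bar>z n i\<bar> \<le> b n"
proof
  show "(\<lambda>n. nrm (linf_fin (v n)) (z n)) \<longlonglongrightarrow> 0" using z by (simp add: V_space_def c0_sum_def)
  show "\<bar>z n i\<bar> \<le> nrm (linf_fin (v n)) (z n)" for n i
    by (cases "i < v n") (simp_all add: linf_fin_abs_le linf_fin_nonneg V_outside[OF z])
qed

lemma V_abs_le:
  assumes z: "z \<in> carr (V_space v)"
  shows "\<bar>z n i\<bar> \<le> nrm (V_space v) z"
proof (cases "i < v n")
  case True
  then have "\<bar>z n i\<bar> \<le> nrm (linf_fin (v n)) (z n)" by (rule linf_fin_abs_le)
  also have "\<dots> \<le> nrm (V_space v) z"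
    using c0_sum_le[OF normed_carrier_linf_fin] z by (simp add: V_space_def)
  finally show ?thesis .
next
  case False
  then show ?thesis using V_outside[OF z] normed_carrier.nrm_nonneg[OF normed_carrier_V z] by simp
qed

text \<open>Blocks beyond some \<open>n0\<close> stay below \<open>\<epsilon>\<close>, and an
  earlier block has only \<open>v n\<close> coordinates. Milman's argument needs this finiteness to
  move a vector by a positive amount.\<close>

lemma V_finite_large:
  assumes z: "z \<in> carr (V_space v)" and "0 < \<epsilon>"
  shows "finite {(n, i). \<epsilon> \<le> \<bar>z n i\<bar>}"
proof -
  obtain b where b: "b \<longlonglongrightarrow> 0" "\<And>n i. \<bar>z n i\<bar> \<le> b n" using V_block_bound[OF z] by blast
  obtain n0 where n0: "\<And>n. n \<ge> n0 \<Longrightarrow> b n < \<epsilon>"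
    using order_tendstoD(2)[OF b(1) \<open>0 < \<epsilon>\<close>] by (auto simp: eventually_sequentially)
  have "(n, i) \<in> (SIGMA n:{..<n0}. {..<v n})" if "\<epsilon> \<le> \<bar>z n i\<bar>" for n i
  proof -
    have "n < n0" using n0[of n] b(2)[of n i] that by force
    moreover have "i < v n" using V_outside[OF z, of n i] that \<open>0 < \<epsilon>\<close> by force
    ultimately show ?thesis by simp
  qed
  then have "{(n, i). \<epsilon> \<le> \<bar>z n i\<bar>} \<subseteq> (SIGMA n:{..<n0}. {..<v n})" by blast
  then show ?thesis by (rule finite_subset) simp
qed

section \<open>Linear systems and Milman's lemma\<close>

text \<open>Gaussian elimination: an equation with a nonzero coefficient at \<open>b0\<close>
  removes the unknown \<open>b0\<close> from the other equations, and the value of that unknown is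
  restored from it at the end.\<close>

lemma homogeneous_system:
  fixes a :: "'t \<Rightarrow> 'b \<Rightarrow> real"
  assumes "finite F" "finite B" "card F < card B"
  shows "\<exists>c. (\<exists>b\<in>B. c b \<noteq> 0) \<and> (\<forall>t\<in>F. (\<Sum>b\<in>B. c b * a t b) = 0)"
  using assms
proof (induction F arbitrary: B a rule: finite_induct)
  case empty
  then have "B \<noteq> {}" by auto
  then show ?case by (intro exI[of _ "\<lambda>_. 1"]) auto
next
  case (insert t0 F)
  show ?case
  proof (cases "\<exists>b0\<in>B. a t0 b0 \<noteq> 0")
    case False
    have "card F < card B" using insert.hyps insert.prems by simp
    then obtain c where "\<exists>b\<in>B. c b \<noteq> 0" "\<forall>t\<in>F. (\<Sum>b\<in>B. c b * a t b) = 0"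
      using insert.IH[OF insert.prems(1)] by blast
    then show ?thesis using False by (intro exI[of _ c]) auto
  next
    case True
    then obtain b0 where b0: "b0 \<in> B" "a t0 b0 \<noteq> 0" by blast
    define a' where "a' t b = a t b - a t b0 / a t0 b0 * a t0 b" for t b
    have "card F < card (B - {b0})" using insert.hyps insert.prems b0 by simp
    then obtain c where c: "\<exists>b\<in>B-{b0}. c b \<noteq> 0" "\<And>t. t\<in>F \<Longrightarrow> (\<Sum>b\<in>B-{b0}. c b * a' t b) = 0"
      using insert.IH[of "B - {b0}" a'] insert.prems(1) by auto
    define s where "s = (\<Sum>b\<in>B-{b0}. c b * a t0 b)"
    define d where "d = c(b0 := - s / a t0 b0)"
    have eq: "(\<Sum>b\<in>B. d b * a t b) = - s / a t0 b0 * a t b0 + (\<Sum>b\<in>B-{b0}. c b * a t b)" for t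
      using sum.remove[OF insert.prems(1) b0(1), of "\<lambda>b. d b * a t b"] by (simp add: d_def)
    have "(\<Sum>b\<in>B. d b * a t b) = 0" if "t \<in> F" for t
    proof -
      have "(\<Sum>b\<in>B-{b0}. c b * a' t b) = (\<Sum>b\<in>B-{b0}. c b * a t b) - a t b0 / a t0 b0 * s"
        by (simp add: a'_def s_def algebra_simps sum_subtractf sum_distrib_left)
      then show ?thesis using c(2)[OF that] eq[of t] by simp
    qed
    moreover have "(\<Sum>b\<in>B. d b * a t0 b) = 0" using eq[of t0] b0 by (simp add: s_def)
    moreover have "\<exists>b\<in>B. d b \<noteq> 0" using c(1) by (auto simp: d_def)
    ultimately show ?thesis by blast
  qed
qed

text \<open>The coefficients with respect to \<open>B\<close> are the unknowns, and each functional
  contributes one equation. Linearity is asked for on \<open>E\<close> only, since operators are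
  extended by 0 off the carrier.\<close>

lemma common_kernel:
  fixes f :: "'t \<Rightarrow> 'a::real_vector \<Rightarrow> real"
  assumes E: "subspace E" and B: "B \<subseteq> E" "finite B" "independent B" and F: "finite F" "card F < card B"
    and add: "\<And>t x y. t \<in> F \<Longrightarrow> x \<in> E \<Longrightarrow> y \<in> E \<Longrightarrow> f t (x + y) = f t x + f t y"
    and scale: "\<And>t c x. t \<in> F \<Longrightarrow> x \<in> E \<Longrightarrow> f t (c *\<^sub>R x) = c * f t x"
  shows "\<exists>y\<in>E. y \<noteq> 0 \<and> (\<forall>t\<in>F. f t y = 0)"
proof -
  obtain c where c: "\<exists>b\<in>B. c b \<noteq> 0" "\<And>t. t\<in>F \<Longrightarrow> (\<Sum>b\<in>B. c b * f t b) = 0"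
    using homogeneous_system[OF F(1) B(2) F(2)] by blast
  define y where "y = (\<Sum>b\<in>B. c b *\<^sub>R b)"
  have inE: "(\<Sum>b\<in>D. c b *\<^sub>R b) \<in> E" if "D \<subseteq> B" for D
    using that B E by (intro subspace_sum) (auto intro: subspace_scale)
  have "f t (\<Sum>b\<in>D. c b *\<^sub>R b) = (\<Sum>b\<in>D. c b * f t b)" if "t \<in> F" "D \<subseteq> B" for t D
    using finite_subset[OF that(2) B(2)] that(2)
  proof (induction D rule: finite_induct)
    case empty
    show ?case using scale[OF that(1) subspace_0[OF E], of 0] by simp
  next
    case (insert b D)
    then have "b \<in> E" "c b *\<^sub>R b \<in> E" using B E by (auto intro: subspace_scale)
    with insert show ?case using add[OF that(1)] scale[OF that(1)] inE by simp
  qed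
  then have "\<forall>t\<in>F. f t y = 0" using c(2) by (simp add: y_def)
  moreover have "y \<noteq> 0" using c(1) B by (auto simp: y_def dependent_finite)
  ultimately show ?thesis using inE[OF order_refl] by (auto simp: y_def)
qed

text \<open>Milman's argument: move \<open>x\<close> along a direction that keeps the coordinates already equal to
  \<open>\<plusminus>1\<close> fixed, up to the last moment at which no coordinate exceeds \<open>1\<close>; since only finitely many
  coordinates are close to \<open>1\<close>, a new one is reached.\<close>

lemma milman:
  fixes f :: "'t \<Rightarrow> 'a::real_vector \<Rightarrow> real"
  assumes E: "subspace E"
    and add: "\<And>t x y. x \<in> E \<Longrightarrow> y \<in> E \<Longrightarrow> f t (x + y) = f t x + f t y"
    and scale: "\<And>t c x. x \<in> E \<Longrightarrow> f t (c *\<^sub>R x) = c * f t x"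
    and c0: "\<And>x \<epsilon>. x \<in> E \<Longrightarrow> 0 < \<epsilon> \<Longrightarrow> finite {t. \<epsilon> \<le> \<bar>f t x\<bar>}"
    and dir: "\<And>J. finite J \<Longrightarrow> card J < q \<Longrightarrow> \<exists>y\<in>E. (\<exists>t. f t y \<noteq> 0) \<and> (\<forall>t\<in>J. f t y = 0)"
  shows "\<exists>x\<in>E. \<exists>J. finite J \<and> card J = q \<and> (\<forall>t\<in>J. \<bar>f t x\<bar> = 1) \<and> (\<forall>t. \<bar>f t x\<bar> \<le> 1)"
  using dir
proof (induction q)
  case 0
  have "f t 0 = 0" for t using scale[OF subspace_0[OF E], of t 0] by simp
  then show ?case using subspace_0[OF E] by (intro bexI[of _ 0] exI[of _ "{}"]) auto
next
  case (Suc q)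
  obtain x J where x: "x \<in> E" and J: "finite J" "card J = q" "\<And>t. t \<in> J \<Longrightarrow> \<bar>f t x\<bar> = 1"
    and le: "\<And>t. \<bar>f t x\<bar> \<le> 1"
    using Suc.IH Suc.prems less_SucI by blast
  obtain y t1 where y: "y \<in> E" "f t1 y \<noteq> 0" "\<And>t. t \<in> J \<Longrightarrow> f t y = 0"
    using Suc.prems[OF J(1)] J(2) by auto
  have lin: "f t (x + s *\<^sub>R y) = f t x + s * f t y" for t s
    using add[OF x subspace_scale[OF E y(1)]] scale[OF y(1)] by simp
  \<comment> \<open>The admissible step lengths. Each condition is closed in \<open>s\<close>, and
    the coordinate \<open>t1\<close>, on which \<open>y\<close> does not vanish, bounds the set, so
    a largest step exists.\<close>
  define S where "S = {s. 0 \<le> s \<and> (\<forall>t. \<bar>f t x + s * f t y\<bar> \<le> 1)}"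
  have "closed S"
    unfolding S_def
    by (intro closed_Collect_conj closed_Collect_all closed_Collect_le continuous_intros)
  moreover have "0 \<in> S" using le by (simp add: S_def)
  moreover have bdd: "bdd_above S"
  proof (rule bdd_aboveI)
    fix s assume "s \<in> S"
    then have "0 \<le> s" "\<bar>f t1 x + s * f t1 y\<bar> \<le> 1" by (auto simp: S_def)
    then have "s * \<bar>f t1 y\<bar> \<le> 2" using le[of t1] abs_mult[of s "f t1 y"] by linarith
    then show "s \<le> 2 / \<bar>f t1 y\<bar>" using y(2) by (simp add: field_simps)
  qed
  ultimately have "Sup S \<in> S" by (intro closed_contains_Sup) auto
  define s where "s = Sup S"
  have s: "0 \<le> s" "\<And>t. \<bar>f t x + s * f t y\<bar> \<le> 1" using \<open>Sup S \<in> S\<close> by (auto simp: S_def s_def)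
  define z where "z = x + s *\<^sub>R y"
  have z: "z \<in> E" "\<And>t. \<bar>f t z\<bar> \<le> 1"
    using x y E s(2) lin by (auto simp: z_def intro: subspace_add subspace_scale)
  have "\<exists>t. t \<notin> J \<and> \<bar>f t z\<bar> = 1"
  proof (rule ccontr)
    assume "\<nexists>t. t \<notin> J \<and> \<bar>f t z\<bar> = 1"
    then have less: "\<bar>f t z\<bar> < 1" if "t \<notin> J" for t using that z(2)[of t] by force
    \<comment> \<open>Coordinates in \<open>J\<close> do not move. Among the others, only those at
      which \<open>z\<close> or \<open>y\<close> reaches 1/2 can obstruct a step of length at most
      1; they are finitely many, so one positive \<open>r\<close> suits all of them.\<close>
    define D where "D = ({t. 1/2 \<le> \<bar>f t z\<bar>} \<union> {t. 1/2 \<le> \<bar>f t y\<bar>}) - J"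
    have D: "finite D" using c0[OF z(1), of "1/2"] c0[OF y(1), of "1/2"] by (simp add: D_def)
    define r where "r = Min (insert 1 ((\<lambda>t. (1 - \<bar>f t z\<bar>) / (\<bar>f t y\<bar> + 1)) ` D))"
    have rD: "r \<le> (1 - \<bar>f t z\<bar>) / (\<bar>f t y\<bar> + 1)" if "t \<in> D" for t
      using D that by (auto simp: r_def)
    have r0: "0 < r" using D less by (auto simp: r_def D_def)
    have r1: "r \<le> 1" using D by (auto simp: r_def)
    have "\<bar>f t x + (s + r) * f t y\<bar> \<le> 1" for t
    proof -
      have eq: "f t x + (s + r) * f t y = f t z + r * f t y"
        using lin[of t s] by (simp add: z_def algebra_simps)
      have tri: "\<bar>f t z + r * f t y\<bar> \<le> \<bar>f t z\<bar> + r * \<bar>f t y\<bar>"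
        using abs_triangle_ineq[of "f t z" "r * f t y"] r0 by (simp add: abs_mult)
      consider "t \<in> J" | "t \<in> D" | "\<bar>f t z\<bar> < 1/2" "\<bar>f t y\<bar> < 1/2"
        by (force simp: D_def)
      then have "\<bar>f t z + r * f t y\<bar> \<le> 1"
      proof cases
        case 1
        then show ?thesis using y(3) z(2) by simp
      next
        case 2
        from rD[OF this] have "r * (\<bar>f t y\<bar> + 1) \<le> 1 - \<bar>f t z\<bar>" by (simp add: field_simps)
        then show ?thesis using tri r0 by (simp add: algebra_simps)
      next
        case 3
        have "r * \<bar>f t y\<bar> \<le> 1 * \<bar>f t y\<bar>" using r1 by (intro mult_right_mono) auto
        then show ?thesis using tri 3 by simp
      qed
      then show ?thesis using eq by simp
    qed
    then have "s + r \<in> S" using s(1) r0 by (simp add: S_def)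
    then have "s + r \<le> s" unfolding s_def by (rule cSup_upper[OF _ bdd])
    then show False using r0 by simp
  qed
  then obtain t2 where t2: "t2 \<notin> J" "\<bar>f t2 z\<bar> = 1" by blast
  have "\<forall>t\<in>insert t2 J. \<bar>f t z\<bar> = 1" using t2 J(3) y(3) lin by (simp add: z_def)
  then show ?case using z t2(1) J by (intro bexI[of _ z] exI[of _ "insert t2 J"]) auto
qed

section \<open>Cutting one scalar sequence into blocks of different sizes\<close>

lemma concat_blocks_apply:
  assumes "i < d n"
  shows "concat_blocks d x ((\<Sum>m<n. d m) + i) = x n i"
proof -
  have "(LEAST k. (\<Sum>m<n. d m) + i < (\<Sum>m\<le>k. d m)) = n"
  proof (rule Least_equality)
    show "(\<Sum>m<n. d m) + i < (\<Sum>m\<le>n. d m)" using assms by (simp add: lessThan_Suc_atMost[symmetric])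
  next
    fix k assume k: "(\<Sum>m<n. d m) + i < (\<Sum>m\<le>k. d m)"
    show "n \<le> k"
    proof (rule ccontr)
      assume "\<not> n \<le> k"
      then have "(\<Sum>m\<le>k. d m) \<le> (\<Sum>m<n. d m)" by (intro sum_mono2) auto
      with k show False by simp
    qed
  qed
  then show ?thesis by (simp add: concat_blocks_def Let_def)
qed

lemma block_position:
  fixes d :: "nat \<Rightarrow> nat"
  assumes "\<And>n. 0 < d n"
  obtains n i where "i < d n" "k = (\<Sum>m<n. d m) + i"
proof -
  have "n \<le> (\<Sum>m<n. d m)" for n
    using sum_mono[of "{..<n}" "\<lambda>_. 1" d] assms by (simp add: Suc_leI)
  then have ex: "k < (\<Sum>m\<le>k. d m)" using order_less_le_trans[OF lessI, of k] by (metis lessThan_Suc_atMost)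
  define n where "n = (LEAST n. k < (\<Sum>m\<le>n. d m))"
  have n: "k < (\<Sum>m\<le>n. d m)" unfolding n_def by (rule LeastI[of _ k]) (rule ex)
  have "(\<Sum>m<n. d m) \<le> k"
  proof (cases n)
    case (Suc n')
    then have "\<not> k < (\<Sum>m\<le>n'. d m)" using not_less_Least[of n' "\<lambda>n. k < (\<Sum>m\<le>n. d m)"] by (simp add: n_def)
    then show ?thesis using Suc by (simp add: lessThan_Suc_atMost)
  qed simp
  then show ?thesis using that[of "k - (\<Sum>m<n. d m)" n] n by (simp add: lessThan_Suc_atMost[symmetric])
qed

lemma concat_blocks_tendsto:
  assumes d: "\<And>n. 0 < d n" and b: "b \<longlonglongrightarrow> 0" "\<And>n i. i < d n \<Longrightarrow> \<bar>x n i\<bar> \<le> b n"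
  shows "concat_blocks d x \<longlonglongrightarrow> 0"
proof (rule LIMSEQ_I)
  fix \<epsilon> :: real assume "0 < \<epsilon>"
  then obtain n0 where n0: "\<And>n. n \<ge> n0 \<Longrightarrow> b n < \<epsilon>"
    using order_tendstoD(2)[OF b(1)] by (auto simp: eventually_sequentially)
  have "norm (concat_blocks d x k - 0) < \<epsilon>" if k: "k \<ge> (\<Sum>m<n0. d m)" for k
  proof -
    obtain n i where ni: "i < d n" "k = (\<Sum>m<n. d m) + i" by (rule block_position[OF d])
    have "n0 \<le> n"
    proof (rule ccontr)
      assume "\<not> n0 \<le> n"
      then have "(\<Sum>m<Suc n. d m) \<le> (\<Sum>m<n0. d m)" by (intro sum_mono2) auto
      then show False using k ni by simp
    qed
    then show ?thesis using b(2)[OF ni(1)] n0[of n] concat_blocks_apply[of i d n x, OF ni(1)] ni(2) by simp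
  qed
  then show "\<exists>k0. \<forall>k\<ge>k0. norm (concat_blocks d x k - 0) < \<epsilon>" by blast
qed

lemma concat_blocks_abs_le:
  assumes d: "\<And>n. 0 < d n" and K: "\<And>n i. i < d n \<Longrightarrow> \<bar>x n i\<bar> \<le> K"
  shows "\<bar>concat_blocks d x k\<bar> \<le> K"
proof -
  obtain n i where "i < d n" "k = (\<Sum>m<n. d m) + i" by (rule block_position[OF d])
  then show ?thesis using K concat_blocks_apply[of i d n x] by simp
qed

lemma concat_blocks_cong:
  assumes d: "\<And>n. 0 < d n" and eq: "\<And>n i. i < d n \<Longrightarrow> x n i = y n i"
  shows "concat_blocks d x = concat_blocks d y"
proof
  fix k
  obtain n i where "i < d n" "k = (\<Sum>m<n. d m) + i" by (rule block_position[OF d])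
  then show "concat_blocks d x k = concat_blocks d y k" using eq concat_blocks_apply[of i d n] by simp
qed

lemma concat_blocks_add: "concat_blocks d (x + y) = concat_blocks d x + concat_blocks d y"
  and concat_blocks_scale: "concat_blocks d (c *\<^sub>R x) = c *\<^sub>R concat_blocks d x"
  by (auto simp: concat_blocks_def Let_def fun_eq_iff)

lemma split_blocks_add: "split_blocks d (x + y) = split_blocks d x + split_blocks d y"
  and split_blocks_scale: "split_blocks d (c *\<^sub>R x) = c *\<^sub>R split_blocks d x"
  by (auto simp: split_blocks_def fun_eq_iff)

lemma concat_split_blocks:
  assumes "\<And>n. 0 < d n"
  shows "concat_blocks d (split_blocks d y) = y"
proof
  fix k
  obtain n i where "i < d n" "k = (\<Sum>m<n. d m) + i" by (rule block_position[OF assms])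
  then show "concat_blocks d (split_blocks d y) k = y k"
    using concat_blocks_apply[of i d n "split_blocks d y"] by (simp add: split_blocks_def)
qed

lemma split_blocks_V:
  assumes v: "\<And>n. 0 < v n" and y: "y \<longlonglongrightarrow> 0" "\<And>k. \<bar>y k\<bar> \<le> K"
  shows "split_blocks v y \<in> carr (V_space v)" "nrm (V_space v) (split_blocks v y) \<le> K"
proof -
  have "0 \<le> K" using y(2)[of 0] by linarith
  then show "nrm (V_space v) (split_blocks v y) \<le> K"
    using y(2) by (intro V_nrm_le) (auto simp: split_blocks_def)
  have mono: "strict_mono (\<lambda>n. \<Sum>m<n. v m)"
    by (rule strict_monoI_Suc) (simp add: v)
  have conv: "\<exists>N. \<forall>k\<ge>N. \<bar>y k\<bar> < \<epsilon>" if "\<epsilon> > 0" for \<epsilon>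
    using LIMSEQ_D[OF y(1) that] by simp
  \<comment> \<open>Suprema of tails. Every block is nonempty, so block \<open>n\<close> starts at
    position \<open>n\<close> or later and is bounded by \<open>c n\<close>.\<close>
  define c where "c n = (SUP k\<in>{n..}. \<bar>y k\<bar>)" for n :: nat
  have bdd: "bdd_above ((\<lambda>k. \<bar>y k\<bar>) ` A)" for A using y(2) by (auto simp: bdd_above_def)
  have "c \<longlonglongrightarrow> 0"
  proof (rule LIMSEQ_I)
    fix \<epsilon> :: real assume "\<epsilon> > 0"
    then obtain N where N: "\<And>k. k \<ge> N \<Longrightarrow> \<bar>y k\<bar> < \<epsilon> / 2" using conv[of "\<epsilon> / 2"] by auto
    have "norm (c n - 0) < \<epsilon>" if "n \<ge> N" for n
    proof -
      have "c n \<le> \<epsilon> / 2" unfolding c_def by (rule cSUP_least) (use N that in \<open>auto intro: less_imp_le\<close>)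
      moreover have "\<bar>y n\<bar> \<le> c n" unfolding c_def by (rule cSUP_upper[OF _ bdd]) simp
      ultimately show ?thesis using \<open>\<epsilon> > 0\<close> by simp
    qed
    then show "\<exists>N. \<forall>n\<ge>N. norm (c n - 0) < \<epsilon>" by blast
  qed
  show "split_blocks v y \<in> carr (V_space v)"
  proof (rule V_carrI[OF _ _ \<open>c \<longlonglongrightarrow> 0\<close>])
    fix n i assume "i < v n"
    have "n \<le> (\<Sum>m<n. v m)" using strict_mono_imp_increasing[OF mono] by simp
    then show "\<bar>split_blocks v y n i\<bar> \<le> c n"
      using \<open>i < v n\<close> unfolding c_def by (auto simp: split_blocks_def intro: cSUP_upper[OF _ bdd])
  qed (simp add: split_blocks_def)
qed

section \<open>Factorizations of the operators\<close>

text \<open>Moving the n-th block to position \<open>m n\<close> and filling up with zero blocks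
  does not alter the sum of p-th powers, so a blockwise bound \<open>K\<close> becomes an operator
  bound.\<close>

lemma U_reindexed:
  assumes p: "1 \<le> p" and x: "x \<in> carr (U_space p u)" and m: "strict_mono m"
    and y: "\<And>n. y (m n) \<in> carr (l2_fin (u (m n)))" "\<And>k. k \<notin> range m \<Longrightarrow> y k = 0"
    and K: "0 \<le> K" "\<And>n. nrm (l2_fin (u (m n))) (y (m n)) \<le> K * nrm (l2_fin (u n)) (x n)"
  shows "y \<in> carr (U_space p u)" "nrm (U_space p u) y \<le> K * nrm (U_space p u) x"
proof -
  define f where "f k = nrm (l2_fin (u k)) (y k) powr p" for k
  define e where "e n = nrm (l2_fin (u n)) (x n) powr p" for n
  have se: "summable e" using x by (simp add: U_space_def lp_sum_def e_def[abs_def])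
  have f0: "f k = 0" if "k \<notin> range m" for k
    using y(2)[OF that] normed_carrier.nrm_zero[OF normed_carrier_l2_fin] by (simp add: f_def)
  have le: "f (m n) \<le> K powr p * e n" for n
    using powr_mono2[OF _ l2_fin_nonneg K(2), of p] p K(1) l2_fin_nonneg
    by (simp add: f_def e_def powr_mult)
  have sfm: "summable (\<lambda>n. f (m n))"
    by (rule summable_comparison_test'[OF summable_mult[OF se, of "K powr p"], of 0])
      (use le in \<open>auto simp: f_def\<close>)
  then have sf: "summable f" using summable_mono_reindex[of m f, OF m f0] by blast
  have carr: "y k \<in> carr (l2_fin (u k))" for k
    using y normed_carrier.carr_zero[OF normed_carrier_l2_fin] by (cases "k \<in> range m") auto
  show "y \<in> carr (U_space p u)" using sf carr by (simp add: U_space_def lp_sum_def f_def[abs_def])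
  have "suminf f = (\<Sum>n. f (m n))" using suminf_mono_reindex[of m f, OF m f0] by simp
  also have "\<dots> \<le> (\<Sum>n. K powr p * e n)" by (rule suminf_le[OF le sfm summable_mult[OF se]])
  also have "\<dots> = K powr p * suminf e" by (rule suminf_mult[OF se])
  finally have "suminf f powr (1/p) \<le> (K powr p * suminf e) powr (1/p)"
    using p suminf_nonneg[OF sf] by (intro powr_mono2) (auto simp: f_def)
  moreover have "0 \<le> suminf e" using suminf_nonneg[OF se] by (simp add: e_def)
  ultimately show "nrm (U_space p u) y \<le> K * nrm (U_space p u) x"
    using p K(1) by (simp add: U_space_def lp_sum_def f_def[abs_def] e_def[abs_def] powr_mult powr_powr)
qed

text \<open>The dual vector \<open>h i\<close> is sought in the span of the \<open>g b\<close>: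
  orthogonality to the other d - 1 vectors has a nontrivial solution, and the Riesz bound keeps it
  from being orthogonal to \<open>g i\<close> as well. The same bound, read through duality, gives
  the constant \<open>sqrt 2\<close>.\<close>

lemma biorthogonal_system:
  fixes g :: "nat \<Rightarrow> nat \<Rightarrow> real"
  assumes riesz: "\<And>a. 1/2 * (\<Sum>i<d. \<bar>a i\<bar>\<^sup>2) \<le> (nrm (l2_fin k) (\<Sum>i<d. a i *\<^sub>R g i))\<^sup>2"
    and carr: "\<And>i. i < d \<Longrightarrow> g i \<in> carr (l2_fin k)"
  obtains h where "\<And>i. h i \<in> carr (l2_fin k)"
    "\<And>i j. i < d \<Longrightarrow> j < d \<Longrightarrow> inner_fin k (h i) (g j) = (if i = j then 1 else 0)"
    "\<And>a. nrm (l2_fin k) (\<Sum>i<d. a i *\<^sub>R h i) \<le> sqrt 2 * nrm (l2_fin d) a"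
proof -
  have sub: "subspace (carr (l2_fin k))" by (rule normed_carrier.carr_subspace[OF normed_carrier_l2_fin])
  have self: "(nrm (l2_fin k) w)\<^sup>2 = (\<Sum>b<d. c b * inner_fin k w (g b))" if "w = (\<Sum>b<d. c b *\<^sub>R g b)" for w c
  proof -
    have "inner_fin k w w = (\<Sum>b<d. c b * inner_fin k (g b) w)"
      unfolding arg_cong[OF that, of "\<lambda>z. inner_fin k z w"] by (rule inner_fin_sum)
    then show ?thesis by (simp add: inner_fin_self inner_fin_commute)
  qed
  define dual where "dual i c \<longleftrightarrow> (\<forall>j<d. inner_fin k (\<Sum>b<d. c b *\<^sub>R g b) (g j) = (if i = j then 1 else 0))" for i c
  have "\<exists>c. dual i c" if i: "i < d" for i
  proof -
    have "card ({..<d} - {i}) < card {..<d}" using i by (intro psubset_card_mono) auto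
    then obtain c where c: "\<exists>b\<in>{..<d}. c b \<noteq> 0"
        "\<And>t. t \<in> {..<d} - {i} \<Longrightarrow> (\<Sum>b<d. c b * inner_fin k (g b) (g t)) = 0"
      using homogeneous_system[of "{..<d} - {i}" "{..<d}" "\<lambda>t b. inner_fin k (g b) (g t)"] by auto
    define w where "w = (\<Sum>b<d. c b *\<^sub>R g b)"
    have w0: "inner_fin k w (g t) = 0" if "t < d" "t \<noteq> i" for t
      using c(2)[of t] that by (simp add: w_def inner_fin_sum)
    have "(nrm (l2_fin k) w)\<^sup>2 = c i * inner_fin k w (g i)"
      using self[OF w_def] i w0 by (subst (asm) sum.remove[of _ i]) auto
    moreover have "0 < (nrm (l2_fin k) w)\<^sup>2"
    proof -
      obtain b where "b < d" "c b \<noteq> 0" using c(1) by auto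
      then have "0 < (\<Sum>i<d. \<bar>c i\<bar>\<^sup>2)" by (intro sum_pos2[of _ b]) auto
      then show ?thesis using riesz[of c] unfolding w_def by linarith
    qed
    ultimately have nz: "inner_fin k w (g i) \<noteq> 0" by auto
    have "(\<Sum>b<d. (c b / inner_fin k w (g i)) *\<^sub>R g b) = (1 / inner_fin k w (g i)) *\<^sub>R w"
      unfolding w_def by (simp add: scaleR_sum_right del: scaleR_fun_apply sum_fun_apply)
    then have "inner_fin k (\<Sum>b<d. (c b / inner_fin k w (g i)) *\<^sub>R g b) (g j) = (if i = j then 1 else 0)"
      if "j < d" for j
      using nz w0[of j] that by (simp only: inner_fin_scale) auto
    then show ?thesis unfolding dual_def by (intro exI[of _ "\<lambda>b. c b / inner_fin k w (g i)"]) blast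
  qed
  then obtain C where "\<And>i. i < d \<Longrightarrow> dual i (C i)" by metis
  then have C: "inner_fin k (\<Sum>b<d. C i b *\<^sub>R g b) (g j) = (if i = j then 1 else 0)"
    if "i < d" "j < d" for i j
    using that by (simp only: dual_def)
  define h where "h i = (\<Sum>b<d. C i b *\<^sub>R g b)" for i
  show ?thesis
  proof
    show "h i \<in> carr (l2_fin k)" for i
      unfolding h_def using carr by (intro subspace_sum[OF sub] subspace_scale[OF sub]) auto
    show "inner_fin k (h i) (g j) = (if i = j then 1 else 0)" if "i < d" "j < d" for i j
      using C[OF that] by (simp add: h_def)
    fix a
    define w where "w = (\<Sum>i<d. a i *\<^sub>R h i)"
    \<comment> \<open>The coefficients of \<open>w\<close> with respect to the \<open>g b\<close>.
      The squared norm of \<open>w\<close> is the inner product of \<open>\<beta>\<close> and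
      \<open>a\<close>, and the Riesz bound estimates \<open>\<beta>\<close> by
      \<open>sqrt 2\<close> times the norm of \<open>w\<close>, one factor of which then
      cancels.\<close>
    define \<beta> where "\<beta> b = (\<Sum>i<d. a i * C i b)" for b
    have w: "w = (\<Sum>b<d. \<beta> b *\<^sub>R g b)"
      unfolding w_def h_def \<beta>_def scaleR_sum_right scaleR_sum_left scaleR_scaleR by (rule sum.swap)
    have wg: "inner_fin k w (g j) = a j" if "j < d" for j
    proof -
      have "inner_fin k w (g j) = (\<Sum>i<d. if i = j then a i else 0)"
        unfolding w_def inner_fin_sum using C that by (intro sum.cong) (auto simp: h_def)
      then show ?thesis using that by simp
    qed
    have "(nrm (l2_fin k) w)\<^sup>2 = inner_fin d \<beta> a"
      using self[OF w] wg by (simp add: inner_fin_def)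
    also have "\<dots> \<le> nrm (l2_fin d) \<beta> * nrm (l2_fin d) a"
      using inner_fin_cauchy_schwarz[of d \<beta> a] by linarith
    also have "\<dots> \<le> (sqrt 2 * nrm (l2_fin k) w) * nrm (l2_fin d) a"
    proof (rule mult_right_mono)
      have "(nrm (l2_fin d) \<beta>)\<^sup>2 \<le> 2 * (nrm (l2_fin k) w)\<^sup>2"
        using riesz[of \<beta>] unfolding l2_fin_sq[of d] w[symmetric] power2_abs by linarith
      then have "(nrm (l2_fin d) \<beta>)\<^sup>2 \<le> (sqrt 2 * nrm (l2_fin k) w)\<^sup>2"
        unfolding power_mult_distrib by simp
      then show "nrm (l2_fin d) \<beta> \<le> sqrt 2 * nrm (l2_fin k) w"
        by (rule power2_le_imp_le) (simp add: l2_fin_nonneg)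
    qed (rule l2_fin_nonneg)
    finally have "nrm (l2_fin k) w * nrm (l2_fin k) w \<le> nrm (l2_fin k) w * (sqrt 2 * nrm (l2_fin d) a)"
      by (simp add: power2_eq_square mult_ac)
    then have "nrm (l2_fin k) w \<le> sqrt 2 * nrm (l2_fin d) a"
      using l2_fin_nonneg[of k w] l2_fin_nonneg[of d a]
      by (cases "nrm (l2_fin k) w = 0") (auto simp: mult_le_cancel_left_pos)
    then show "nrm (l2_fin k) (\<Sum>i<d. a i *\<^sub>R h i) \<le> sqrt 2 * nrm (l2_fin d) a"
      by (simp add: w_def)
  qed
qed

section \<open>The standing hypotheses and the growth of \<open>s\<close>\<close>

locale block_setting =
  fixes p :: real and u v :: "nat \<Rightarrow> nat" and g :: "nat \<Rightarrow> nat \<Rightarrow> nat \<Rightarrow> real"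
  assumes p: "1 \<le> p"
    and pos: "0 < u 0"
    and interlaced: "\<And>n. u n < v n \<and> v n < u (Suc n)"
    and unit: "\<And>n i. i < v n \<Longrightarrow> g n i \<in> carr (l2_fin (u n)) \<and> nrm (l2_fin (u n)) (g n i) = 1"
    and v_large: "\<And>n. real (v n) \<ge> 9 * real (n + 1) ^ 3 * s_seq p u (n + 1)"
    and riesz: "\<And>n J a. J \<subseteq> {..<v n} \<Longrightarrow>
        real (card J) \<le> max (s_seq p u n + 1) (19 * real (n + 1) ^ 2) \<Longrightarrow>
        1/2 * (\<Sum>i\<in>J. \<bar>a i\<bar>\<^sup>2) \<le> (nrm (l2_fin (u n)) (\<Sum>i\<in>J. a i *\<^sub>R g n i))\<^sup>2 \<and>
        (nrm (l2_fin (u n)) (\<Sum>i\<in>J. a i *\<^sub>R g n i))\<^sup>2 \<le> 2 * (\<Sum>i\<in>J. \<bar>a i\<bar>\<^sup>2)"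
    and bessel: "\<And>n J x. J \<subseteq> {..<v n} \<Longrightarrow>
        real (card J) \<le> max (s_seq p u n + 1) (19 * real (n + 1) ^ 2) \<Longrightarrow>
        x \<in> carr (l2_fin (u n)) \<Longrightarrow>
        (\<Sum>i\<in>J. \<bar>inner_fin (u n) x (g n i)\<bar>\<^sup>2) \<le> 2 * (nrm (l2_fin (u n)) x)\<^sup>2"
begin

abbreviation "U \<equiv> U_space p u"
abbreviation "V \<equiv> V_space v"
abbreviation "T \<equiv> T_op p u v g"
abbreviation "I \<equiv> formal_incl p u v"
abbreviation "s \<equiv> s_seq p u"

sublocale U: normed_carrier U by (rule normed_carrier_U[OF p])
sublocale V: normed_carrier V by (rule normed_carrier_V)

lemmas UV = U.normed_carrier_axioms V.normed_carrier_axioms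

lemma strict_mono_u: "strict_mono u"
  by (rule strict_monoI_Suc) (use interlaced order_less_trans in blast)

lemma u_pos: "0 < u n"
  using pos strict_mono_less_eq[OF strict_mono_u, of 0 n] by simp

lemma v_pos: "0 < v n"
  using interlaced[of n] by simp

lemma v_less_u: "m < n \<Longrightarrow> v m < u n"
  using interlaced[of m] strict_mono_less_eq[OF strict_mono_u, of "Suc m" n] by (simp add: Suc_le_eq)

text \<open>For p < 2 this is the definition. For p >= 2 the two factors of \<open>s (Suc n)\<close>
  raise numbers that are at least 1 to exponents at least 1 and 2.\<close>

lemma s_ge: "2 * real (u n) * real (n + 1)^2 \<le> s (Suc n)"
proof (cases "2 \<le> p")
  case True
  have "2 * real (u n) = (2 * real (u n)) powr 1" by simp
  also have "\<dots> \<le> (2 * real (u n)) powr (p / 2)"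
    using True u_pos[of n] by (intro powr_mono) auto
  finally have 1: "2 * real (u n) \<le> (2 * real (u n)) powr (p / 2)" .
  have "real (n + 1)^2 = real (n + 1) powr 2" by (simp add: powr_numeral)
  also have "\<dots> \<le> real (n + 1) powr p" using True by (intro powr_mono) auto
  finally show ?thesis using True 1 by (auto intro: mult_mono)
qed (simp add: add.commute)

lemma s_mono: "n \<le> m \<Longrightarrow> s (Suc n) \<le> s (Suc m)"
  using strict_mono_less_eq[OF strict_mono_u, of n m] p
  by (auto intro!: mult_mono powr_mono2 power_mono)

text \<open>Makes the first \<open>u n\<close> vectors of any later block an admissible set for
  \<open>riesz\<close>, as embedding block \<open>n\<close> into block \<open>m\<close>
  requires.\<close>

lemma u_le_s:
  assumes "n < m"
  shows "real (u n) \<le> s m + 1"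
proof -
  obtain k where k: "m = Suc k" "n \<le> k" using assms by (cases m) auto
  have "real (u n) \<le> 2 * real (u n) * real (n + 1)^2"
    by (simp add: mult_le_cancel_left1 power2_eq_square algebra_simps)
  also have "\<dots> \<le> s (Suc k)" using s_ge[of n] s_mono[OF k(2)] by linarith
  finally show ?thesis using k by simp
qed

lemma T_apply:
  assumes "x \<in> carr U"
  shows "T M x n i = (if n \<in> M \<and> i < v n then inner_fin (u n) (x n) (g n i) else 0)"
  using assms by (simp add: T_op_def T_block_def)

lemma inner_g_le: "i < v n \<Longrightarrow> \<bar>inner_fin (u n) x (g n i)\<bar> \<le> nrm (l2_fin (u n)) x"
  using inner_fin_cauchy_schwarz[of "u n" x "g n i"] unit[of i n] by simp

lemma T_ops: "T M \<in> ops U V"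
proof (rule opsI[where K=1])
  fix x assume x: "x \<in> carr U"
  have le: "\<bar>T M x n i\<bar> \<le> nrm (l2_fin (u n)) (x n)" for n i
    using inner_g_le by (auto simp: T_apply[OF x] l2_fin_nonneg)
  show "T M x \<in> carr V"
    by (rule V_carrI[OF _ le U_block_tendsto[OF p x]]) (simp add: T_apply[OF x])
  show "nrm V (T M x) \<le> 1 * nrm U x"
    using order_trans[OF le U_block(2)[OF p x]] U.nrm_nonneg[OF x] by (auto intro: V_nrm_le)
  show "T M (c *\<^sub>R x) = c *\<^sub>R T M x" for c
    using x U.carr_scale[OF x, of c] by (auto simp: fun_eq_iff T_apply inner_fin_scale)
  fix y assume y: "y \<in> carr U"
  show "T M (x + y) = T M x + T M y"
    using x y U.carr_add[OF x y] by (auto simp: fun_eq_iff T_apply inner_fin_add)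
qed (simp add: T_op_def)

definition restrict_blocks :: "nat set \<Rightarrow> (nat \<Rightarrow> nat \<Rightarrow> real) \<Rightarrow> nat \<Rightarrow> nat \<Rightarrow> real" where
  "restrict_blocks M x = (if x \<in> carr U then (\<lambda>n. if n \<in> M then x n else 0) else 0)"

lemma restrict_blocks_dominated:
  assumes x: "x \<in> carr U"
  shows "restrict_blocks M x \<in> carr U" "nrm U (restrict_blocks M x) \<le> 1 * nrm U x"
proof -
  have "restrict_blocks M x n \<in> carr (l2_fin (u n))" for n
    using U_block(1)[OF p x] x normed_carrier.carr_zero[OF normed_carrier_l2_fin]
    by (auto simp: restrict_blocks_def)
  moreover have "nrm (l2_fin (u n)) (restrict_blocks M x n) \<le> 1 * nrm (l2_fin (u n)) (x n)" for n
    using x normed_carrier.nrm_zero[OF normed_carrier_l2_fin]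
    by (auto simp: restrict_blocks_def l2_fin_nonneg)
  ultimately show "restrict_blocks M x \<in> carr U" "nrm U (restrict_blocks M x) \<le> 1 * nrm U x"
    using U_dominated[OF p x, of "restrict_blocks M x" 1] by auto
qed

lemma restrict_blocks_ops: "restrict_blocks M \<in> ops U U"
  by (rule opsI[where K=1])
    (use restrict_blocks_dominated in \<open>auto simp: restrict_blocks_def fun_eq_iff U.carr_add U.carr_scale\<close>)

lemma T_restrict_blocks: "M \<subseteq> N \<Longrightarrow> T N \<circ> restrict_blocks M = T M"
proof
  fix x assume "M \<subseteq> N"
  show "(T N \<circ> restrict_blocks M) x = T M x"
  proof (cases "x \<in> carr U")
    case True
    then show ?thesis
      using \<open>M \<subseteq> N\<close> restrict_blocks_dominated(1)[OF True]
      by (auto simp: fun_eq_iff T_apply) (auto simp: restrict_blocks_def inner_fin_zero)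
  next
    case False
    then have "restrict_blocks M x = 0" by (simp add: restrict_blocks_def)
    then show ?thesis
      using False ops_zero[OF UV(1) T_ops] ops_outside[OF T_ops False] by simp
  qed
qed

lemma T_Un: "M \<inter> N = {} \<Longrightarrow> T (M \<union> N) = T M + T N"
  using T_ops ops_outside by (auto simp: T_op_def fun_eq_iff)

text \<open>\<open>concat_blocks u\<close> reads only the first \<open>u n\<close> coordinates of
  the block \<open>z (m n)\<close> and discards the rest; the resulting sequence is cut again along
  \<open>v\<close> to land in V.\<close>

definition select_blocks :: "(nat \<Rightarrow> nat) \<Rightarrow> (nat \<Rightarrow> nat \<Rightarrow> real) \<Rightarrow> nat \<Rightarrow> nat \<Rightarrow> real" where
  "select_blocks m z = (if z \<in> carr V then split_blocks v (concat_blocks u (\<lambda>n. z (m n))) else 0)"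

lemma select_blocks_ops:
  assumes m: "strict_mono m"
  shows "select_blocks m \<in> ops V V"
proof (rule opsI[where K=1])
  fix z assume z: "z \<in> carr V"
  obtain b where b: "b \<longlonglongrightarrow> 0" "\<And>n i. \<bar>z n i\<bar> \<le> b n" using V_block_bound[OF z] by blast
  have "(\<lambda>n. b (m n)) \<longlonglongrightarrow> 0" using LIMSEQ_subseq_LIMSEQ[OF b(1) m] by (simp add: o_def)
  then have "concat_blocks u (\<lambda>n. z (m n)) \<longlonglongrightarrow> 0"
    by (rule concat_blocks_tendsto[OF u_pos]) (rule b(2))
  moreover have "\<bar>concat_blocks u (\<lambda>n. z (m n)) k\<bar> \<le> nrm V z" for k
    by (rule concat_blocks_abs_le[OF u_pos]) (rule V_abs_le[OF z])
  ultimately show "select_blocks m z \<in> carr V" "nrm V (select_blocks m z) \<le> 1 * nrm V z"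
    using split_blocks_V[where v=v, OF v_pos] z by (auto simp: select_blocks_def)
  show "select_blocks m (c *\<^sub>R z) = c *\<^sub>R select_blocks m z" for c
  proof -
    have "(\<lambda>n. (c *\<^sub>R z) (m n)) = c *\<^sub>R (\<lambda>n. z (m n))" by (simp add: fun_eq_iff)
    then show ?thesis
      using z V.carr_scale[OF z, of c]
      by (simp only: select_blocks_def concat_blocks_scale split_blocks_scale if_True)
  qed
  fix y assume y: "y \<in> carr V"
  show "select_blocks m (z + y) = select_blocks m z + select_blocks m y"
  proof -
    have "(\<lambda>n. (z + y) (m n)) = (\<lambda>n. z (m n)) + (\<lambda>n. y (m n))" by (simp add: fun_eq_iff)
    then show ?thesis
      using z y V.carr_add[OF z y]
      by (simp only: select_blocks_def concat_blocks_add split_blocks_add if_True)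
  qed
qed (simp add: select_blocks_def)

lemma I_ops: "I \<in> ops U V"
proof (rule opsI[where K=1])
  fix x assume x: "x \<in> carr U"
  have le: "\<bar>x n i\<bar> \<le> nrm (l2_fin (u n)) (x n)" if "i < u n" for n i
  proof -
    have "(x n i)\<^sup>2 \<le> (nrm (l2_fin (u n)) (x n))\<^sup>2"
      unfolding l2_fin_sq using that by (intro member_le_sum) auto
    then show ?thesis using l2_fin_nonneg[of "u n" "x n"] by (simp add: abs_le_square_iff[symmetric])
  qed
  have "concat_blocks u x \<longlonglongrightarrow> 0"
    by (rule concat_blocks_tendsto[OF u_pos U_block_tendsto[OF p x] le])
  moreover have "\<bar>concat_blocks u x k\<bar> \<le> nrm U x" for k
    by (rule concat_blocks_abs_le[OF u_pos]) (rule order_trans[OF le U_block(2)[OF p x]])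
  ultimately show "I x \<in> carr V" "nrm V (I x) \<le> 1 * nrm U x"
    using split_blocks_V[where v=v, OF v_pos] x by (auto simp: formal_incl_def)
  show "I (c *\<^sub>R x) = c *\<^sub>R I x" for c
    using x U.carr_scale[OF x, of c] by (simp add: formal_incl_def concat_blocks_scale split_blocks_scale)
  fix y assume y: "y \<in> carr U"
  show "I (x + y) = I x + I y"
    using x y U.carr_add[OF x y] by (simp add: formal_incl_def concat_blocks_add split_blocks_add)
qed (simp add: formal_incl_def)

text \<open>\<open>B\<close> sends the i-th unit vector of block \<open>n\<close> to the dual vector
  \<open>h n i\<close> in block \<open>m n\<close>. Pairing with the first \<open>u n\<close>
  vectors of \<open>g (m n)\<close> recovers the coordinates of \<open>x\<close>, and
  \<open>select_blocks\<close> collects them.\<close>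

lemma I_factors:
  assumes N: "infinite N"
  shows "\<exists>A\<in>ops V V. \<exists>B\<in>ops U U. I = A \<circ> T N \<circ> B"
proof -
  \<comment> \<open>The shift by one in the enumeration gives the strict inequality
    \<open>n < m n\<close> on which \<open>u_le_s\<close> rests.\<close>
  define m where "m n = enumerate N (Suc n)" for n
  have m: "strict_mono m" unfolding m_def using strict_mono_enumerate[OF N] by (simp add: strict_mono_def)
  have mN: "m n \<in> N" for n unfolding m_def by (rule enumerate_in_set[OF N])
  have less: "n < m n" for n
    using le_enumerate[OF N, of "Suc n"] by (simp add: m_def)
  define dual where "dual n h \<longleftrightarrow> (\<forall>i. h i \<in> carr (l2_fin (u (m n)))) \<and>
     (\<forall>i j. i < u n \<longrightarrow> j < u n \<longrightarrow> inner_fin (u (m n)) (h i) (g (m n) j) = (if i = j then 1 else 0)) \<and>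
     (\<forall>a. nrm (l2_fin (u (m n))) (\<Sum>i<u n. a i *\<^sub>R h i) \<le> sqrt 2 * nrm (l2_fin (u n)) a)" for n h
  have "\<exists>h. dual n h" for n
  proof -
    have "u n < u (m n)" using less strict_mono_u by (simp add: strict_mono_less)
    then have uv: "u n < v (m n)" using interlaced[of "m n"] by simp
    then have "1/2 * (\<Sum>i<u n. \<bar>a i\<bar>\<^sup>2) \<le> (nrm (l2_fin (u (m n))) (\<Sum>i<u n. a i *\<^sub>R g (m n) i))\<^sup>2" for a
      using riesz[of "{..<u n}" "m n" a] u_le_s[OF less, of n] by (simp add: max_def)
    moreover have "g (m n) i \<in> carr (l2_fin (u (m n)))" if "i < u n" for i
      using unit[of i "m n"] that uv by simp
    ultimately obtain h where "\<And>i. h i \<in> carr (l2_fin (u (m n)))"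
      "\<And>i j. i < u n \<Longrightarrow> j < u n \<Longrightarrow> inner_fin (u (m n)) (h i) (g (m n) j) = (if i = j then 1 else 0)"
      "\<And>a. nrm (l2_fin (u (m n))) (\<Sum>i<u n. a i *\<^sub>R h i) \<le> sqrt 2 * nrm (l2_fin (u n)) a"
      by (rule biorthogonal_system[of "u n" "u (m n)" "g (m n)"]) auto
    then show ?thesis by (intro exI[of _ h]) (simp add: dual_def)
  qed
  then obtain h where "\<And>n. dual n (h n)" by metis
  then have h: "\<And>n i. h n i \<in> carr (l2_fin (u (m n)))"
     "\<And>n i j. i < u n \<Longrightarrow> j < u n \<Longrightarrow> inner_fin (u (m n)) (h n i) (g (m n) j) = (if i = j then 1 else 0)"
     "\<And>n a. nrm (l2_fin (u (m n))) (\<Sum>i<u n. a i *\<^sub>R h n i) \<le> sqrt 2 * nrm (l2_fin (u n)) a"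
    by (simp_all add: dual_def)
  have inj: "inj m" using m by (rule strict_mono_imp_inj_on)
  define B where "B x = (if x \<in> carr U then (\<lambda>k. if k \<in> range m then
      (\<Sum>i<u (inv m k). x (inv m k) i *\<^sub>R h (inv m k) i) else 0) else 0)" for x
  have Bm: "B x (m n) = (\<Sum>i<u n. x n i *\<^sub>R h n i)" if "x \<in> carr U" for x n
    using that inv_f_f[OF inj] by (simp add: B_def)
  have Bcarr: "B x \<in> carr U" and Bnrm: "nrm U (B x) \<le> sqrt 2 * nrm U x" if x: "x \<in> carr U" for x
  proof -
    have c: "B x (m n) \<in> carr (l2_fin (u (m n)))" for n
      unfolding Bm[OF x] using normed_carrier.carr_subspace[OF normed_carrier_l2_fin] h(1)
      by (intro subspace_sum subspace_scale)
    have z: "B x k = 0" if "k \<notin> range m" for k using that by (simp add: B_def)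
    have l: "nrm (l2_fin (u (m n))) (B x (m n)) \<le> sqrt 2 * nrm (l2_fin (u n)) (x n)" for n
      unfolding Bm[OF x] by (rule h(3))
    show "B x \<in> carr U" "nrm U (B x) \<le> sqrt 2 * nrm U x"
      using U_reindexed[OF p x m c z _ l] by simp_all
  qed
  have "B \<in> ops U U"
  proof (rule opsI[where K="sqrt 2"])
    fix x assume x: "x \<in> carr U"
    show "B (c *\<^sub>R x) = c *\<^sub>R B x" for c
      using x U.carr_scale[OF x, of c] by (auto simp: B_def fun_eq_iff sum_distrib_left mult.assoc)
    fix y assume y: "y \<in> carr U"
    show "B (x + y) = B x + B y"
      using x y U.carr_add[OF x y] by (auto simp: B_def fun_eq_iff sum.distrib distrib_right)
  qed (use Bcarr Bnrm in \<open>auto simp: B_def\<close>)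
  moreover have "I = select_blocks m \<circ> T N \<circ> B"
  proof
    fix x
    show "I x = (select_blocks m \<circ> T N \<circ> B) x"
    proof (cases "x \<in> carr U")
      case True
      have "T N (B x) (m n) i = x n i" if "i < u n" for n i
      proof -
        have "u n < u (m n)" using less strict_mono_u by (simp add: strict_mono_less)
        then have "i < v (m n)" using interlaced[of "m n"] that by simp
        then have "T N (B x) (m n) i = (\<Sum>j<u n. x n j * inner_fin (u (m n)) (h n j) (g (m n) i))"
          using mN by (simp add: T_apply[OF Bcarr[OF True]] Bm[OF True] inner_fin_sum del: sum_fun_apply)
        also have "\<dots> = (\<Sum>j<u n. if j = i then x n j else 0)"
          using h(2) that by (intro sum.cong) auto
        finally show ?thesis using that by simp
      qed
      then have "concat_blocks u (\<lambda>n. T N (B x) (m n)) = concat_blocks u x"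
        by (intro concat_blocks_cong[OF u_pos]) simp
      then show ?thesis
        using True ops_carr[OF T_ops Bcarr[OF True], of N]
        by (simp add: formal_incl_def select_blocks_def)
    next
      case False
      then have "B x = 0" by (simp add: B_def)
      then show ?thesis
        using False ops_zero[OF UV(1) T_ops] ops_zero[OF UV(2) select_blocks_ops[OF m]]
        by (simp add: formal_incl_def)
    qed
  qed
  ultimately show ?thesis using select_blocks_ops[OF m] by blast
qed

text \<open>\<open>I\<close> leaves the scalar sequence unchanged, so block \<open>n\<close> of
  \<open>x\<close> is found in \<open>I x\<close> after concatenation along \<open>v\<close>,
  starting at the sum of the earlier \<open>u m\<close>. A finite matrix with rows
  \<open>g n i\<close> then produces \<open>T {n}\<close>.\<close>

lemma T_single_factors: "\<exists>A\<in>ops V V. T {n} = A \<circ> I"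
proof -
  define A where "A z = (if z \<in> carr V then (\<lambda>k i. if k = n \<and> i < v n
    then \<Sum>r<u n. concat_blocks v z ((\<Sum>m<n. u m) + r) * g n i r else 0) else 0)" for z
  \<comment> \<open>The sum of the absolute values of all matrix entries: crude, but only
    boundedness is asked for.\<close>
  define K where "K = (\<Sum>i<v n. \<Sum>r<u n. \<bar>g n i r\<bar>)"
  have "A \<in> ops V V"
  proof (rule opsI[where K=K])
    fix z assume z: "z \<in> carr V"
    have K0: "0 \<le> K" by (simp add: K_def sum_nonneg)
    have le: "\<bar>A z k i\<bar> \<le> (if k = n then K * nrm V z else 0)" for k i
    proof (cases "k = n \<and> i < v n")
      case True
      have "\<bar>A z k i\<bar> \<le> (\<Sum>r<u n. \<bar>concat_blocks v z ((\<Sum>m<n. u m) + r) * g n i r\<bar>)"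
        using True z by (simp add: A_def sum_abs)
      also have "\<dots> \<le> (\<Sum>r<u n. nrm V z * \<bar>g n i r\<bar>)"
        unfolding abs_mult
        by (intro sum_mono mult_right_mono concat_blocks_abs_le[OF v_pos] V_abs_le[OF z]) simp
      also have "\<dots> = nrm V z * (\<Sum>r<u n. \<bar>g n i r\<bar>)" by (simp add: sum_distrib_left)
      also have "\<dots> \<le> nrm V z * K"
        unfolding K_def using True V.nrm_nonneg[OF z]
        by (intro mult_left_mono member_le_sum[of i _ "\<lambda>i. \<Sum>r<u n. \<bar>g n i r\<bar>"]) (auto intro: sum_nonneg)
      finally show ?thesis using True by (simp add: mult.commute)
    next
      case False
      then show ?thesis using z K0 V.nrm_nonneg[OF z] by (auto simp: A_def)
    qed
    show "A z \<in> carr V"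
    proof (rule V_carrI)
      show "(\<lambda>k. if k = n then K * nrm V z else 0) \<longlonglongrightarrow> 0"
        by (rule tendsto_eventually[OF eventually_mono[OF eventually_gt_at_top[of n]]]) simp
    qed (use z le in \<open>auto simp: A_def\<close>)
    show "nrm V (A z) \<le> K * nrm V z"
      using le K0 V.nrm_nonneg[OF z] by (intro V_nrm_le) (auto intro: order_trans[OF le])
    show "A (c *\<^sub>R z) = c *\<^sub>R A z" for c
      using z V.carr_scale[OF z, of c]
      by (auto simp: A_def fun_eq_iff concat_blocks_scale sum_distrib_left mult.assoc)
    fix y assume y: "y \<in> carr V"
    show "A (z + y) = A z + A y"
      using z y V.carr_add[OF z y]
      by (auto simp: A_def fun_eq_iff concat_blocks_add sum.distrib distrib_right)
  qed (simp add: A_def)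
  moreover have "T {n} = A \<circ> I"
  proof
    fix x
    show "T {n} x = (A \<circ> I) x"
    proof (cases "x \<in> carr U")
      case True
      then have "concat_blocks v (I x) = concat_blocks u x"
        by (simp add: formal_incl_def concat_split_blocks[OF v_pos])
      then show ?thesis
        using True ops_carr[OF I_ops True] concat_blocks_apply[of _ u n x]
        by (auto simp: A_def fun_eq_iff T_apply inner_fin_def)
    next
      case False
      then show ?thesis
        using ops_outside[OF I_ops False] ops_outside[OF T_ops False] ops_zero[OF UV(2) calculation] by simp
    qed
  qed
  ultimately show ?thesis by blast
qed

section \<open>The ideals generated by \<open>I\<close> and by the \<open>T M\<close>\<close>

abbreviation "JI \<equiv> ideal_gen U V I U V"
abbreviation "JT M \<equiv> ideal_gen U V (T M) U V"

lemma JI_closed_ideal: "JI \<in> closed_ideals U V"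
  and JT_closed_ideal: "JT M \<in> closed_ideals U V"
  using ideal_gen_closed_ideal[OF UV(1) UV(1) UV(2) UV(2)] I_ops T_ops by auto

lemma JI_subset_JT: "infinite N \<Longrightarrow> JI \<subseteq> JT N"
  using I_factors[of N] comp_in_ideal_gen[OF UV T_ops]
  by (intro ideal_gen_least[OF JT_closed_ideal]) auto

lemma T_single_in_JI: "T {n} \<in> JI"
proof -
  obtain A where A: "A \<in> ops V V" "T {n} = A \<circ> I" using T_single_factors by blast
  have "A \<circ> I \<circ> carr_id U = A \<circ> I" using comp_carr_id[OF UV(1) I_ops] by (simp add: comp_assoc)
  then show ?thesis using comp_in_ideal_gen[OF UV I_ops A(1) carr_id_ops[OF UV(1)]] A(2) by simp
qed

lemma T_finite_in_JI: "finite F \<Longrightarrow> T F \<in> JI"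
proof (induction F rule: finite_induct)
  case empty
  have "T {} = 0" by (auto simp: T_op_def fun_eq_iff)
  then show ?case using subspace_0[OF closed_ideal_subspace[OF JI_closed_ideal]] by (simp only:)
next
  case (insert n F)
  then have "T (insert n F) = T {n} + T F" using T_Un[of "{n}" F] by simp
  then show ?case
    using subspace_add[OF closed_ideal_subspace[OF JI_closed_ideal] T_single_in_JI insert.IH] by (simp only:)
qed

lemma T_subset_in_JT: "M \<subseteq> N \<Longrightarrow> T M \<in> JT N"
  using comp_in_ideal_gen[OF UV T_ops carr_id_ops[OF UV(2)] restrict_blocks_ops, of N M]
    T_restrict_blocks[of M N] carr_id_comp[OF UV(2) T_ops] by simp

text \<open>\<open>T M\<close> is the sum of its part on \<open>M \<inter> N\<close>, which factors
  through \<open>T N\<close>, and a finite part, which lies in \<open>JI\<close>; infinity of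
  \<open>N\<close> places \<open>JI\<close> inside \<open>JT N\<close>.\<close>

lemma JT_mono:
  assumes N: "infinite N" and MN: "finite (M - N)"
  shows "JT M \<subseteq> JT N"
proof (rule ideal_gen_least[OF JT_closed_ideal])
  have "T (M \<inter> N) \<in> JT N" by (rule T_subset_in_JT) blast
  moreover have "T (M - N) \<in> JT N" using JI_subset_JT[OF N] T_finite_in_JI[OF MN] by blast
  moreover have "T M = T (M \<inter> N) + T (M - N)"
    using T_Un[of "M \<inter> N" "M - N"] by (simp add: Int_Diff_Un Int_Diff_disjoint)
  ultimately show "T M \<in> JT N"
    using subspace_add[OF closed_ideal_subspace[OF JT_closed_ideal]] by simp
qed

text \<open>\<open>T\<close> is additive on disjoint sets, hence the decomposition of the union into
  \<open>M\<close> and \<open>N - M\<close>.\<close>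

lemma JT_join: "ideal_join U V (JT M) (JT N) = JT (M \<union> N)"
proof (rule antisym)
  show "ideal_join U V (JT M) (JT N) \<subseteq> JT (M \<union> N)"
    by (intro ideal_join_least ideal_gen_least JT_closed_ideal T_subset_in_JT) auto
  have "T (M \<union> N) = T M + T (N - M)" using T_Un[of M "N - M"] by (simp add: Un_Diff_cancel)
  moreover have "T M \<in> JT M" "T (N - M) \<in> JT N" by (auto intro: T_subset_in_JT)
  ultimately have "T (M \<union> N) \<in> ideal_join U V (JT M) (JT N)"
    using add_in_ideal_join[OF UV JT_closed_ideal JT_closed_ideal] by simp
  then show "JT (M \<union> N) \<subseteq> ideal_join U V (JT M) (JT N)"
    by (intro ideal_gen_least ideal_join_closed_ideal[OF UV] JT_closed_ideal)
qed

end

section \<open>Separating the ideals\<close>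

lemma ops_sum:
  assumes X: "normed_carrier X" and T: "T \<in> ops X Y" and y: "\<And>r. r \<in> D \<Longrightarrow> y r \<in> carr X"
  shows "T (\<Sum>r\<in>D. c r *\<^sub>R y r) = (\<Sum>r\<in>D. c r *\<^sub>R T (y r))"
  using y
proof (induction D rule: infinite_finite_induct)
  case (insert r D)
  then have "c r *\<^sub>R y r \<in> carr X" "(\<Sum>r\<in>D. c r *\<^sub>R y r) \<in> carr X"
    using normed_carrier.carr_subspace[OF X] by (auto intro: subspace_scale subspace_sum)
  then have "T (c r *\<^sub>R y r + (\<Sum>r\<in>D. c r *\<^sub>R y r)) = c r *\<^sub>R T (y r) + T (\<Sum>r\<in>D. c r *\<^sub>R y r)"
    using ops_add[OF T] ops_scale[OF T] insert.prems by simp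
  then show ?case using insert by simp
qed (simp_all add: ops_zero[OF X T])

lemma (in normed_carrier) nrm_sum_le:
  assumes "\<And>i. i \<in> D \<Longrightarrow> y i \<in> carr X"
  shows "nrm X (\<Sum>i\<in>D. y i) \<le> (\<Sum>i\<in>D. nrm X (y i))"
  using assms
proof (induction D rule: infinite_finite_induct)
  case (insert i D)
  then have "(\<Sum>i\<in>D. y i) \<in> carr X" using carr_subspace by (auto intro: subspace_sum)
  then show ?case using nrm_triangle[of "y i" "\<Sum>i\<in>D. y i"] insert by fastforce
qed (simp_all add: nrm_zero)

text \<open>Jensen's inequality for the mean of the \<open>b r\<close>. With exponent p/2 and u_n
  summands it accounts for the power of u_n in \<open>s\<close> when p >= 2.\<close>

lemma sum_powr_le:
  fixes b :: "nat \<Rightarrow> real"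
  assumes q: "1 \<le> q" and b: "\<And>r. 0 \<le> b r" and n: "0 < n"
  shows "(\<Sum>r<n. b r) powr q \<le> real n powr (q - 1) * (\<Sum>r<n. b r powr q)"
proof -
  have "(\<Sum>r<n. (1 / real n) *\<^sub>R b r) powr q \<le> (\<Sum>r<n. (1 / real n) * b r powr q)"
    using n b by (intro convex_on_sum[OF _ _ convex_on_powr_nonneg[OF q]]) auto
  then have "((1 / real n) * (\<Sum>r<n. b r)) powr q \<le> (1 / real n) * (\<Sum>r<n. b r powr q)"
    by (simp add: sum_distrib_left)
  then have "(1 / real n) powr q * (\<Sum>r<n. b r) powr q \<le> (1 / real n) * (\<Sum>r<n. b r powr q)"
    using powr_mult[of "1 / real n" "\<Sum>r<n. b r" q] b by (simp only: sum_nonneg)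
  then have "real n powr q * ((1 / real n) powr q * (\<Sum>r<n. b r) powr q)
      \<le> real n powr q * ((1 / real n) * (\<Sum>r<n. b r powr q))"
    by (intro mult_left_mono) auto
  moreover have "real n powr q * (1 / real n) powr q = 1"
    using n by (simp add: powr_mult[symmetric])
  moreover have "real n powr q * (1 / real n) = real n powr (q - 1)"
    using n by (simp add: powr_diff)
  ultimately show ?thesis by (simp only: mult.assoc[symmetric] mult_1_left)
qed

definition single_block :: "nat \<Rightarrow> (nat \<Rightarrow> real) \<Rightarrow> nat \<Rightarrow> nat \<Rightarrow> real" where
  "single_block n x = (\<lambda>m. if m = n then x else 0)"

definition unit_vec :: "nat \<Rightarrow> nat \<Rightarrow> real" where
  "unit_vec r = (\<lambda>i. if i = r then 1 else 0)"

section \<open>Counting the large coordinates of a contraction on one block\<close>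

context block_setting
begin

lemma single_block:
  assumes "x \<in> carr (l2_fin (u n))"
  shows "single_block n x \<in> carr U" "nrm U (single_block n x) = nrm (l2_fin (u n)) x"
  unfolding single_block_def using U_single[where u=u and n=n, OF p assms] by auto

lemma unit_vec:
  assumes "r < u n"
  shows "unit_vec r \<in> carr (l2_fin (u n))" "nrm (l2_fin (u n)) (unit_vec r) = 1"
proof -
  show "unit_vec r \<in> carr (l2_fin (u n))" using assms by (auto simp: unit_vec_def l2_fin_def)
  have "(\<Sum>i<u n. (unit_vec r i)\<^sup>2) = (\<Sum>i<u n. if i = r then 1 else 0)"
    by (rule sum.cong) (auto simp: unit_vec_def)
  then show "nrm (l2_fin (u n)) (unit_vec r) = 1"
    using assms by (simp add: l2_fin_def L2_set_def)
qed

text \<open>Coordinate (m, l) of \<open>T N (B y)\<close>, where \<open>y\<close> is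
  \<open>x\<close> placed in block \<open>n\<close> and \<open>m\<close> lies in \<open>N\<close>.
  The set \<open>N\<close> is left out, so that one count serves all sets.\<close>

definition coord :: "((nat \<Rightarrow> nat \<Rightarrow> real) \<Rightarrow> nat \<Rightarrow> nat \<Rightarrow> real) \<Rightarrow> nat \<Rightarrow> (nat \<Rightarrow> real) \<Rightarrow> nat \<Rightarrow> nat \<Rightarrow> real" where
  "coord B n x m l = inner_fin (u m) (B (single_block n x) m) (g m l)"

text \<open>The vector of block \<open>n\<close> representing the functional
  \<open>coord B n _ m l\<close>; its length decides whether coordinate (m, l) can be large
  there.\<close>

definition coord_vec :: "((nat \<Rightarrow> nat \<Rightarrow> real) \<Rightarrow> nat \<Rightarrow> nat \<Rightarrow> real) \<Rightarrow> nat \<Rightarrow> nat \<Rightarrow> nat \<Rightarrow> nat \<Rightarrow> real" where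
  "coord_vec B n m l = (\<lambda>r. if r < u n then coord B n (unit_vec r) m l else 0)"

lemma coord_vec_carr: "coord_vec B n m l \<in> carr (l2_fin (u n))"
  by (simp add: coord_vec_def l2_fin_def)

lemma coord_eq_inner:
  assumes B: "B \<in> ops U U" and x: "x \<in> carr (l2_fin (u n))"
  shows "coord B n x m l = inner_fin (u n) x (coord_vec B n m l)"
proof -
  have "single_block n x m i = (\<Sum>r<u n. x r *\<^sub>R single_block n (unit_vec r)) m i" for m i
  proof -
    have "x i = (\<Sum>r<u n. if i = r then x r else 0)"
      using x by (auto simp: l2_fin_def)
    also have "\<dots> = (\<Sum>r<u n. x r * unit_vec r i)"
      by (rule sum.cong) (auto simp: unit_vec_def)
    finally show ?thesis unfolding single_block_def by (cases "m = n") simp_all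
  qed
  then have "single_block n x = (\<Sum>r<u n. x r *\<^sub>R single_block n (unit_vec r))" by blast
  then have "B (single_block n x) = (\<Sum>r<u n. x r *\<^sub>R B (single_block n (unit_vec r)))"
    using ops_sum[OF UV(1) B, of "{..<u n}" "\<lambda>r. single_block n (unit_vec r)" x] single_block(1) unit_vec(1)
    by auto
  then have "B (single_block n x) m = (\<Sum>r<u n. x r *\<^sub>R B (single_block n (unit_vec r)) m)"
    by simp
  then have "coord B n x m l = (\<Sum>r<u n. x r * coord B n (unit_vec r) m l)"
    unfolding coord_def by (simp only: inner_fin_sum)
  then show ?thesis by (simp add: inner_fin_def coord_vec_def)
qed

lemma coord_abs_le:
  assumes B: "B \<in> ops U U" and contr: "\<And>x. x \<in> carr U \<Longrightarrow> nrm U (B x) \<le> nrm U x"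
    and x: "x \<in> carr (l2_fin (u n))" and l: "l < v m"
  shows "\<bar>coord B n x m l\<bar> \<le> nrm (l2_fin (u n)) x"
proof -
  have Bx: "B (single_block n x) \<in> carr U" using ops_carr[OF B single_block(1)[OF x]] .
  have "\<bar>coord B n x m l\<bar> \<le> nrm (l2_fin (u m)) (B (single_block n x) m)"
    unfolding coord_def by (rule inner_g_le[OF l])
  also have "\<dots> \<le> nrm U (B (single_block n x))" by (rule U_block(2)[OF p Bx])
  also have "\<dots> \<le> nrm (l2_fin (u n)) x"
    using contr[OF single_block(1)[OF x]] single_block(2)[OF x] by simp
  finally show ?thesis .
qed

text \<open>The representing vector is tested on itself: its squared length is a value of a
  functional of norm at most 1, hence at most its length.\<close>

lemma coord_vec_nrm_le:
  assumes B: "B \<in> ops U U" and contr: "\<And>x. x \<in> carr U \<Longrightarrow> nrm U (B x) \<le> nrm U x" and l: "l < v m"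
  shows "nrm (l2_fin (u n)) (coord_vec B n m l) \<le> 1"
proof -
  let ?h = "coord_vec B n m l"
  have "(nrm (l2_fin (u n)) ?h)\<^sup>2 = coord B n ?h m l"
    unfolding coord_eq_inner[OF B coord_vec_carr] inner_fin_self ..
  also have "\<dots> \<le> nrm (l2_fin (u n)) ?h"
    by (rule order_trans[OF abs_ge_self coord_abs_le[OF B contr coord_vec_carr l]])
  finally have "\<not> 1 < nrm (l2_fin (u n)) ?h"
    using power_strict_increasing[of 1 2 "nrm (l2_fin (u n)) ?h"] by auto
  then show ?thesis by simp
qed

lemma card_large_inner_le:
  assumes h: "h \<in> carr (l2_fin (u n))" "nrm (l2_fin (u n)) h \<le> 1"
  shows "card {j. j < v n \<and> 1 / real (n + 1) \<le> \<bar>inner_fin (u n) h (g n j)\<bar>} \<le> 2 * (n + 1)\<^sup>2" (is "card ?A \<le> _")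
proof (rule ccontr)
  assume "\<not> ?thesis"
  then have "2 * (n + 1)\<^sup>2 + 1 \<le> card ?A" by simp
  \<comment> \<open>One index beyond the claimed bound suffices for the contradiction, and with N =
    n + 1 these 2 N^2 + 1 indices are within the admissible 19 N^2.\<close>
  then obtain J where J: "J \<subseteq> ?A" "card J = 2 * (n + 1)\<^sup>2 + 1" by (rule obtain_subset_with_card_n) 
  have "real (card J) \<le> 19 * real (n + 1)^2"
  proof -
    have "1 \<le> (n + 1)\<^sup>2" by simp
    then have "card J \<le> 19 * (n + 1)\<^sup>2" using J(2) by linarith
    then have "real (card J) \<le> real (19 * (n + 1)\<^sup>2)" by (rule of_nat_mono)
    then show ?thesis by simp
  qed
  then have "(\<Sum>i\<in>J. \<bar>inner_fin (u n) h (g n i)\<bar>\<^sup>2) \<le> 2 * (nrm (l2_fin (u n)) h)\<^sup>2"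
    using J(1) h(1) by (intro bessel) auto
  also have "\<dots> \<le> 2 * 1" using h(2) l2_fin_nonneg by (intro mult_left_mono power_le_one) auto
  finally have "(\<Sum>i\<in>J. \<bar>inner_fin (u n) h (g n i)\<bar>\<^sup>2) \<le> 2" by simp
  moreover have "real (card J) * (1 / real (n + 1))\<^sup>2 \<le> (\<Sum>i\<in>J. \<bar>inner_fin (u n) h (g n i)\<bar>\<^sup>2)"
    using J(1) by (intro sum_bounded_below power_mono) auto
  ultimately have "real (card J) * (1 / real (n + 1))\<^sup>2 \<le> 2" by linarith
  then have "real (card J) \<le> 2 * (real (n + 1))\<^sup>2"
    by (simp add: power_one_over field_simps)
  then show False unfolding J(2) by simp
qed

text \<open>Each element of \<open>L\<close> contributes at least 1/(n+1)^2 to a sum of squared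
  lengths. Expanding the lengths in unit vectors and applying Bessel in each later block
  \<open>m\<close> bounds the number \<open>c m\<close> of elements from that block by the squares
  of the norms \<open>b r m\<close>, whose p-th powers sum to at most 1 over \<open>m\<close>. The
  assumed bound on \<open>card L\<close> makes the index sets admissible.\<close>

lemma card_large_coord_vec_aux:
  assumes B: "B \<in> ops U U" and contr: "\<And>x. x \<in> carr U \<Longrightarrow> nrm U (B x) \<le> nrm U x"
    and L: "finite L" "L \<subseteq> {(m, l). n < m \<and> l < v m \<and> 1 / real (n + 1) \<le> nrm (l2_fin (u n)) (coord_vec B n m l)}"
    and card: "real (card L) \<le> s (Suc n) + 1"
  shows "real (card L) \<le> s (Suc n)"
proof -
  define N where "N = real (n + 1)"
  have N: "0 < N" by (simp add: N_def)
  define D where "D = fst ` L"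
  define c where "c m = card (L `` {m})" for m
  define b where "b r m = nrm (l2_fin (u m)) (B (single_block n (unit_vec r)) m)" for r m
  have b0: "0 \<le> b r m" for r m by (simp add: b_def l2_fin_nonneg)
  have D: "finite D" using L(1) by (simp add: D_def)
  have fib: "finite (L `` {m})" for m using L(1) by (rule finite_Image)
  have "L = (SIGMA m:D. L `` {m})" by (force simp: D_def)
  then have cardL: "card L = (\<Sum>m\<in>D. c m)" using card_SigmaI[OF D, of "\<lambda>m. L `` {m}"] fib by (simp add: c_def)
  have unitU: "B (single_block n (unit_vec r)) \<in> carr U" "nrm U (B (single_block n (unit_vec r))) \<le> 1"
    if "r < u n" for r
    using single_block[OF unit_vec(1)[OF that]] unit_vec(2)[OF that] ops_carr[OF B]
      contr[OF single_block(1)[OF unit_vec(1)[OF that]]] by auto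
  have bp: "(\<Sum>m\<in>D. b r m powr p) \<le> 1" if "r < u n" for r
  proof -
    have "(\<Sum>m\<in>D. b r m powr p) \<le> nrm U (B (single_block n (unit_vec r))) powr p"
      unfolding b_def by (rule U_finite_sum[OF p unitU(1)[OF that] D])
    also have "\<dots> \<le> 1" using unitU[OF that] U.nrm_nonneg p by (intro powr_le1) auto
    finally show ?thesis .
  qed
  have b1: "b r m \<le> 1" if "r < u n" for r m
    using U_block(2)[OF p unitU(1)[OF that], of m] unitU(2)[OF that] unfolding b_def by linarith
  have cb: "real (c m) \<le> 2 * N\<^sup>2 * (\<Sum>r<u n. (b r m)\<^sup>2)" if m: "m \<in> D" for m
  proof -
    have sub: "L `` {m} \<subseteq> {..<v m}" and nm: "n < m" using L(2) m by (auto simp: D_def)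
    obtain k where k: "m = Suc k" "n \<le> k" using nm by (cases m) auto
    have "card (L `` {m}) \<le> card L"
      using card_mono[OF L(1), of "{m} \<times> (L `` {m})"] by (auto simp: card_cartesian_product_singleton)
    \<comment> \<open>Bessel in block \<open>m\<close> admits \<open>s m + 1\<close> indices, and
      \<open>s m\<close> is at least \<open>s (Suc n)\<close> because \<open>m\<close> is later than
      \<open>n\<close>.\<close>
    then have "real (card (L `` {m})) \<le> s m + 1" using card s_mono[OF k(2)] k(1) by simp
    then have bes: "(\<Sum>l\<in>L `` {m}. \<bar>coord B n (unit_vec r) m l\<bar>\<^sup>2) \<le> 2 * (b r m)\<^sup>2" if "r < u n" for r
      unfolding coord_def b_def using sub U_block(1)[OF p unitU(1)[OF that]] by (intro bessel) auto
    have "real (c m) * (1 / N)\<^sup>2 \<le> (\<Sum>l\<in>L `` {m}. (nrm (l2_fin (u n)) (coord_vec B n m l))\<^sup>2)"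
      unfolding c_def using L(2) N by (intro sum_bounded_below power_mono) (auto simp: N_def)
    also have "\<dots> = (\<Sum>l\<in>L `` {m}. \<Sum>r<u n. \<bar>coord B n (unit_vec r) m l\<bar>\<^sup>2)"
      by (simp add: l2_fin_sq coord_vec_def)
    also have "\<dots> = (\<Sum>r<u n. \<Sum>l\<in>L `` {m}. \<bar>coord B n (unit_vec r) m l\<bar>\<^sup>2)" by (rule sum.swap)
    also have "\<dots> \<le> (\<Sum>r<u n. 2 * (b r m)\<^sup>2)" using bes by (intro sum_mono) auto
    finally have "real (c m) * (1 / N)\<^sup>2 \<le> 2 * (\<Sum>r<u n. (b r m)\<^sup>2)" by (simp add: sum_distrib_left)
    then show ?thesis using N by (simp add: power_one_over field_simps)
  qed
  show ?thesis
  proof (cases "2 \<le> p")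
    case False
    \<comment> \<open>For p < 2 squares are dominated by p-th powers, the block norms being at most
      1.\<close>
    have "(b r m)\<^sup>2 \<le> b r m powr p" if "r < u n" for r m
    proof (cases "b r m = 0")
      case False
      then have "b r m powr 2 \<le> b r m powr p"
        using b0[of r m] b1[OF that, of m] \<open>\<not> 2 \<le> p\<close> by (intro powr_mono') auto
      then show ?thesis using b0[of r m] False by (simp add: powr_numeral)
    qed simp
    then have "(\<Sum>m\<in>D. \<Sum>r<u n. (b r m)\<^sup>2) \<le> (\<Sum>m\<in>D. \<Sum>r<u n. b r m powr p)"
      by (intro sum_mono) auto
    also have "\<dots> = (\<Sum>r<u n. \<Sum>m\<in>D. b r m powr p)" by (rule sum.swap)
    also have "\<dots> \<le> (\<Sum>r<u n. 1)" using bp by (intro sum_mono) auto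
    finally have *: "(\<Sum>m\<in>D. \<Sum>r<u n. (b r m)\<^sup>2) \<le> real (u n)" by simp
    have "real (card L) \<le> (\<Sum>m\<in>D. 2 * N\<^sup>2 * (\<Sum>r<u n. (b r m)\<^sup>2))"
      using cb by (simp add: cardL sum_mono)
    also have "\<dots> \<le> 2 * N\<^sup>2 * real (u n)"
      unfolding sum_distrib_left[symmetric] using * by (intro mult_left_mono) auto
    finally show ?thesis using False by (simp add: N_def algebra_simps)
  next
    case True
    define w where "w = real (u n)"
    have w: "0 < w" using u_pos by (simp add: w_def)
    have "real (c m) \<le> (2 * N\<^sup>2) powr (p/2) * (w powr (p/2 - 1) * (\<Sum>r<u n. b r m powr p))"
      if m: "m \<in> D" for m
    proof -
      have "L `` {m} \<noteq> {}" using m by (auto simp: D_def)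
      then have "c m \<noteq> 0" using fib[of m] by (simp add: c_def)
      \<comment> \<open>For p >= 2 the count is raised to the power p/2 before summing over
        \<open>m\<close>, which only enlarges it since a block meeting \<open>L\<close> has
        \<open>c m\<close> at least 1. Jensen's inequality then turns squares into p-th
        powers.\<close>
      then have "real (c m) powr 1 \<le> real (c m) powr (p/2)" using True by (intro powr_mono) auto
      also have "\<dots> \<le> (2 * N\<^sup>2 * (\<Sum>r<u n. (b r m)\<^sup>2)) powr (p/2)"
        using True cb[OF m] by (intro powr_mono2) auto
      also have "\<dots> = (2 * N\<^sup>2) powr (p/2) * (\<Sum>r<u n. (b r m)\<^sup>2) powr (p/2)"
        by (rule powr_mult)
      also have "\<dots> \<le> (2 * N\<^sup>2) powr (p/2) * (w powr (p/2 - 1) * (\<Sum>r<u n. ((b r m)\<^sup>2) powr (p/2)))"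
        unfolding w_def using True u_pos by (intro mult_left_mono sum_powr_le) auto
      also have "(\<Sum>r<u n. ((b r m)\<^sup>2) powr (p/2)) = (\<Sum>r<u n. b r m powr p)"
      proof (rule sum.cong)
        fix r
        have "(b r m)\<^sup>2 = b r m powr 2" using b0[of r m] by (cases "b r m = 0") (auto simp: powr_numeral)
        then show "((b r m)\<^sup>2) powr (p/2) = b r m powr p" by (simp add: powr_powr)
      qed simp
      finally show ?thesis by simp
    qed
    then have "real (card L) \<le> (\<Sum>m\<in>D. (2 * N\<^sup>2) powr (p/2) * (w powr (p/2 - 1) * (\<Sum>r<u n. b r m powr p)))"
      by (simp add: cardL sum_mono)
    also have "\<dots> = (2 * N\<^sup>2) powr (p/2) * (w powr (p/2 - 1) * (\<Sum>m\<in>D. \<Sum>r<u n. b r m powr p))"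
      by (simp add: sum_distrib_left)
    also have "(\<Sum>m\<in>D. \<Sum>r<u n. b r m powr p) = (\<Sum>r<u n. \<Sum>m\<in>D. b r m powr p)" by (rule sum.swap)
    also have "(2 * N\<^sup>2) powr (p/2) * (w powr (p/2 - 1) * (\<Sum>r<u n. \<Sum>m\<in>D. b r m powr p))
        \<le> (2 * N\<^sup>2) powr (p/2) * (w powr (p/2 - 1) * (\<Sum>r<u n. 1))"
      using bp by (intro mult_left_mono sum_mono) auto
    \<comment> \<open>The sum over the u_n unit vectors supplies the factor \<open>w\<close> that
      raises the exponent p/2 - 1 to p/2.\<close>
    also have "\<dots> = (2 * N\<^sup>2) powr (p/2) * w powr (p/2)"
      using w by (simp add: w_def[symmetric] powr_diff)
    also have "\<dots> = (2 * w) powr (p/2) * (N\<^sup>2) powr (p/2)"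
      by (simp add: powr_mult)
    also have "N\<^sup>2 = N powr 2" using N by (simp add: powr_numeral)
    also have "(2 * w) powr (p/2) * (N powr 2) powr (p/2) = s (Suc n)"
      unfolding powr_powr using True by (simp add: w_def N_def add.commute)
    finally show ?thesis .
  qed
qed

text \<open>The auxiliary bound covers only sets of size at most \<open>s (Suc n) + 1\<close>. A
  finite subset that is too large contains one whose size is the floor of \<open>s (Suc n)\<close>
  plus 1: still admissible, yet contradicting that bound. Bounding all finite subsets also proves
  finiteness.\<close>

lemma card_large_coord_vec:
  fixes n :: nat
  assumes B: "B \<in> ops U U" and contr: "\<And>x. x \<in> carr U \<Longrightarrow> nrm U (B x) \<le> nrm U x"
  defines "L \<equiv> {(m, l). n < m \<and> l < v m \<and> 1 / real (n + 1) \<le> nrm (l2_fin (u n)) (coord_vec B n m l)}"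
  shows "finite L" "real (card L) \<le> s (Suc n)"
proof -
  have s0: "0 \<le> s (Suc n)" using s_ge[of n] by (smt (verit) of_nat_0_le_iff mult_nonneg_nonneg zero_le_power2)
  have fin: "card F \<le> nat \<lfloor>s (Suc n)\<rfloor>" if F: "F \<subseteq> L" "finite F" for F
  proof (rule ccontr)
    assume "\<not> ?thesis"
    then have "Suc (nat \<lfloor>s (Suc n)\<rfloor>) \<le> card F" by simp
    then obtain F' where F': "F' \<subseteq> F" "card F' = Suc (nat \<lfloor>s (Suc n)\<rfloor>)"
      by (rule obtain_subset_with_card_n)
    have "real (card F') \<le> s (Suc n)"
    proof (rule card_large_coord_vec_aux[OF B contr])
      show "finite F'" using F F' finite_subset by blast
      show "F' \<subseteq> {(m, l). n < m \<and> l < v m \<and> 1 / real (n + 1) \<le> nrm (l2_fin (u n)) (coord_vec B n m l)}"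
        using F(1) F'(1) by (simp add: L_def)
      have "real (nat \<lfloor>s (Suc n)\<rfloor>) \<le> s (Suc n)" using s0 by simp
      then show "real (card F') \<le> s (Suc n) + 1" using F'(2) by simp
    qed
    then show False using F'(2) s0 by linarith
  qed
  then show "finite L"
    using finite_if_finite_subsets_card_bdd[of L "nat \<lfloor>s (Suc n)\<rfloor>"] by blast
  from fin[OF order_refl this] show "real (card L) \<le> s (Suc n)" using s0 by linarith
qed

text \<open>A union bound over triples (i, m, l): each vector indexed by \<open>H\<close> spoils few
  indices \<open>j\<close>, and all of them together spoil fewer than \<open>v n\<close>. One
  \<open>j\<close> is therefore good for all maps and all other blocks simultaneously.\<close>

lemma good_coordinate:
  assumes k: "k \<le> n" and B: "\<And>i. i < k \<Longrightarrow> B i \<in> ops U U"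
    and contr: "\<And>i x. i < k \<Longrightarrow> x \<in> carr U \<Longrightarrow> nrm U (B i x) \<le> nrm U x"
  shows "\<exists>j<v n. \<forall>i<k. \<forall>m l. m \<noteq> n \<longrightarrow> l < v m \<longrightarrow> \<bar>coord (B i) n (g n j) m l\<bar> \<le> 1 / real (n + 1)"
proof -
  define N where "N = real (n + 1)"
  define S where "S = s (Suc n)"
  \<comment> \<open>Earlier blocks have few coordinates altogether, because
    \<open>v m < u n\<close>; only later blocks need the restriction to long representing
    vectors.\<close>
  define low where "low = (SIGMA m:{..<n}. {..<v m})"
  define L where "L i = {(m, l). n < m \<and> l < v m \<and> 1 / N \<le> nrm (l2_fin (u n)) (coord_vec (B i) n m l)}" for i
  define H where "H = (SIGMA i:{..<k}. low \<union> L i)"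
  define bad where "bad = (\<lambda>(i, m, l). {j. j < v n \<and> 1 / N \<le> \<bar>inner_fin (u n) (coord_vec (B i) n m l) (g n j)\<bar>})"
  have L: "finite (L i)" "real (card (L i)) \<le> S" if "i < k" for i
    using card_large_coord_vec[OF B contr, OF that that, of n] by (auto simp: L_def N_def S_def)
  have S: "2 * real (u n) * N\<^sup>2 \<le> S" using s_ge[of n] by (simp add: S_def N_def add.commute)
  have N1: "1 \<le> N" "real n \<le> N" "real k \<le> N" using k by (auto simp: N_def)
  have S0: "0 < S"
  proof -
    have "0 < 2 * real (u n) * N\<^sup>2" using u_pos[of n] N1(1) by simp
    then show ?thesis using S by linarith
  qed
  have nu: "real n * real (u n) \<le> S / 2"
  proof -
    have "real n * real (u n) \<le> N\<^sup>2 * real (u n)"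
      using N1(1,2) by (intro mult_right_mono) (auto simp: power2_eq_square intro: order_trans[OF _ mult_left_mono[of 1 N N]])
    then show ?thesis using S by (simp add: mult_ac)
  qed
  have fin_low: "finite low" by (simp add: low_def)
  have "card low = (\<Sum>m<n. v m)" by (simp add: low_def)
  also have "\<dots> \<le> (\<Sum>m<n. u n)" using v_less_u by (intro sum_mono) (auto intro: less_imp_le)
  finally have "card low \<le> n * u n" by simp
  then have "real (card low) \<le> real (n * u n)" by (rule of_nat_mono)
  then have low: "real (card low) \<le> S / 2" using nu by simp
  have fin_H: "finite H" using L(1) fin_low by (auto simp: H_def)
  have "real (card H) = (\<Sum>i<k. real (card (low \<union> L i)))"
    unfolding H_def using L(1) fin_low by (subst card_SigmaI) auto
  also have "\<dots> \<le> (\<Sum>i<k. 3 / 2 * S)"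
  proof (rule sum_mono)
    fix i assume "i \<in> {..<k}"
    then show "real (card (low \<union> L i)) \<le> 3 / 2 * S"
      using card_Un_le[of low "L i"] low L(2)[of i] by simp
  qed
  also have "\<dots> = real k * (3 / 2 * S)" by simp
  also have "\<dots> \<le> N * (3 / 2 * S)" using N1(3) S0 by (intro mult_right_mono) auto
  finally have cardH: "real (card H) \<le> N * (3 / 2 * S)" .
  have lv: "l < v m" if "(i, m, l) \<in> H" for i m l using that by (auto simp: H_def low_def L_def)
  have "card (bad t) \<le> 2 * (n + 1)\<^sup>2" if t: "t \<in> H" for t
  proof -
    obtain i m l where t': "t = (i, m, l)" by (cases t)
    have i: "i < k" using t t' by (simp add: H_def)
    have "nrm (l2_fin (u n)) (coord_vec (B i) n m l) \<le> 1"
      using t t' by (intro coord_vec_nrm_le[OF B[OF i] contr[OF i] lv]) auto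
    from card_large_inner_le[OF coord_vec_carr this] show ?thesis
      by (simp add: bad_def t' N_def)
  qed
  then have "card (\<Union>t\<in>H. bad t) \<le> card H * (2 * (n + 1)\<^sup>2)"
    using card_UN_le[OF fin_H, of bad] sum_bounded_above[of H "\<lambda>t. card (bad t)" "2 * (n + 1)\<^sup>2"]
    by (metis (no_types, lifting) of_nat_id order_trans)
  then have "real (card (\<Union>t\<in>H. bad t)) \<le> real (card H * (2 * (n + 1)\<^sup>2))" by (rule of_nat_mono)
  also have "\<dots> = real (card H) * (2 * N\<^sup>2)" by (simp add: N_def)
  also have "\<dots> \<le> N * (3 / 2 * S) * (2 * N\<^sup>2)" using cardH by (rule mult_right_mono) simp
  \<comment> \<open>At most N maps, 3/2 S vectors for each (S/2 from earlier blocks, S from later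
    ones), and 2 N^2 indices spoiled by each vector.\<close>
  also have "\<dots> = 3 * N ^ 3 * S" by (simp add: power2_eq_square power3_eq_cube)
  also have "\<dots> < 9 * N ^ 3 * S" using N1(1) S0 by simp
  also have "\<dots> \<le> real (v n)" using v_large[of n] by (simp add: N_def S_def)
  finally have "card (\<Union>t\<in>H. bad t) < card {..<v n}" by simp
  moreover have "(\<Union>t\<in>H. bad t) \<subseteq> {..<v n}" by (auto simp: bad_def)
  ultimately obtain j where j: "j < v n" "j \<notin> (\<Union>t\<in>H. bad t)"
    by (metis lessThan_iff less_irrefl subset_antisym subsetI)
  have gj: "g n j \<in> carr (l2_fin (u n))" "nrm (l2_fin (u n)) (g n j) = 1" using unit[OF j(1)] by auto
  have "\<bar>coord (B i) n (g n j) m l\<bar> \<le> 1 / N" if i: "i < k" and m: "m \<noteq> n" and l: "l < v m" for i m l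
  proof (cases "(i, m, l) \<in> H")
    case True
    then have "j \<notin> bad (i, m, l)" using j(2) by blast
    then show ?thesis
      using j(1) by (simp add: bad_def coord_eq_inner[OF B[OF i] gj(1)] inner_fin_commute)
  next
    case False
    \<comment> \<open>Such a triple belongs to a later block and has a short representing vector, so
      every unit vector gives a small value there.\<close>
    then have "nrm (l2_fin (u n)) (coord_vec (B i) n m l) < 1 / N"
      using i m l by (auto simp: H_def low_def L_def)
    then show ?thesis
      using inner_fin_cauchy_schwarz[of "u n" "g n j" "coord_vec (B i) n m l"] gj(2)
      by (simp add: coord_eq_inner[OF B[OF i] gj(1)])
  qed
  then show ?thesis using j(1) by (auto simp: N_def)
qed

section \<open>Approximation by finite sums, and what it implies for the ideals\<close>

lemma JT_span_approx:
  assumes S: "S \<in> JT M" and "0 < \<epsilon>"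
  shows "\<exists>k A B C. 0 \<le> C \<and> (\<forall>i<k::nat. A i \<in> ops V V \<and> B i \<in> ops U U \<and>
      (\<forall>x\<in>carr U. nrm U (B i x) \<le> nrm U x) \<and> (\<forall>z\<in>carr V. nrm V (A i z) \<le> C * nrm V z)) \<and>
    (\<forall>x\<in>carr U. nrm V (S x - (\<Sum>i<k. A i (T M (B i x)))) \<le> \<epsilon> * nrm U x)"
proof -
  let ?G = "{A \<circ> T M \<circ> B | A B. A \<in> ops V V \<and> B \<in> ops U U}"
  have "span ?G \<subseteq> ops U V"
    using span_ideal[OF UV(1) UV(1) UV(2) UV(2) T_ops] by (auto simp: op_ideal_def)
  then obtain R where R: "R \<in> span ?G" "\<And>x. x \<in> carr U \<Longrightarrow> nrm V (S x - R x) \<le> \<epsilon> * nrm U x"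
    using S \<open>0 < \<epsilon>\<close> unfolding ideal_gen_def by (subst (asm) op_closure_iff[OF UV]) auto
  from span_representation[OF UV(1) UV(1) UV(2) UV(2) T_ops R(1)]
  obtain k A B C where *: "0 \<le> C" "R = (\<Sum>i<k::nat. A i \<circ> T M \<circ> B i)"
    "\<forall>i<k. A i \<in> ops V V \<and> B i \<in> ops U U \<and> (\<forall>x\<in>carr U. nrm U (B i x) \<le> nrm U x) \<and>
       (\<forall>z\<in>carr V. nrm V (A i z) \<le> C * nrm V z)"
    by blast
  then show ?thesis using R(2) by (intro exI[of _ k] exI[of _ A] exI[of _ B] exI[of _ C]) simp
qed

lemma T_notin_JT:
  assumes inf: "infinite (M - N)"
  shows "T M \<notin> JT N"
proof
  assume T: "T M \<in> JT N"
  obtain k A B C where span: "0 \<le> C" "\<forall>i<k::nat. A i \<in> ops V V \<and> B i \<in> ops U U \<and>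
      (\<forall>x\<in>carr U. nrm U (B i x) \<le> nrm U x) \<and> (\<forall>z\<in>carr V. nrm V (A i z) \<le> C * nrm V z)"
    "\<forall>x\<in>carr U. nrm V (T M x - (\<Sum>i<k. A i (T N (B i x)))) \<le> 1/4 * nrm U x"
    using JT_span_approx[OF T, of "1/4"] by auto
  then have C: "0 \<le> C" and A: "\<And>i. i < k \<Longrightarrow> A i \<in> ops V V"
    and B: "\<And>i. i < k \<Longrightarrow> B i \<in> ops U U"
    and contr: "\<And>i x. i < k \<Longrightarrow> x \<in> carr U \<Longrightarrow> nrm U (B i x) \<le> nrm U x"
    and AC: "\<And>i z. i < k \<Longrightarrow> z \<in> carr V \<Longrightarrow> nrm V (A i z) \<le> C * nrm V z"
    and close: "\<And>x. x \<in> carr U \<Longrightarrow> nrm V (T M x - (\<Sum>i<k. A i (T N (B i x)))) \<le> 1/4 * nrm U x"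
    by blast+
  \<comment> \<open>The block is chosen after the approximating sum: \<open>n\<close> is at least
    \<open>k\<close>, as \<open>good_coordinate\<close> requires, and so large that the
    \<open>k\<close> outer factors of bound \<open>C\<close> contribute at most 1/4. With the
    approximation error 1/4 this stays below the value 1 of \<open>T M\<close> at (n, j).\<close>
  obtain n where n: "n \<in> M - N" "k + nat \<lceil>4 * k * C\<rceil> \<le> n"
    using inf unfolding infinite_nat_iff_unbounded_le by blast
  have kC: "real k * C / real (n + 1) \<le> 1/4"
  proof -
    have "4 * real k * C \<le> real (n + 1)" using n(2) by linarith
    then show ?thesis by (simp add: field_simps)
  qed
  obtain j where j: "j < v n" and good: "\<And>i m l. i < k \<Longrightarrow> m \<noteq> n \<Longrightarrow> l < v m \<Longrightarrow>
      \<bar>coord (B i) n (g n j) m l\<bar> \<le> 1 / real (n + 1)"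
    using good_coordinate[of k n B] n(2) B contr by auto
  have gj: "g n j \<in> carr (l2_fin (u n))" "nrm (l2_fin (u n)) (g n j) = 1" using unit[OF j] by auto
  define x where "x = single_block n (g n j)"
  have x: "x \<in> carr U" "nrm U x = 1" using single_block[OF gj(1)] gj(2) by (auto simp: x_def)
  have TV: "T N (B i x) \<in> carr V" for i by (rule ops_in_carr[OF UV(2) T_ops])
  have "\<bar>A i (T N (B i x)) n j\<bar> \<le> C * (1 / real (n + 1))" if i: "i < k" for i
  proof -
    have "nrm V (T N (B i x)) \<le> 1 / real (n + 1)"
    proof (rule V_nrm_le)
      fix m l assume l: "l < v m"
      \<comment> \<open>Block \<open>n\<close> itself is not covered by \<open>good\<close>, but
        \<open>T N\<close> vanishes there because \<open>n\<close> lies outside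
        \<open>N\<close>.\<close>
      show "\<bar>T N (B i x) m l\<bar> \<le> 1 / real (n + 1)"
        unfolding T_apply[OF ops_carr[OF B[OF i] x(1)]]
        using good[OF i _ l] n(1) by (auto simp: coord_def x_def)
    qed simp
    then have "nrm V (A i (T N (B i x))) \<le> C * (1 / real (n + 1))"
      using AC[OF i TV, of i] C by (meson mult_left_mono order_trans)
    then show ?thesis using V_abs_le[OF ops_carr[OF A[OF i] TV], of i n j] by linarith
  qed
  then have "\<bar>\<Sum>i<k. A i (T N (B i x)) n j\<bar> \<le> (\<Sum>i<k. C * (1 / real (n + 1)))"
    by (intro order_trans[OF sum_abs sum_mono]) auto
  also have "\<dots> = real k * C / real (n + 1)" by simp
  also have "\<dots> \<le> 1/4" by (rule kC)
  finally have small: "\<bar>\<Sum>i<k. A i (T N (B i x)) n j\<bar> \<le> 1/4" .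
  have "T M x - (\<Sum>i<k. A i (T N (B i x))) \<in> carr V"
    using ops_carr[OF T_ops x(1)] ops_carr[OF A TV] V.carr_subspace
    by (intro subspace_diff subspace_sum) auto
  from V_abs_le[OF this, of n j] have "\<bar>T M x n j - (\<Sum>i<k. A i (T N (B i x)) n j)\<bar> \<le> 1/4"
    using close[OF x(1)] x(2) by simp
  moreover have "T M x n j = 1"
    using n(1) j gj(2) by (simp add: T_apply[OF x(1)]) (simp add: x_def single_block_def inner_fin_self)
  ultimately show False using small by linarith
qed

text \<open>In block \<open>m\<close>, Bessel bounds the number of unit coordinates by twice the
  square of the block norm \<open>a m\<close>. A block with such a coordinate has \<open>a m\<close>
  at least 1, so that square is at most \<open>nrm U y * a m powr p\<close>, which can be summed
  over \<open>m\<close>; hence the exponent p + 1 for every p. Starting at block \<open>n0\<close>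
  makes 19 (n0 + 1)^2 indices admissible in all blocks concerned.\<close>

lemma card_unit_coords_le:
  assumes y: "y \<in> carr U" and J: "finite J" "card J \<le> 19 * (n0 + 1)\<^sup>2"
    and coords: "\<And>m l. (m, l) \<in> J \<Longrightarrow> n0 \<le> m \<and> l < v m \<and> \<bar>inner_fin (u m) (y m) (g m l)\<bar> = 1"
  shows "real (card J) \<le> 2 * nrm U y powr (p + 1)"
proof -
  define D where "D = fst ` J"
  define a where "a m = nrm (l2_fin (u m)) (y m)" for m
  have D: "finite D" using J(1) by (simp add: D_def)
  have fib: "finite (J `` {m})" for m using J(1) by (rule finite_Image)
  have "J = (SIGMA m:D. J `` {m})" by (force simp: D_def)
  then have "card J = (\<Sum>m\<in>D. card (J `` {m}))" using card_SigmaI[OF D, of "\<lambda>m. J `` {m}"] fib by simp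
  then have "real (card J) = (\<Sum>m\<in>D. real (card (J `` {m})))" by simp
  also have "\<dots> \<le> (\<Sum>m\<in>D. 2 * (nrm U y * a m powr p))"
  proof (rule sum_mono)
    fix m assume "m \<in> D"
    then obtain l where l: "(m, l) \<in> J" by (auto simp: D_def)
    have am: "1 \<le> a m" using coords[OF l] inner_g_le[of l m "y m"] by (simp add: a_def)
    have "card (J `` {m}) \<le> card J"
      using card_mono[OF J(1), of "{m} \<times> (J `` {m})"] by (auto simp: card_cartesian_product_singleton)
    also have "\<dots> \<le> 19 * (m + 1)\<^sup>2"
      using J(2) coords[OF l] by (meson add_le_mono1 le_trans mult_le_mono2 power_mono zero_le)
    finally have "real (card (J `` {m})) \<le> real (19 * (m + 1)\<^sup>2)" by (rule of_nat_mono)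
    then have "(\<Sum>l\<in>J `` {m}. \<bar>inner_fin (u m) (y m) (g m l)\<bar>\<^sup>2) \<le> 2 * (a m)\<^sup>2"
      unfolding a_def using coords U_block(1)[OF p y] by (intro bessel) auto
    moreover have "(\<Sum>l\<in>J `` {m}. \<bar>inner_fin (u m) (y m) (g m l)\<bar>\<^sup>2) = (\<Sum>l\<in>J `` {m}. 1)"
      using coords by (intro sum.cong) auto
    ultimately have "real (card (J `` {m})) \<le> 2 * (a m * a m)" by (simp add: power2_eq_square)
    also have "\<dots> \<le> 2 * (nrm U y * a m powr p)"
    proof -
      have "a m powr 1 \<le> a m powr p" using am p by (intro powr_mono) auto
      moreover have "a m \<le> nrm U y" unfolding a_def by (rule U_block(2)[OF p y])
      ultimately show ?thesis using am by (intro mult_left_mono mult_mono) auto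
    qed
    finally show "real (card (J `` {m})) \<le> 2 * (nrm U y * a m powr p)" .
  qed
  also have "\<dots> = 2 * nrm U y * (\<Sum>m\<in>D. a m powr p)" by (simp add: sum_distrib_left mult.assoc)
  also have "\<dots> \<le> 2 * nrm U y * nrm U y powr p"
    unfolding a_def using U_finite_sum[OF p y D] U.nrm_nonneg[OF y] by (intro mult_left_mono) auto
  also have "\<dots> = 2 * nrm U y powr (p + 1)"
    using U.nrm_nonneg[OF y] by (simp add: powr_add)
  finally show ?thesis .
qed

lemma JT_fin_strictly_singular: "JT M \<subseteq> fin_strictly_singular U V"
proof
  fix S assume S: "S \<in> JT M"
  then have Sops: "S \<in> ops U V" using closed_ideal_ops[OF JT_closed_ideal] by blast
  have "\<exists>n::nat. \<forall>E. subspace E \<and> E \<subseteq> carr U \<and> (\<exists>B\<subseteq>E. finite B \<and> independent B \<and> card B = n)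
     \<longrightarrow> (\<exists>x\<in>E. nrm V (S x) < \<epsilon> * nrm U x)" if "0 < \<epsilon>" for \<epsilon>
  proof -
    obtain k A B C where span: "0 \<le> C" "\<forall>i<k::nat. A i \<in> ops V V \<and> B i \<in> ops U U \<and>
      (\<forall>x\<in>carr U. nrm U (B i x) \<le> nrm U x) \<and> (\<forall>z\<in>carr V. nrm V (A i z) \<le> C * nrm V z)"
    "\<forall>x\<in>carr U. nrm V (S x - (\<Sum>i<k. A i (T M (B i x)))) \<le> (\<epsilon>/2) * nrm U x"
    using JT_span_approx[OF S half_gt_zero[OF \<open>0 < \<epsilon>\<close>]] by blast
  then have C: "0 \<le> C" and A: "\<And>i. i < k \<Longrightarrow> A i \<in> ops V V"
    and B: "\<And>i. i < k \<Longrightarrow> B i \<in> ops U U"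
    and contr: "\<And>i x. i < k \<Longrightarrow> x \<in> carr U \<Longrightarrow> nrm U (B i x) \<le> nrm U x"
    and AC: "\<And>i z. i < k \<Longrightarrow> z \<in> carr V \<Longrightarrow> nrm V (A i z) \<le> C * nrm V z"
    and close: "\<And>x. x \<in> carr U \<Longrightarrow> nrm V (S x - (\<Sum>i<k. A i (T M (B i x)))) \<le> (\<epsilon>/2) * nrm U x"
    by blast+
    \<comment> \<open>For \<open>x\<close> of norm above \<open>\<rho>\<close>, half of
      \<open>\<epsilon>\<close> times that norm exceeds k C, the bound of the finite sum when all
      coordinates are at most 1 in modulus.\<close>
    define \<rho> where "\<rho> = 2 * (real k * C + 1) / \<epsilon>"
    \<comment> \<open>This many unit coordinates in one \<open>B i x\<close> force its norm above
      \<open>\<rho>\<close>. The same number of initial blocks is annihilated below.\<close>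
    define r where "r = nat \<lceil>2 * \<rho> powr (p + 1)\<rceil> + 1"
    have r: "2 * \<rho> powr (p + 1) < real r" unfolding r_def by linarith
    \<comment> \<open>The coordinates in the first \<open>r\<close> blocks. On their common kernel
      all unit coordinates lie in blocks from \<open>r\<close> on, where sets of \<open>r\<close>
      indices are admissible.\<close>
    define H where "H = {..<k} \<times> (SIGMA m:{..<r}. {..<v m})"
    have H: "finite H" by (simp add: H_def)
    \<comment> \<open>By the pigeonhole principle, \<open>q\<close> unit coordinates distributed
      over \<open>k\<close> maps leave some map with at least \<open>r\<close> of them.\<close>
    define q where "q = k * r + 1"
    \<comment> \<open>The value 0 for \<open>i\<close> from \<open>k\<close> on keeps
      \<open>f\<close> linear with finitely many large values over all triples, as
      \<open>milman\<close> demands of the whole index type.\<close>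
    define f where "f = (\<lambda>(i, m, l) x. if i < k then T M (B i x) m l else 0)"
    have TV: "T M (B i x) \<in> carr V" for i x by (rule ops_in_carr[OF UV(2) T_ops])
    have f_add: "f t (x + y) = f t x + f t y" if "x \<in> carr U" "y \<in> carr U" for t x y
      using ops_add[OF B that] ops_add[OF T_ops ops_carr[OF B that(1)] ops_carr[OF B that(2)]]
      by (auto simp: f_def split: prod.split)
    have f_scale: "f t (c *\<^sub>R x) = c * f t x" if "x \<in> carr U" for t c x
      using ops_scale[OF B that] ops_scale[OF T_ops ops_carr[OF B that]]
      by (auto simp: f_def split: prod.split)
    have final: "nrm V (S x) < \<epsilon> * nrm U x"
      if x: "x \<in> carr U" and R: "(\<Sum>i<k. nrm V (A i (T M (B i x)))) < \<epsilon> / 2 * nrm U x" for x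
    proof -
      have AV: "A i (T M (B i x)) \<in> carr V" if "i < k" for i using ops_carr[OF A[OF that] TV] .
      then have RV: "(\<Sum>i<k. A i (T M (B i x))) \<in> carr V" using V.carr_subspace by (intro subspace_sum) auto
      have "nrm V (\<Sum>i<k. A i (T M (B i x))) \<le> (\<Sum>i<k. nrm V (A i (T M (B i x))))"
        using AV by (intro V.nrm_sum_le) auto
      moreover have "nrm V (S x) \<le> nrm V (S x - (\<Sum>i<k. A i (T M (B i x)))) + nrm V (\<Sum>i<k. A i (T M (B i x)))"
        using V.nrm_triangle[OF subspace_diff[OF V.carr_subspace ops_carr[OF Sops x] RV] RV]
        by (simp only: diff_add_cancel)
      ultimately show ?thesis using close[OF x] R by linarith
    qed
    have "\<exists>x\<in>E. nrm V (S x) < \<epsilon> * nrm U x"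
      if E: "subspace E" "E \<subseteq> carr U" and Q: "Q \<subseteq> E" "finite Q" "independent Q" "card Q = card H + q" for E Q
    proof -
      define E' where "E' = {x \<in> E. \<forall>t\<in>H. f t x = 0}"
      have f0: "f t 0 = 0" for t using f_scale[OF U.carr_zero, of t 0] by simp
      have E': "subspace E'"
        using E f0 f_add f_scale unfolding E'_def subspace_def by (auto simp: subset_iff)
      have E'U: "E' \<subseteq> carr U" using E by (auto simp: E'_def)
      show ?thesis
      \<comment> \<open>Milman's lemma needs directions with a nonzero coordinate. A nonzero vector
        all of whose coordinates vanish is killed by the finite sum, and then the approximation
        error alone settles the claim.\<close>
      proof (cases "\<exists>y\<in>E'. y \<noteq> 0 \<and> (\<forall>t. f t y = 0)")
        case True
        then obtain y where y: "y \<in> E'" "y \<noteq> 0" "\<And>t. f t y = 0" by blast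
        have "A i (T M (B i y)) = 0" if "i < k" for i
        proof -
          have "T M (B i y) m l = 0" for m l using y(3)[of "(i, m, l)"] that by (simp add: f_def)
          then have "T M (B i y) = 0" by (simp add: fun_eq_iff)
          then show ?thesis using ops_zero[OF UV(2) A[OF that]] by simp
        qed
        then have "(\<Sum>i<k. nrm V (A i (T M (B i y)))) = 0" using V.nrm_zero by simp
        moreover have "y \<in> carr U" "y \<in> E" using y(1) E'U by (auto simp: E'_def)
        moreover have "0 < nrm U y" using U_nrm_pos[OF p \<open>y \<in> carr U\<close> y(2)] .
        ultimately show ?thesis using final[of y] \<open>0 < \<epsilon>\<close> by (intro bexI[of _ y]) auto
      next
        case False
        have "\<exists>x\<in>E'. \<exists>J. finite J \<and> card J = q \<and> (\<forall>t\<in>J. \<bar>f t x\<bar> = 1) \<and> (\<forall>t. \<bar>f t x\<bar> \<le> 1)"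
        proof (rule milman[OF E'])
          show "f t (x + y) = f t x + f t y" if "x \<in> E'" "y \<in> E'" for t x y
            using f_add that E'U by blast
          show "f t (c *\<^sub>R x) = c * f t x" if "x \<in> E'" for t c x
            using f_scale that E'U by blast
          show "finite {t. \<delta> \<le> \<bar>f t x\<bar>}" if "x \<in> E'" "0 < \<delta>" for x \<delta>
          proof -
            have "{t. \<delta> \<le> \<bar>f t x\<bar>} \<subseteq> (SIGMA i:{..<k}. {(m, l). \<delta> \<le> \<bar>T M (B i x) m l\<bar>})"
              using \<open>0 < \<delta>\<close> by (auto simp: f_def split: if_splits)
            moreover have "finite (SIGMA i:{..<k}. {(m, l). \<delta> \<le> \<bar>T M (B i x) m l\<bar>})"
              using V_finite_large[OF TV \<open>0 < \<delta>\<close>] by (intro finite_SigmaI) auto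
            ultimately show ?thesis by (rule finite_subset)
          qed
          fix J :: "(nat \<times> nat \<times> nat) set"
          assume J: "finite J" "card J < q"
          \<comment> \<open>The dimension \<open>card H + q\<close> leaves room for the equations
            from \<open>H\<close> and for up to q - 1 prescribed coordinates.\<close>
          have "card (H \<union> J) < card Q" using card_Un_le[of H J] J(2) Q(4) by simp
          then have "\<exists>y\<in>E. y \<noteq> 0 \<and> (\<forall>t\<in>H \<union> J. f t y = 0)"
            using H J(1) f_add f_scale E(2)
            by (intro common_kernel[OF E(1) Q(1,2,3)]) (auto simp: subset_iff)
          then obtain y where "y \<in> E" "y \<noteq> 0" "\<forall>t\<in>H \<union> J. f t y = 0" by blast
          then show "\<exists>y\<in>E'. (\<exists>t. f t y \<noteq> 0) \<and> (\<forall>t\<in>J. f t y = 0)"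
            using False by (intro bexI[of _ y]) (auto simp: E'_def)
        qed
        then obtain x J where x: "x \<in> E'" and J: "finite J" "card J = q"
          and J1: "\<And>t. t \<in> J \<Longrightarrow> \<bar>f t x\<bar> = 1" and le1: "\<And>t. \<bar>f t x\<bar> \<le> 1" by blast
        have xU: "x \<in> carr U" using x E'U by blast
        have ik: "i < k" if "(i, m, l) \<in> J" for i m l
          using J1[OF that] by (auto simp: f_def split: if_splits)
        have "\<exists>i<k. r \<le> card (J `` {i})"
        proof (rule ccontr)
          assume "\<not> ?thesis"
          then have less: "card (J `` {i}) \<le> r" if "i < k" for i using that by force
          have "J = (SIGMA i:{..<k}. J `` {i})" using ik by auto
          then have "card J = (\<Sum>i<k. card (J `` {i}))"
            using card_SigmaI[of "{..<k}" "\<lambda>i. J `` {i}"] finite_Image[OF J(1)] by simp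
          also have "\<dots> \<le> (\<Sum>i<k. r)" using less by (intro sum_mono) auto
          finally show False using J(2) by (simp add: q_def)
        qed
        then obtain i where i: "i < k" "r \<le> card (J `` {i})" by blast
        then obtain G where G: "G \<subseteq> J `` {i}" "card G = r" by (meson obtain_subset_with_card_n)
        have Bx: "B i x \<in> carr U" by (rule ops_carr[OF B[OF i(1)] xU])
        have "real (card G) \<le> 2 * nrm U (B i x) powr (p + 1)"
        proof (rule card_unit_coords_le[OF Bx])
          show "finite G" using G(1) finite_Image[OF J(1)] finite_subset by blast
          have "r \<le> (r + 1)\<^sup>2" by (simp add: power2_eq_square)
          then show "card G \<le> 19 * (r + 1)\<^sup>2" unfolding G(2) by linarith
          fix m l assume "(m, l) \<in> G"
          then have t: "(i, m, l) \<in> J" using G(1) by auto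
          then have "(i, m, l) \<notin> H" using J1 x by (force simp: E'_def)
          moreover have "m \<in> M \<and> l < v m \<and> \<bar>inner_fin (u m) (B i x m) (g m l)\<bar> = 1"
            using J1[OF t] i(1) by (auto simp: f_def T_apply[OF Bx] split: if_splits)
          ultimately show "r \<le> m \<and> l < v m \<and> \<bar>inner_fin (u m) (B i x m) (g m l)\<bar> = 1"
            using i(1) by (auto simp: H_def)
        qed
        then have "2 * \<rho> powr (p + 1) < 2 * nrm U (B i x) powr (p + 1)" using r G(2) by simp
        then have "\<rho> < nrm U (B i x)"
          using powr_mono2[of "p + 1" "nrm U (B i x)" \<rho>] p U.nrm_nonneg[OF Bx] by fastforce
        then have \<rho>: "\<rho> < nrm U x" using contr[OF i(1) xU] by linarith
        have "(\<Sum>i<k. nrm V (A i (T M (B i x)))) \<le> (\<Sum>i<k. C)"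
        proof (rule sum_mono)
          fix i assume i: "i \<in> {..<k}"
          have "nrm V (T M (B i x)) \<le> 1"
            using le1[of "(i, _, _)"] i by (intro V_nrm_le) (auto simp: f_def)
          then show "nrm V (A i (T M (B i x))) \<le> C"
            using AC[OF _ TV, of i i x] i C mult_left_mono[of "nrm V (T M (B i x))" 1 C] by auto
        qed
        also have "\<dots> < real k * C + 1" by simp
        also have "\<dots> = \<epsilon> / 2 * \<rho>" using \<open>0 < \<epsilon>\<close> by (simp add: \<rho>_def)
        also have "\<dots> < \<epsilon> / 2 * nrm U x" using \<rho> \<open>0 < \<epsilon>\<close> by simp
        finally show ?thesis using final[OF xU] x by (intro bexI[of _ x]) (auto simp: E'_def)
      qed
    qed
    then show ?thesis by (intro exI[of _ "card H + q"]) blast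
  qed
  then show "S \<in> fin_strictly_singular U V" using Sops unfolding fin_strictly_singular_def by blast
qed

end

section \<open>The map from the Boolean algebra\<close>

lemma mod_fin_eq_iff: "mod_fin M = mod_fin N \<longleftrightarrow> finite ((M - N) \<union> (N - M))"
  by transfer simp

lemma mod_fin_le_iff: "mod_fin M \<le> mod_fin N \<longleftrightarrow> finite (M - N)"
  by transfer simp

lemma sup_mod_fin: "sup (mod_fin M) (mod_fin N) = mod_fin (M \<union> N)"
  by transfer simp

lemma surj_mod_fin: "surj mod_fin"
proof -
  have "\<exists>M. a = mod_fin M" for a
  proof (transfer)
    show "\<exists>M. finite ((a - M) \<union> (M - a))" for a :: "nat set"
      by (rule exI[of _ a]) simp
  qed
  then show ?thesis unfolding surj_def by blast
qed

text \<open>Surjectivity of \<open>mod_fin\<close> gives one direction. For the other, each point of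
  a set is replaced by an infinite column of the grid, so that distinct sets differ at infinitely
  many points.\<close>

lemma natset_mod_fin_eqpoll: "(UNIV :: natset_mod_fin set) \<approx> (UNIV :: nat set set)"
proof (rule lepoll_antisym)
  show "(UNIV :: natset_mod_fin set) \<lesssim> (UNIV :: nat set set)"
    using image_lepoll[of mod_fin UNIV] surj_mod_fin by simp
  define code where "code A = prod_encode ` (A \<times> UNIV)" for A :: "nat set"
  have "A \<subseteq> A'" if "mod_fin (code A) = mod_fin (code A')" for A A'
  proof
    fix a assume "a \<in> A"
    show "a \<in> A'"
    proof (rule ccontr)
      assume "a \<notin> A'"
      then have "range (\<lambda>b. prod_encode (a, b)) \<subseteq> code A - code A'"
        using \<open>a \<in> A\<close> by (auto simp: code_def)
      moreover have "infinite (range (\<lambda>b. prod_encode (a, b)))"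
        by (rule range_inj_infinite) (simp add: inj_def)
      ultimately show False using that finite_subset unfolding mod_fin_eq_iff by blast
    qed
  qed
  then have "inj (\<lambda>A. mod_fin (code A))"
    by (metis (no_types, lifting) injI subset_antisym)
  then show "(UNIV :: nat set set) \<lesssim> (UNIV :: natset_mod_fin set)"
    unfolding lepoll_def by blast
qed

section \<open>Order, joins and cardinality of the family of ideals\<close>

context block_setting
begin

definition \<Phi> :: "nat set \<Rightarrow> ((nat \<Rightarrow> nat \<Rightarrow> real) \<Rightarrow> (nat \<Rightarrow> nat \<Rightarrow> real)) set" where
  "\<Phi> M = (if infinite M then JT M else JI)"

lemma \<Phi>_closed_ideal: "\<Phi> M \<in> closed_ideals U V"
  by (simp add: \<Phi>_def JI_closed_ideal JT_closed_ideal)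

lemma JI_subset_\<Phi>: "JI \<subseteq> \<Phi> M"
  by (simp add: \<Phi>_def JI_subset_JT)

lemma \<Phi>_fin_strictly_singular: "\<Phi> M \<subseteq> fin_strictly_singular U V"
  using JT_fin_strictly_singular JI_subset_JT[of UNIV] by (auto simp: \<Phi>_def)

text \<open>Well-definedness, injectivity and monotonicity all follow from this one equivalence,
  because equality of ideals and equality of classes are both two-sided comparisons.\<close>

lemma \<Phi>_subset_iff: "\<Phi> M \<subseteq> \<Phi> N \<longleftrightarrow> finite (M - N)"
proof
  assume fin: "finite (M - N)"
  show "\<Phi> M \<subseteq> \<Phi> N"
  proof (cases "infinite N")
    case True
    then show ?thesis using JT_mono[OF True fin] JI_subset_JT[OF True] by (simp add: \<Phi>_def)
  next
    case False
    then have "finite M" using fin by (metis Diff_infinite_finite)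
    then show ?thesis using False by (simp add: \<Phi>_def)
  qed
next
  assume sub: "\<Phi> M \<subseteq> \<Phi> N"
  show "finite (M - N)"
  proof (rule ccontr)
    assume inf: "infinite (M - N)"
    then have M: "infinite M" by (metis finite_Diff)
    \<comment> \<open>For finite \<open>N\<close> the ideal is \<open>JI\<close>, to which
      \<open>T_notin_JT\<close> does not apply directly. It is enlarged to \<open>JT N'\<close>,
      where \<open>N'\<close> takes every other element of \<open>M\<close>, so that
      \<open>M - N'\<close> stays infinite.\<close>
    obtain N' where N': "infinite N'" "infinite (M - N')" "\<Phi> N \<subseteq> JT N'"
    proof (cases "infinite N")
      case True
      then show ?thesis using inf that[of N] by (simp add: \<Phi>_def)
    next
      case False
      define e where "e = enumerate M"
      have e: "strict_mono e" "\<And>n. e n \<in> M"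
        using strict_mono_enumerate[OF M] enumerate_in_set[OF M] by (auto simp: e_def)
      have eq: "e a = e b \<longleftrightarrow> a = b" for a b using strict_mono_eq[OF e(1)] .
      define N' where "N' = range (\<lambda>n. e (2 * n))"
      have "range (\<lambda>n. e (2 * n + 1)) \<subseteq> M - N'"
        using e(2) by (auto simp: N'_def eq) presburger
      moreover have "infinite (range (\<lambda>n. e (2 * n + 1)))" "infinite N'"
        unfolding N'_def by (rule range_inj_infinite; simp add: inj_def eq)+
      ultimately have "infinite N'" "infinite (M - N')" using finite_subset by blast+
      then show ?thesis using that[of N'] False JI_subset_JT[of N'] by (simp add: \<Phi>_def)
    qed
    have "T M \<in> \<Phi> M" using M T_subset_in_JT[of M M] by (simp add: \<Phi>_def)
    then show False using sub N'(3) T_notin_JT[OF N'(2)] by blast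
  qed
qed

lemma \<Phi>_join: "\<Phi> (M \<union> N) = ideal_join U V (\<Phi> M) (\<Phi> N)"
proof (cases "infinite M \<and> infinite N")
  case True
  then show ?thesis by (simp add: \<Phi>_def JT_join)
next
  case False
  \<comment> \<open>If one of the sets is finite, the union exceeds the other by finitely many
    elements only.\<close>
  have "\<Phi> (M \<union> N) \<subseteq> \<Phi> M \<or> \<Phi> (M \<union> N) \<subseteq> \<Phi> N"
    using False by (auto simp: \<Phi>_subset_iff Un_Diff)
  then have "\<Phi> (M \<union> N) \<subseteq> ideal_join U V (\<Phi> M) (\<Phi> N)"
    using ideal_join_upper[OF UV \<Phi>_closed_ideal \<Phi>_closed_ideal] by blast
  moreover have "ideal_join U V (\<Phi> M) (\<Phi> N) \<subseteq> \<Phi> (M \<union> N)"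
  proof (rule ideal_join_least[OF \<Phi>_closed_ideal])
    have "M - (M \<union> N) = {}" "N - (M \<union> N) = {}" by auto
    then show "\<Phi> M \<subseteq> \<Phi> (M \<union> N)" "\<Phi> N \<subseteq> \<Phi> (M \<union> N)"
      unfolding \<Phi>_subset_iff by (simp_all only: finite.emptyI)
  qed
  ultimately show ?thesis by (rule antisym)
qed

lemma ideal_lattice_embedding:
  "\<exists>\<phi> :: natset_mod_fin \<Rightarrow> ((nat \<Rightarrow> nat \<Rightarrow> real) \<Rightarrow> (nat \<Rightarrow> nat \<Rightarrow> real)) set.
     (\<forall>M. \<phi> (mod_fin M) = (if infinite M then JT M else JI)) \<and>
     range \<phi> \<subseteq> closed_ideals U V \<and> inj \<phi> \<and> mono \<phi> \<and>
     (\<forall>a b. \<phi> (sup a b) = ideal_join U V (\<phi> a) (\<phi> b))"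
  (is ?embedding)
  and continuum_many_ideals:
  "\<exists>\<F>. \<F> \<subseteq> {\<J> \<in> closed_ideals U V. JI \<subseteq> \<J> \<and> \<J> \<subseteq> fin_strictly_singular U V} \<and>
     \<F> \<approx> (UNIV :: nat set set)"
  (is ?continuum)
proof -
  \<comment> \<open>\<open>inv mod_fin\<close> picks an arbitrary representative of the class; by
    \<open>\<Phi>_subset_iff\<close> the choice does not matter.\<close>
  define \<phi> where "\<phi> a = \<Phi> (inv mod_fin a)" for a
  have \<phi>: "\<phi> (mod_fin M) = \<Phi> M" for M
  proof -
    have "mod_fin (inv mod_fin (mod_fin M)) = mod_fin M" by (rule surj_f_inv_f[OF surj_mod_fin])
    then have "finite (inv mod_fin (mod_fin M) - M)" "finite (M - inv mod_fin (mod_fin M))"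
      by (auto simp: mod_fin_eq_iff)
    then show ?thesis unfolding \<phi>_def by (intro antisym) (simp_all add: \<Phi>_subset_iff)
  qed
  have rep: "\<exists>M. a = mod_fin M" for a using surj_mod_fin by (auto simp: surj_def)
  have le: "\<phi> a \<subseteq> \<phi> b \<longleftrightarrow> a \<le> b" for a b
  proof -
    obtain M N where "a = mod_fin M" "b = mod_fin N" using rep by metis
    then show ?thesis by (simp add: \<phi> \<Phi>_subset_iff mod_fin_le_iff)
  qed
  have inj: "inj \<phi>"
  proof (rule injI)
    fix a b assume "\<phi> a = \<phi> b"
    then show "a = b" using le[of a b] le[of b a] by (simp add: antisym)
  qed
  have join: "\<phi> (sup a b) = ideal_join U V (\<phi> a) (\<phi> b)" for a b
  proof -
    obtain M N where "a = mod_fin M" "b = mod_fin N" using rep by metis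
    then show ?thesis by (simp add: \<phi> sup_mod_fin \<Phi>_join)
  qed
  have mono: "mono \<phi>" using le by (auto intro: monoI)
  have range: "range \<phi> \<subseteq> closed_ideals U V" using \<Phi>_closed_ideal by (auto simp: \<phi>_def)
  have "\<forall>M. \<phi> (mod_fin M) = (if infinite M then JT M else JI)" by (simp only: \<phi> \<Phi>_def) simp
  with range inj mono join show ?embedding by blast
  have "range \<phi> \<approx> (UNIV :: nat set set)"
    using inj_on_image_eqpoll_self[OF inj] natset_mod_fin_eqpoll by (rule eqpoll_trans)
  moreover have "range \<phi> \<subseteq> {\<J> \<in> closed_ideals U V. JI \<subseteq> \<J> \<and> \<J> \<subseteq> fin_strictly_singular U V}"
    by (rule image_subsetI) (simp add: \<phi>_def \<Phi>_closed_ideal JI_subset_\<Phi> \<Phi>_fin_strictly_singular)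
  ultimately show ?continuum by blast
qed

end

theorem theorem2:
  fixes p :: real
    and u v :: "nat \<Rightarrow> nat"
    and g :: "nat \<Rightarrow> nat \<Rightarrow> nat \<Rightarrow> real"
  assumes p: "1 \<le> p"
    and pos: "0 < u 0"
    and interlaced: "\<And>n. u n < v n \<and> v n < u (Suc n)"
    and unit: "\<And>n i. i < v n \<Longrightarrow> g n i \<in> carr (l2_fin (u n)) \<and> nrm (l2_fin (u n)) (g n i) = 1"
    and u_large: "\<And>n. u n \<ge> 19 * (n + 1) ^ 3 * (6 * (n + 1) + 1) ^ (\<Sum>k<n. u k)"
    and v_large: "\<And>n. real (v n) \<ge> 9 * real (n + 1) ^ 3 * s_seq p u (n + 1)"
    and riesz: "\<And>n J a. J \<subseteq> {..<v n} \<Longrightarrow>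
        real (card J) \<le> max (s_seq p u n + 1) (19 * real (n + 1) ^ 2) \<Longrightarrow>
        1/2 * (\<Sum>i\<in>J. \<bar>a i\<bar>\<^sup>2) \<le> (nrm (l2_fin (u n)) (\<Sum>i\<in>J. a i *\<^sub>R g n i))\<^sup>2 \<and>
        (nrm (l2_fin (u n)) (\<Sum>i\<in>J. a i *\<^sub>R g n i))\<^sup>2 \<le> 2 * (\<Sum>i\<in>J. \<bar>a i\<bar>\<^sup>2)"
    and bessel: "\<And>n J x. J \<subseteq> {..<v n} \<Longrightarrow>
        real (card J) \<le> max (s_seq p u n + 1) (19 * real (n + 1) ^ 2) \<Longrightarrow>
        x \<in> carr (l2_fin (u n)) \<Longrightarrow>
        (\<Sum>i\<in>J. \<bar>inner_fin (u n) x (g n i)\<bar>\<^sup>2) \<le> 2 * (nrm (l2_fin (u n)) x)\<^sup>2"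
  shows "(let U = U_space p u; V = V_space v;
              T = T_op p u v g; I = formal_incl p u v
          in (\<exists>\<phi> :: natset_mod_fin \<Rightarrow> ((nat \<Rightarrow> nat \<Rightarrow> real) \<Rightarrow> (nat \<Rightarrow> nat \<Rightarrow> real)) set.
                (\<forall>M. \<phi> (mod_fin M) =
                   (if infinite M then ideal_gen U V (T M) U V else ideal_gen U V I U V)) \<and>
                range \<phi> \<subseteq> closed_ideals U V \<and>
                inj \<phi> \<and>
                mono \<phi> \<and>
                (\<forall>a b. \<phi> (sup a b) = ideal_join U V (\<phi> a) (\<phi> b))) \<and>
             (\<exists>\<F>. \<F> \<subseteq> {\<J> \<in> closed_ideals U V.
                     ideal_gen U V I U V \<subseteq> \<J> \<and> \<J> \<subseteq> fin_strictly_singular U V} \<and>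
                   \<F> \<approx> (UNIV :: nat set set)))"
proof -
  interpret block_setting p u v g
    by unfold_locales (fact p pos interlaced unit v_large riesz bessel)+
  show ?thesis
    unfolding Let_def by (rule conjI[OF ideal_lattice_embedding continuum_many_ideals])
qed

end
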